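(* Let $\{S_n\}$ be a random walk with random environment $\mu$ in time, with $S_0=0$, $\mathbf{E}(M_1)=0$, $\mathbf{E}(\eta_1)=1$ and $\sigma^2:=\mathbf{E}(M_1^2)$. If $\mathbf{E}\big((\mathbf{E}_\mu|S_1|^\alpha)^2\big)<+\infty$ for some $\alpha>2$, then for any bounded Lipschitz functional $f$ on $C[0,1]$ (with respect to the uniform norm), $$\mathbf{E}_\mu(f(S_{(n)}))\ \xrightarrow{\ d\ }\ \mathbf{E}(f(B+\sigma W)\mid W)\quad\text{as } n\to\infty,$$ where $B$ and $W$ are independent standard Brownian motions and $\xrightarrow{d}$ denotes convergence in distribution of real random variables.
   Context: Random walk with random environment in time: $\mu=\{\mu_n\}_{n\ge1}$ is an i.i.d. sequence of random probability measures on $\mathbb{R}$. Conditionally on a realization of $\mu$, $\{X_n\}_{n\ge1}$ are independent real random variables such that $X_n$ has law $\mu_n$. Put $S_0=0$, $S_n=\sum_{i=1}^nX_i$. $\mathbf{P}_\mu$ (expectation $\mathbf{E}_\mu$) is the law of $\{S_n\}$ conditionally on $\mu$ (quenched law), and $\mathbf{P}$ (expectation $\mathbf{E}$) is the joint law of $\{S_n\}$ and $\mu$ (annealed law). The random variable $\mathbf{E}_\mu(f(S_{(n)}))$ is a function of $\mu$ and its distribution is taken under $\mathbf{P}$. Notation: $M_n:=\mathbf{E}_\mu(S_n)$, $U_n:=S_n-\mathbf{E}_\mu(S_n)$, $\eta_n:=\mathbf{E}_\mu(U_n^2)=\mathbf{E}_\mu(S_n^2)-M_n^2$. $S_{(n)}\in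 C[0,1]$ is the rescaled random broken line $$S_{(n)}(t):=\frac{S_{\lfloor tn\rfloor}+(tn-\lfloor tn\rfloor)(S_{\lfloor tn\rfloor+1}-S_{\lfloor tn\rfloor})}{\sqrt n},\quad t\in[0,1].$$ $B+\sigma W$ denotes the random path $t\mapsto B_t+\sigma W_t$ in $C[0,1]$, where $B,W$ are independent standard Brownian motions with $B_0=W_0=0$. *)

theory Defs
  imports "HOL-Probability.Probability"
begin

definition generated_algebra ::
  "'a measure \<Rightarrow> 'i set \<Rightarrow> 'b measure \<Rightarrow> ('i \<Rightarrow> 'a \<Rightarrow> 'b) \<Rightarrow> 'a measure"
  where "generated_algebra M I K Y =
    vimage_algebra (space M) (\<lambda>\<omega>. \<lambda>i\<in>I. Y i \<omega>) (\<Pi>\<^sub>M i\<in>I. K)"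

text \<open>Both the environment and the steps are indexed by the integers from 1 on; the values at
  index 0 are irrelevant. The measure \<open>M\<close> carries the joint (annealed) law. The last
  axiom says that, conditionally on the environment, the steps are independent and
  the \<open>n\<close>-th one has law \<open>\<mu> n\<close>.\<close>

locale random_walk_in_random_environment = prob_space M
  for M :: "'a measure" +
  fixes \<mu> :: "nat \<Rightarrow> 'a \<Rightarrow> real measure"
    and X :: "nat \<Rightarrow> 'a \<Rightarrow> real"
  assumes indep_env: "indep_vars (\<lambda>_. prob_algebra borel) \<mu> {1..}"
    and ident_env: "\<And>n. n \<ge> 1 \<Longrightarrow>
      distr M (prob_algebra borel) (\<mu> n) = distr M (prob_algebra borel) (\<mu> 1)"
    and step_measurable: "\<And>n. n \<ge> 1 \<Longrightarrow> X n \<in> borel_measurable M"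
    and cond_indep_steps: "\<And>J A. finite J \<Longrightarrow> J \<subseteq> {1..} \<Longrightarrow> (\<And>i. i \<in> J \<Longrightarrow> A i \<in> sets borel) \<Longrightarrow>
      AE \<omega> in M. real_cond_exp M (generated_algebra M {1..} (prob_algebra borel) \<mu>)
          (indicator {\<omega> \<in> space M. \<forall>i\<in>J. X i \<omega> \<in> A i}) \<omega>
        = (\<Prod>i\<in>J. measure (\<mu> i \<omega>) (A i))"

definition walk :: "(nat \<Rightarrow> 'a \<Rightarrow> real) \<Rightarrow> nat \<Rightarrow> 'a \<Rightarrow> real"
  where "walk X n \<omega> = (\<Sum>i=1..n. X i \<omega>)"

text \<open>The quenched expectation is the conditional expectation given the environment. The
  second version is for nonnegative variables and may be infinite.\<close>

definition quenched_exp ::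
  "'a measure \<Rightarrow> (nat \<Rightarrow> 'a \<Rightarrow> real measure) \<Rightarrow> ('a \<Rightarrow> real) \<Rightarrow> 'a \<Rightarrow> real"
  where "quenched_exp M \<mu> = real_cond_exp M (generated_algebra M {1..} (prob_algebra borel) \<mu>)"

definition quenched_nn_exp ::
  "'a measure \<Rightarrow> (nat \<Rightarrow> 'a \<Rightarrow> real measure) \<Rightarrow> ('a \<Rightarrow> ennreal) \<Rightarrow> 'a \<Rightarrow> ennreal"
  where "quenched_nn_exp M \<mu> = nn_cond_exp M (generated_algebra M {1..} (prob_algebra borel) \<mu>)"

definition quenched_mean ::
  "'a measure \<Rightarrow> (nat \<Rightarrow> 'a \<Rightarrow> real measure) \<Rightarrow> (nat \<Rightarrow> 'a \<Rightarrow> real) \<Rightarrow> nat \<Rightarrow> 'a \<Rightarrow> real"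
  where "quenched_mean M \<mu> X n = quenched_exp M \<mu> (walk X n)"

definition centered_walk ::
  "'a measure \<Rightarrow> (nat \<Rightarrow> 'a \<Rightarrow> real measure) \<Rightarrow> (nat \<Rightarrow> 'a \<Rightarrow> real) \<Rightarrow> nat \<Rightarrow> 'a \<Rightarrow> real"
  where "centered_walk M \<mu> X n \<omega> = walk X n \<omega> - quenched_mean M \<mu> X n \<omega>"

definition quenched_var ::
  "'a measure \<Rightarrow> (nat \<Rightarrow> 'a \<Rightarrow> real measure) \<Rightarrow> (nat \<Rightarrow> 'a \<Rightarrow> real) \<Rightarrow> nat \<Rightarrow> 'a \<Rightarrow> real"
  where "quenched_var M \<mu> X n = quenched_exp M \<mu> (\<lambda>\<omega>. (centered_walk M \<mu> X n \<omega>)\<^sup>2)"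

text \<open>The space \<open>C[0,1]\<close> with the uniform distance. Its points are functions that take the
  value \<^term>\<open>undefined\<close> outside \<open>[0,1]\<close>, hence the restricted abstractions below.\<close>

abbreviation C01 :: "(real \<Rightarrow> real) metric"
  where "C01 \<equiv> cfunspace (top_of_set {0..1}) euclidean_metric"

definition broken_line :: "nat \<Rightarrow> (nat \<Rightarrow> real) \<Rightarrow> real \<Rightarrow> real"
  where "broken_line n s = (\<lambda>t\<in>{0..1}.
    let k = nat \<lfloor>t * real n\<rfloor>
    in (s k + (t * real n - real k) * (s (Suc k) - s k)) / sqrt (real n))"

text \<open>Standard Brownian motion with time restricted to \<open>[0,1]\<close>; all paths are required to be
  continuous, so that it is a random element of \<open>C[0,1]\<close>.\<close>

definition brownian_motion01 :: "'a measure \<Rightarrow> (real \<Rightarrow> 'a \<Rightarrow> real) \<Rightarrow> bool"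
  where "brownian_motion01 N B \<longleftrightarrow>
    (\<forall>t\<in>{0..1}. B t \<in> borel_measurable N) \<and>
    (\<forall>\<omega>\<in>space N. B 0 \<omega> = 0) \<and>
    (\<forall>\<omega>\<in>space N. continuous_on {0..1} (\<lambda>t. B t \<omega>)) \<and>
    (\<forall>s t. 0 \<le> s \<and> s < t \<and> t \<le> 1 \<longrightarrow>
      distributed N lborel (\<lambda>\<omega>. B t \<omega> - B s \<omega>) (normal_density 0 (sqrt (t - s)))) \<and>
    (\<forall>(k::nat) \<tau>. (\<forall>i\<le>k. \<tau> i \<in> {0..1}) \<and> (\<forall>i<k. \<tau> i < \<tau> (Suc i)) \<longrightarrow>
      prob_space.indep_vars N (\<lambda>_. borel) (\<lambda>i \<omega>. B (\<tau> (Suc i)) \<omega> - B (\<tau> i) \<omega>) {..<k})"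

definition independent_processes01 ::
  "'a measure \<Rightarrow> (real \<Rightarrow> 'a \<Rightarrow> real) \<Rightarrow> (real \<Rightarrow> 'a \<Rightarrow> real) \<Rightarrow> bool"
  where "independent_processes01 N B W \<longleftrightarrow>
    prob_space.indep_var N (\<Pi>\<^sub>M t\<in>{0..1}. borel) (\<lambda>\<omega>. \<lambda>t\<in>{0..1}. B t \<omega>)
                           (\<Pi>\<^sub>M t\<in>{0..1}. borel) (\<lambda>\<omega>. \<lambda>t\<in>{0..1}. W t \<omega>)"

end

theory Submission
  imports Defs
begin

text \<open>Since the limit is a bounded random variable, it suffices to control moments. A bounded Lipschitz
  functional is approximated in \<open>L\<^sup>1\<close>, uniformly in \<open>n\<close>, by a trigonometric polynomial in the
  increments of the path over a grid of mesh \<open>1/m\<close>: first replace the path by its interpolation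
  on the grid (tightness: Ottaviani's inequality and the central limit theorem for the annealed walk),
  then apply the Stone--Weierstrass theorem. The quenched expectation of a character of the increments
  is a product of the characteristic functions of \<open>\<mu> 1, ..., \<mu> n\<close>, so a joint moment of such
  expectations factorizes over the independent environments. With \<open>a\<close> and \<open>q\<close> the first two moments
  of \<open>\<mu> 1\<close>, each factor expands as
  \<open>1 - ((\<Sum> \<theta>\<^sup>2) E(q - a\<^sup>2) + (\<Sum> \<theta>)\<^sup>2 E a\<^sup>2) / (2 n) + o(1/n)\<close>,
  which in the limit gives the joint moment of the conditional expectations of the
  corresponding characters of \<open>B + \<sigma> W\<close> given \<open>W\<close>.\<close>

subsection \<open>Interpolation in \<open>C[0,1]\<close>\<close>

text \<open>The limit is a random variable governed by the environment, and the convergence is in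
  law only. Hence the use of moments: the \<open>k\<close>-th moment of a quenched expectation is an
  annealed expectation over \<open>k\<close> copies of the walk, independent given one common
  environment. The copies share the quenched means, so there their frequencies add before they are
  squared; the fluctuations around the means are independent, so there the squares add. On the limit
  side \<open>W\<close> is the shared part and \<open>B\<close> the independent one.

  Approximation in L1 suffices because conditional expectation contracts L1. All errors can thus be
  estimated under the annealed law, for which the walk has i.i.d. steps.

  Tightness sums an error over \<open>m\<close> blocks, so a block must contribute less than order
  \<open>1/m\<close>. Chebyshev gives just \<open>1/m\<close>, and a step may lack a fourth moment.
  The fourth power is therefore borrowed from the Gaussian limit within a block, with
  \<open>m\<close> fixed and \<open>n\<close> tending to infinity. This dictates the order of
  choices: the mesh, then the polynomial, then \<open>n\<close>.\<close>

text \<open>Continuous functions on the compact interval are bounded, so the boundedness clause of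
  \<open>cfunspace\<close> disappears.\<close>

lemma mspace_C01: "x \<in> mspace C01 \<longleftrightarrow> x \<in> extensional {0..1} \<and> continuous_on {0..1} x"
proof -
  have "compactin (top_of_set {0..1::real}) (topspace (top_of_set {0..1::real}))"
    by (simp add: compactin_subtopology)
  then show ?thesis
    by (simp add: compactin_mspace_cfunspace del: mspace_cfunspace)
qed

lemma mdist_C01_le:
  assumes "0 \<le> D" "\<And>t. t \<in> {0..1} \<Longrightarrow> \<bar>x t - y t\<bar> \<le> D"
  shows "mdist C01 x y \<le> D"
  using assms by (intro mdist_cfunspace_le) (auto simp: dist_real_def)

text \<open>The floor is traded for clipped linear weights, one for each step of the walk. In this
  form continuity in \<open>t\<close> is evident, which is what \<open>broken_line_in_C01\<close>
  needs.\<close>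

lemma broken_line_eq_sum:
  assumes t: "t \<in> {0..1}"
  shows "broken_line n s t
    = (s 0 + (\<Sum>k<n. max 0 (min 1 (t * real n - real k)) * (s (Suc k) - s k))) / sqrt (real n)"
proof -
  define k where "k = nat \<lfloor>t * real n\<rfloor>"
  have kle: "real k \<le> t * real n" "t * real n < real k + 1"
    using t unfolding k_def by (auto simp: of_nat_nat)
  have "real k \<le> real n"
    using kle t by (smt (verit) atLeastAtMost_iff mult_left_le_one_le of_nat_0_le_iff)
  then have kn: "k \<le> n" by simp
  let ?c = "\<lambda>i. max 0 (min 1 (t * real n - real i)) * (s (Suc i) - s i)"
  have below: "(\<Sum>i<k. ?c i) = s k - s 0"
  proof -
    have "(\<Sum>i<k. ?c i) = (\<Sum>i<k. s (Suc i) - s i)"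
    proof (intro sum.cong refl)
      fix i assume "i \<in> {..<k}"
      then have "real i + 1 \<le> real k" by auto
      then have "min 1 (t * real n - real i) = 1" using kle by auto
      then show "?c i = s (Suc i) - s i" by simp
    qed
    then show ?thesis by (simp add: sum_lessThan_telescope)
  qed
  have "(\<Sum>i<n. ?c i) = s k - s 0 + (t * real n - real k) * (s (Suc k) - s k)"
  \<comment> \<open>If \<open>k = n\<close> then \<open>t * real n = real k\<close>, so the term
    with \<open>s (Suc k)\<close>, which has no counterpart in the sum, has coefficient
    zero.\<close>
  proof (cases "k = n")
    case True
    have "t * real n = real k" using kle t True by (smt (verit) atLeastAtMost_iff mult_left_le_one_le of_nat_0_le_iff)
    then show ?thesis using below True by simp
  next
    case False
    then have "k < n" using kn by simp
    then have *: "{..<n} = {..<k} \<union> insert k {k<..<n}" by auto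
    have "(\<Sum>i\<in>{k<..<n}. ?c i) = 0"
    proof (intro sum.neutral ballI)
      fix i assume "i \<in> {k<..<n}"
      then have "real k + 1 \<le> real i" by auto
      then show "?c i = 0" using kle by auto
    qed
    moreover have "(\<Sum>i<n. ?c i) = (\<Sum>i<k. ?c i) + (?c k + (\<Sum>i\<in>{k<..<n}. ?c i))"
      unfolding * by (subst sum.union_disjoint) auto
    ultimately show ?thesis using below kle by auto
  qed
  then show ?thesis using t by (simp add: broken_line_def k_def[symmetric] Let_def)
qed

lemma broken_line_in_C01: "broken_line n s \<in> mspace C01"
proof -
  have "continuous_on {0..1} (\<lambda>t. (s 0 + (\<Sum>k<n. max 0 (min 1 (t * real n - real k)) * (s (Suc k) - s k))) / sqrt (real n))"
    by (cases "n = 0") (auto intro!: continuous_intros)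
  then have "continuous_on {0..1} (broken_line n s)"
    by (subst continuous_on_cong[OF refl broken_line_eq_sum])
  moreover have "broken_line n s \<in> extensional {0..1}" by (auto simp: broken_line_def)
  ultimately show ?thesis using mspace_C01 by blast
qed

text \<open>At \<open>t = 1\<close> the node \<open>n + 1\<close> is junk, but it gets weight zero.\<close>

lemma broken_line_between:
  assumes t: "t \<in> {0..1}" and n: "n > 0"
  obtains k c where "k \<le> n" "real k \<le> t * real n" "t * real n < real k + 1" "0 \<le> c" "c \<le> 1"
    "k = n \<longrightarrow> c = 0" "\<forall>s. broken_line n s t = ((1 - c) * s k + c * s (Suc k)) / sqrt (real n)"
proof -
  define k where "k = nat \<lfloor>t * real n\<rfloor>"
  have kle: "real k \<le> t * real n" "t * real n < real k + 1"
    using t unfolding k_def by (auto simp: of_nat_nat)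
  have tn: "t * real n \<le> real n" using t by (simp add: mult_left_le_one_le)
  have kn: "k \<le> n" using kle tn by linarith
  show ?thesis
  proof (rule that[of k "t * real n - real k"])
    show "k = n \<longrightarrow> t * real n - real k = 0"
    proof
      assume "k = n"
      then have "real k = real n" by simp
      with kle tn show "t * real n - real k = 0" by linarith
    qed
    show "\<forall>s. broken_line n s t = ((1 - (t * real n - real k)) * s k + (t * real n - real k) * s (Suc k)) / sqrt (real n)"
      using t by (simp add: broken_line_def k_def[symmetric] Let_def algebra_simps)
  qed (use kle kn in auto)
qed

text \<open>Each bound is demanded only where its weight is positive: at the right end of the
  interval the node \<open>Suc k\<close> is off the grid and nothing is known about it.\<close>

lemma abs_convex_diff_le:
  fixes c :: real
  assumes "0 \<le> c" "c \<le> 1" "c > 0 \<Longrightarrow> \<bar>a - x\<bar> \<le> D" "c < 1 \<Longrightarrow> \<bar>b - x\<bar> \<le> D"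
  shows "\<bar>(1 - c) * b + c * a - x\<bar> \<le> D"
proof -
  have "(1 - c) * b + c * a - x = (1 - c) * (b - x) + c * (a - x)" by (simp add: algebra_simps)
  also have "\<bar>\<dots>\<bar> \<le> \<bar>(1 - c) * (b - x)\<bar> + \<bar>c * (a - x)\<bar>" by (rule abs_triangle_ineq)
  also have "\<dots> = (1 - c) * \<bar>b - x\<bar> + c * \<bar>a - x\<bar>" using assms(1,2) by (simp add: abs_mult)
  also have "\<dots> \<le> (1 - c) * D + c * D"
  proof (intro add_mono)
    show "(1 - c) * \<bar>b - x\<bar> \<le> (1 - c) * D"
      using assms by (cases "c = 1") (auto intro!: mult_left_mono)
    show "c * \<bar>a - x\<bar> \<le> c * D"
      using assms by (cases "c = 0") (auto intro!: mult_left_mono)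
  qed
  finally show ?thesis by (simp add: algebra_simps)
qed

lemma dist_broken_line_le:
  assumes t: "t \<in> {0..1}"
  shows "\<bar>broken_line n s t - broken_line n r t\<bar> \<le> (\<Sum>k\<le>n. \<bar>s k - r k\<bar>) / sqrt (real n)"
proof (cases "n = 0")
  case False
  then have n: "n > 0" by simp
  obtain k c where kc: "k \<le> n" "real k \<le> t * real n" "t * real n < real k + 1" "0 \<le> c" "c \<le> 1"
      "k = n \<longrightarrow> c = 0"
    and eq: "\<forall>s. broken_line n s t = ((1 - c) * s k + c * s (Suc k)) / sqrt (real n)"
    by (rule broken_line_between[OF t n]) (rule that; assumption)
  have single: "\<bar>s i - r i\<bar> \<le> (\<Sum>k\<le>n. \<bar>s k - r k\<bar>)" if "i \<le> n" for i
    using that by (intro member_le_sum) auto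
  have "\<bar>(1 - c) * (s k - r k) + c * (s (Suc k) - r (Suc k)) - 0\<bar> \<le> (\<Sum>k\<le>n. \<bar>s k - r k\<bar>)"
  proof (rule abs_convex_diff_le[OF kc(4,5)])
    assume "c > 0"
    then have "Suc k \<le> n" using kc by (cases "k = n") auto
    then show "\<bar>s (Suc k) - r (Suc k) - 0\<bar> \<le> (\<Sum>k\<le>n. \<bar>s k - r k\<bar>)" using single by simp
  qed (use single kc in simp)
  moreover have "broken_line n s t - broken_line n r t
    = ((1 - c) * (s k - r k) + c * (s (Suc k) - r (Suc k))) / sqrt (real n)"
    unfolding eq[rule_format] by (simp add: diff_divide_distrib[symmetric] algebra_simps)
  ultimately show ?thesis by (simp add: abs_divide divide_right_mono)
qed (simp add: broken_line_def)

text \<open>The path depends on finitely many nodes only, so \<open>f\<close> becomes continuous for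
  the product topology on sequences. Together with
  \<open>borel_measurable_continuous_sequence\<close> this yields measurability along the walk
  without a sigma-algebra on \<open>C01\<close>.\<close>

lemma Lipschitz_broken_line_continuous:
  fixes f :: "(real \<Rightarrow> real) \<Rightarrow> real"
  assumes "Lipschitz_continuous_map C01 euclidean_metric f"
  shows "continuous_on UNIV (\<lambda>s. f (broken_line n s))"
proof -
  obtain L where L: "L > 0" "\<And>x y. x \<in> mspace C01 \<Longrightarrow> y \<in> mspace C01 \<Longrightarrow> \<bar>f x - f y\<bar> \<le> L * mdist C01 x y"
    using assms unfolding Lipschitz_continuous_map_pos by (auto simp: dist_real_def)
  have bd: "\<bar>f (broken_line n s) - f (broken_line n r)\<bar> \<le> L * ((\<Sum>k\<le>n. \<bar>s k - r k\<bar>) / sqrt (real n))" for s r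
  proof -
    have "mdist C01 (broken_line n s) (broken_line n r) \<le> (\<Sum>k\<le>n. \<bar>s k - r k\<bar>) / sqrt (real n)"
      by (intro mdist_C01_le dist_broken_line_le) (auto intro!: divide_nonneg_nonneg sum_nonneg)
    then show ?thesis
      using L(2)[OF broken_line_in_C01 broken_line_in_C01, of n s n r] L(1)
      by (meson less_imp_le mult_left_mono order_trans)
  qed
  have "isCont (\<lambda>s. f (broken_line n s)) r" for r
  proof -
    define b where "b s = L * ((\<Sum>k\<le>n. \<bar>s k - r k\<bar>) / sqrt (real n))" for s
    have "continuous_on UNIV b"
      unfolding b_def by (cases "n = 0") (auto intro!: continuous_intros)
    then have "isCont b r" by (simp add: continuous_on_eq_continuous_at)
    moreover have "b r = 0" by (simp add: b_def)
    ultimately have "(b \<longlongrightarrow> 0) (at r)" by (simp add: isCont_def)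
    then have "((\<lambda>s. f (broken_line n s) - f (broken_line n r)) \<longlongrightarrow> 0) (at r)"
      by (rule Lim_null_comparison[rotated]) (use bd in \<open>auto simp: b_def\<close>)
    then show ?thesis unfolding isCont_def by (simp add: LIM_zero_iff)
  qed
  then show ?thesis by (simp add: continuous_on_eq_continuous_at)
qed

text \<open>The factor \<open>sqrt m\<close> undoes the scaling of \<^const>\<open>broken_line\<close>: the path is linear on each
  \<open>[j/m, (j+1)/m]\<close>, with increment \<open>d j\<close>.\<close>

definition increment_functional :: "((real \<Rightarrow> real) \<Rightarrow> real) \<Rightarrow> nat \<Rightarrow> (nat \<Rightarrow> real) \<Rightarrow> real"
  where "increment_functional f m d = f (broken_line m (\<lambda>j. sqrt (real m) * (\<Sum>i<j. d i)))"

lemma continuous_on_increment_functional: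
  assumes "Lipschitz_continuous_map C01 euclidean_metric f"
  shows "continuous_on UNIV (increment_functional f m)"
proof -
  have "continuous_on UNIV (\<lambda>d::nat \<Rightarrow> real. \<lambda>j. sqrt (real m) * (\<Sum>i<j. d i))"
    by (rule continuous_on_coordinatewise_then_product) (auto intro!: continuous_intros)
  from continuous_on_compose2[OF Lipschitz_broken_line_continuous[OF assms] this, of m]
  show ?thesis by (simp add: increment_functional_def[abs_def])
qed

lemma borel_measurable_continuous_sequence:
  fixes g :: "(nat \<Rightarrow> real) \<Rightarrow> real"
  assumes "continuous_on UNIV g" "\<And>k. (\<lambda>\<omega>. u k \<omega>) \<in> borel_measurable M"
  shows "(\<lambda>\<omega>. g (\<lambda>k. u k \<omega>)) \<in> borel_measurable M"
proof -
  have "(\<lambda>\<omega>. \<lambda>k. u k \<omega>) \<in> measurable M borel"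
    using assms(2) by (intro measurable_coordinatewise_then_product)
  moreover have "g \<in> borel_measurable borel" using assms(1) by (rule borel_measurable_continuous_onI)
  ultimately show ?thesis by (rule measurable_compose)
qed

text \<open>Uniform continuity of \<open>x\<close> makes its interpolations on the grids of mesh
  \<open>1/m\<close> converge uniformly. For the limit process this gives both the measurability of
  the functional and its approximation by functions of finitely many increments.\<close>

lemma increment_functional_tendsto:
  assumes f: "Lipschitz_continuous_map C01 euclidean_metric f"
    and x: "continuous_on {0..1} x" "x 0 = 0"
  shows "(\<lambda>m. increment_functional f m (\<lambda>j. if j < m then x (real (Suc j) / real m) - x (real j / real m) else 0))
    \<longlonglongrightarrow> f (restrict x {0..1})"
proof -
  obtain L where L: "L > 0" "\<And>x y. x \<in> mspace C01 \<Longrightarrow> y \<in> mspace C01 \<Longrightarrow> \<bar>f x - f y\<bar> \<le> L * mdist C01 x y"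
    using f unfolding Lipschitz_continuous_map_pos by (auto simp: dist_real_def)
  have uc: "uniformly_continuous_on {0..1} x"
    using x(1) by (intro compact_uniformly_continuous) auto
  have x_in: "restrict x {0..1} \<in> mspace C01"
    using x(1) continuous_on_cong[of "{0..1}" "{0..1}" "restrict x {0..1}" x]
    unfolding mspace_C01 by (simp del: restrict_apply add: restrict_apply')
  define V where "V m = (\<lambda>j. sqrt (real m) * (\<Sum>i<j. if i < m then x (real (Suc i) / real m) - x (real i / real m) else 0))" for m :: nat
  have V: "V m j = sqrt (real m) * x (real j / real m)" if "j \<le> m" for m j
  proof -
    have "(\<Sum>i<j. if i < m then x (real (Suc i) / real m) - x (real i / real m) else 0)
      = (\<Sum>i<j. x (real (Suc i) / real m) - x (real i / real m))"
      using that by (intro sum.cong) auto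
    also have "\<dots> = x (real j / real m)"
      using x(2) by (subst sum_lessThan_telescope[where f="\<lambda>i. x (real i / real m)"]) simp
    finally show ?thesis by (simp add: V_def)
  qed
  have ev: "\<forall>\<^sub>F m in sequentially. mdist C01 (broken_line m (V m)) (restrict x {0..1}) \<le> e" if e: "e > 0" for e
  proof -
    obtain d where d: "d > 0" "\<And>s t. s \<in> {0..1} \<Longrightarrow> t \<in> {0..1} \<Longrightarrow> dist t s < d \<Longrightarrow> dist (x t) (x s) < e"
      using uc e unfolding uniformly_continuous_on_def by metis
    \<comment> \<open>A mesh below the modulus \<open>d\<close> is enough: both nodes adjacent to
      \<open>t\<close> are within one mesh length of it.\<close>
    have "\<forall>\<^sub>F m in sequentially. real m > 1 / d \<and> m > 0"
      by (intro eventually_conj eventually_gt_at_top filterlim_real_sequentially[THEN filterlim_at_top_dense[THEN iffD1], rule_format])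
    then show ?thesis
    proof (rule eventually_mono)
      fix m assume m: "1 / d < real m \<and> 0 < m"
      then have md: "1 / real m < d" using d(1) by (simp add: field_simps)
      show "mdist C01 (broken_line m (V m)) (restrict x {0..1}) \<le> e"
      proof (rule mdist_C01_le)
        fix t :: real assume t: "t \<in> {0..1}"
        obtain k c where kc: "k \<le> m" "real k \<le> t * real m" "t * real m < real k + 1" "0 \<le> c" "c \<le> 1" "k = m \<longrightarrow> c = 0"
          and eq: "\<forall>s. broken_line m s t = ((1 - c) * s k + c * s (Suc k)) / sqrt (real m)"
          by (rule broken_line_between[OF t conjunct2[OF m]]) (rule that; assumption)
        have near: "\<bar>x (real i / real m) - x t\<bar> \<le> e" if "i \<le> m" "\<bar>real i - t * real m\<bar> \<le> 1" for i
        proof -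
          have "\<bar>real i / real m - t\<bar> = \<bar>real i - t * real m\<bar> / real m"
            using m by (simp add: field_simps abs_divide)
          also have "\<dots> \<le> 1 / real m" using that by (intro divide_right_mono) auto
          finally have "dist (real i / real m) t < d" using md by (simp add: dist_real_def)
          then have "dist (x (real i / real m)) (x t) < e" using that t m by (intro d(2)) auto
          then show ?thesis by (simp add: dist_real_def)
        qed
        have "\<bar>(1 - c) * x (real k / real m) + c * x (real (Suc k) / real m) - x t\<bar> \<le> e"
        proof (rule abs_convex_diff_le[OF kc(4,5)])
          assume "c > 0"
          then have "Suc k \<le> m" using kc by (cases "k = m") auto
          then show "\<bar>x (real (Suc k) / real m) - x t\<bar> \<le> e" using kc by (intro near) auto
        qed (use kc in \<open>intro near; auto\<close>)
        moreover have "broken_line m (V m) t = (1 - c) * x (real k / real m) + c * x (real (Suc k) / real m)"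
        proof (cases "k = m")
          case True then show ?thesis using kc m V[of m m] unfolding eq[rule_format] by simp
        next
          case False
          then have "Suc k \<le> m" using kc by simp
          then show ?thesis using m unfolding eq[rule_format] V[OF kc(1)] V[OF \<open>Suc k \<le> m\<close>]
            by (simp add: field_simps)
        qed
        ultimately show "\<bar>broken_line m (V m) t - restrict x {0..1} t\<bar> \<le> e" using t by simp
      qed (use e in simp)
    qed
  qed
  show ?thesis
  proof (rule LIMSEQ_I)
    fix r :: real assume r: "r > 0"
    have "\<forall>\<^sub>F m in sequentially. \<bar>f (broken_line m (V m)) - f (restrict x {0..1})\<bar> < r"
    proof (rule eventually_mono[OF ev[of "r / (2 * L)"]])
      fix m assume h: "mdist C01 (broken_line m (V m)) (restrict x {0..1}) \<le> r / (2 * L)"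
      have "\<bar>f (broken_line m (V m)) - f (restrict x {0..1})\<bar> \<le> L * (r / (2 * L))"
        using L(2)[OF broken_line_in_C01 x_in, of m "V m"] mult_left_mono[OF h, of L] L(1) by linarith
      also have "\<dots> < r" using L(1) r by (simp add: field_simps)
      finally show "\<bar>f (broken_line m (V m)) - f (restrict x {0..1})\<bar> < r" .
    qed (use r L in simp)
    then show "\<exists>no. \<forall>n\<ge>no. norm (increment_functional f n (\<lambda>j. if j < n then x (real (Suc j) / real n) - x (real j / real n) else 0) - f (restrict x {0..1})) < r"
      unfolding increment_functional_def V_def eventually_sequentially by simp
  qed
qed

subsection \<open>Approximation by trigonometric polynomials\<close>

text \<open>A trigonometric polynomial is stored as a list of coefficients and frequencies, with the
  character \<psi> left open. Conditioning then keeps the list and only replaces the waves by their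
  conditional expectations, so one list serves the walk, the quenched walk and both sides of the
  limit.\<close>

definition expand :: "('t \<Rightarrow> complex) \<Rightarrow> (complex \<times> 't) list \<Rightarrow> complex"
  where "expand \<psi> r = (\<Sum>(c, \<theta>)\<leftarrow>r. c * \<psi> \<theta>)"

lemma expand_simps [simp]:
  "expand \<psi> [] = 0"
  "expand \<psi> ((c, \<theta>) # r) = c * \<psi> \<theta> + expand \<psi> r"
  "expand \<psi> (r @ r') = expand \<psi> r + expand \<psi> r'"
  by (auto simp: expand_def)

definition wave :: "nat \<Rightarrow> (nat \<Rightarrow> real) \<Rightarrow> (nat \<Rightarrow> real) \<Rightarrow> complex"
  where "wave m \<theta> d = iexp (\<Sum>j<m. \<theta> j * d j)"

lemma wave_add: "wave m \<theta> d * wave m \<theta>' d = wave m (\<lambda>j. \<theta> j + \<theta>' j) d"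
  by (simp add: wave_def exp_add[symmetric] distrib_left[symmetric] sum.distrib distrib_right)

lemma wave_zero [simp]: "wave m (\<lambda>_. 0) d = 1"
  by (simp add: wave_def)

lemma norm_wave [simp]: "norm (wave m \<theta> d) = 1"
  by (simp add: wave_def)

lemma expand_wave_scale:
  "c * wave m \<theta> d * expand (\<lambda>\<theta>. wave m \<theta> d) r
    = expand (\<lambda>\<theta>. wave m \<theta> d) (map (\<lambda>(c', \<theta>'). (c * c', \<lambda>j. \<theta> j + \<theta>' j)) r)"
  by (induction r) (auto simp: wave_add[symmetric] algebra_simps)

lemma expand_wave_mult:
  "\<exists>r. \<forall>d. expand (\<lambda>\<theta>. wave m \<theta> d) r = expand (\<lambda>\<theta>. wave m \<theta> d) r1 * expand (\<lambda>\<theta>. wave m \<theta> d) r2"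
proof (induction r1)
  case Nil
  show ?case by (intro exI[of _ "[]"]) simp
next
  case (Cons a r1)
  obtain c \<theta> where a: "a = (c, \<theta>)" by (cases a)
  obtain r where r: "\<forall>d. expand (\<lambda>\<theta>. wave m \<theta> d) r = expand (\<lambda>\<theta>. wave m \<theta> d) r1 * expand (\<lambda>\<theta>. wave m \<theta> d) r2"
    using Cons by blast
  show ?case
    by (intro exI[of _ "map (\<lambda>(c', \<theta>'). (c * c', \<lambda>j. \<theta> j + \<theta>' j)) r2 @ r"])
      (simp only: a r expand_simps expand_wave_scale[symmetric] distrib_right, simp)
qed

definition trig_poly :: "nat \<Rightarrow> ((nat \<Rightarrow> real) \<Rightarrow> real) \<Rightarrow> bool"
  where "trig_poly m p \<longleftrightarrow> (\<exists>r. \<forall>d. complex_of_real (p d) = expand (\<lambda>\<theta>. wave m \<theta> d) r)"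

lemma trig_poly_const: "trig_poly m (\<lambda>_. c)"
  unfolding trig_poly_def by (intro exI[of _ "[(complex_of_real c, \<lambda>_. 0)]"]) simp

lemma trig_poly_add:
  assumes "trig_poly m p" "trig_poly m q"
  shows "trig_poly m (\<lambda>d. p d + q d)"
proof -
  obtain r r' where "\<forall>d. complex_of_real (p d) = expand (\<lambda>\<theta>. wave m \<theta> d) r"
    "\<forall>d. complex_of_real (q d) = expand (\<lambda>\<theta>. wave m \<theta> d) r'"
    using assms unfolding trig_poly_def by blast
  then show ?thesis unfolding trig_poly_def by (intro exI[of _ "r @ r'"]) simp
qed

lemma trig_poly_mult:
  assumes "trig_poly m p" "trig_poly m q"
  shows "trig_poly m (\<lambda>d. p d * q d)"
proof -
  obtain r r' where r: "\<forall>d. complex_of_real (p d) = expand (\<lambda>\<theta>. wave m \<theta> d) r"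
    "\<forall>d. complex_of_real (q d) = expand (\<lambda>\<theta>. wave m \<theta> d) r'"
    using assms unfolding trig_poly_def by blast
  obtain s where "\<forall>d. expand (\<lambda>\<theta>. wave m \<theta> d) s = expand (\<lambda>\<theta>. wave m \<theta> d) r * expand (\<lambda>\<theta>. wave m \<theta> d) r'"
    using expand_wave_mult by blast
  with r show ?thesis unfolding trig_poly_def by (intro exI[of _ s]) simp
qed

lemma trig_poly_sin:
  assumes "j < m"
  shows "trig_poly m (\<lambda>d. sin (c * d j))"
proof -
  have *: "(\<Sum>i<m. (if i = j then a else 0) * d i) = a * d j" for a and d :: "nat \<Rightarrow> real"
    using assms by (simp add: if_distrib[of "\<lambda>x. x * _"] sum.delta cong: if_cong)
  have "complex_of_real (sin x) = 1 / (2 * \<i>) * iexp x + (- 1 / (2 * \<i>)) * iexp (- x)" for x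
    by (simp add: sin_of_real[symmetric] sin_exp_eq field_simps)
  then show ?thesis unfolding trig_poly_def
    by (intro exI[of _ "[(1 / (2 * \<i>), \<lambda>i. if i = j then c else 0), (- 1 / (2 * \<i>), \<lambda>i. if i = j then - c else 0)]"])
      (simp only: expand_simps wave_def *, simp)
qed

lemma compact_box: "compact {y :: nat \<Rightarrow> real. \<forall>j. y j \<in> (if j < m then {-1..1} else {0})}"
proof -
  have "compactin (product_topology (\<lambda>_. euclidean) UNIV) (PiE UNIV (\<lambda>j. if j < m then {-1..1} else {0 :: real}))"
    by (subst compactin_PiE) auto
  moreover have "PiE UNIV (\<lambda>j. if j < m then {-1..1} else {0 :: real}) = {y. \<forall>j. y j \<in> (if j < m then {-1..1} else {0})}"
    by (auto simp: PiE_def Pi_def)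
  ultimately show ?thesis by (simp only: euclidean_product_topology compactin_euclidean_iff)
qed

text \<open>Substituting \<open>y = sin (c d)\<close> turns the polynomials of the Stone--Weierstrass theorem on a box
  into trigonometric polynomials whose uniform bound holds globally, not only where they
  approximate.\<close>

lemma trig_poly_approx:
  fixes G :: "(nat \<Rightarrow> real) \<Rightarrow> real"
  assumes G: "continuous_on UNIV G" "\<And>d. \<bar>G d\<bar> \<le> K" and R: "R > 0" and e: "e > 0"
  obtains p where "trig_poly m p" "\<And>d. \<bar>p d\<bar> \<le> K + e"
    "\<And>d. (\<And>j. j \<ge> m \<Longrightarrow> d j = 0) \<Longrightarrow> (\<And>j. j < m \<Longrightarrow> \<bar>d j\<bar> \<le> R) \<Longrightarrow> \<bar>p d - G d\<bar> \<le> e"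
proof -
  \<comment> \<open>This scale takes \<open>[-R, R]\<close> to the interval from
    \<open>-pi/2\<close> to \<open>pi/2\<close>, on which \<open>arcsin\<close> inverts
    \<open>sin\<close>.\<close>
  define c where "c = pi / (2 * R)"
  have c: "c > 0" using R by (simp add: c_def)
  \<comment> \<open>Coordinates from \<open>m\<close> on are pinned to zero. The set is then
    compact, and two distinct points differ in a coordinate below \<open>m\<close>, where a sine is
    available to separate them.\<close>
  define S where "S = {y :: nat \<Rightarrow> real. \<forall>j. y j \<in> (if j < m then {-1..1} else {0})}"
  define Y where "Y d = (\<lambda>j. if j < m then sin (c * d j) else 0)" for d :: "nat \<Rightarrow> real"
  have Y_in: "Y d \<in> S" for d by (auto simp: Y_def S_def)
  define h where "h y = G (\<lambda>j. arcsin (y j) / c)" for y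
  have "continuous_on S (\<lambda>y. \<lambda>j. arcsin (y j) / c)"
  proof (rule continuous_on_coordinatewise_then_product)
    fix j
    have "continuous_on S (\<lambda>y. y j)" by (rule continuous_on_subset[OF continuous_on_product_coordinates]) simp
    moreover have "y j \<in> {-1..1}" if "y \<in> S" for y
      using that by (auto simp: S_def split: if_splits dest!: spec[of _ j])
    ultimately show "continuous_on S (\<lambda>y. arcsin (y j) / c)"
      using c by (intro continuous_intros) auto
  qed
  then have h: "continuous_on S h"
    unfolding h_def by (rule continuous_on_compose2[OF G(1)]) simp
  \<comment> \<open>The algebra consists of the continuous functions on the box whose pullback under
    \<open>Y\<close> is a trigonometric polynomial.\<close>
  have "\<exists>g. (continuous_on S g \<and> trig_poly m (\<lambda>d. g (Y d))) \<and> (\<forall>x\<in>S. \<bar>h x - g x\<bar> < e)"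
  proof (rule Stone_Weierstrass_HOL[OF _ _ _ _ _ _ h e])
    show "compact S" unfolding S_def by (rule compact_box)
    show "\<exists>f. (continuous_on S f \<and> trig_poly m (\<lambda>d. f (Y d))) \<and> f x \<noteq> f y"
      if "x \<in> S \<and> y \<in> S \<and> x \<noteq> y" for x y
    proof -
      have "\<exists>j. x j \<noteq> y j" using that by (metis ext)
      then obtain j where j: "x j \<noteq> y j" by blast
      then have "j < m" using that by (auto simp: S_def split: if_splits dest!: spec[of _ j])
      moreover have "continuous_on S (\<lambda>y. y j)" by (rule continuous_on_subset[OF continuous_on_product_coordinates]) simp
      ultimately show ?thesis
        using j by (intro exI[of _ "\<lambda>y. y j"]) (auto simp: Y_def trig_poly_sin)
    qed
  qed (auto intro: trig_poly_const trig_poly_add trig_poly_mult continuous_on_add continuous_on_mult)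
  then obtain g where g: "trig_poly m (\<lambda>d. g (Y d))" "\<And>x. x \<in> S \<Longrightarrow> \<bar>h x - g x\<bar> < e" by blast
  show ?thesis
  proof (rule that[OF g(1)])
    fix d
    show "\<bar>g (Y d)\<bar> \<le> K + e"
      using g(2)[OF Y_in[of d]] G(2)[of "\<lambda>j. arcsin (Y d j) / c"] by (simp add: h_def)
    assume d: "\<And>j. j \<ge> m \<Longrightarrow> d j = 0" "\<And>j. j < m \<Longrightarrow> \<bar>d j\<bar> \<le> R"
    have "arcsin (Y d j) / c = d j" for j
    proof (cases "j < m")
      case True
      have "\<bar>c * d j\<bar> = c * \<bar>d j\<bar>" using c by (simp add: abs_mult)
      also have "\<dots> \<le> c * R" using c d(2)[OF True] by simp
      also have "\<dots> = pi / 2" using R by (simp add: c_def)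
      finally have "arcsin (sin (c * d j)) = c * d j" by (intro arcsin_sin) auto
      then show ?thesis using c True by (simp add: Y_def)
    qed (simp add: Y_def d)
    then have "h (Y d) = G d" by (simp add: h_def)
    then show "\<bar>g (Y d) - G d\<bar> \<le> e" using g(2)[OF Y_in[of d]] by simp
  qed
qed

subsection \<open>Products of characteristic functions near zero\<close>

context real_distribution
begin

lemma cmod_char_minus_1_le:
  assumes "integrable M (\<lambda>x. x)"
  shows "cmod (char M u - 1) \<le> \<bar>u\<bar> * expectation (\<lambda>x. \<bar>x\<bar>)"
proof -
  have "cmod (char M u - 1) \<le> expectation (\<lambda>x. min 2 (\<bar>u\<bar> * \<bar>x\<bar>))"
    using char_approx2[of 0 u] prob_space by simp
  also have "\<dots> \<le> expectation (\<lambda>x. \<bar>u\<bar> * \<bar>x\<bar>)"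
    using assms by (intro integral_mono) (auto intro!: integrable_const_bound[where B=2])
  finally show ?thesis by simp
qed

lemma integrable_of_square:
  assumes "integrable M (\<lambda>x. x\<^sup>2)"
  shows "integrable M (\<lambda>x. x)"
  using assms by (intro square_integrable_imp_integrable[OF _ assms]) auto

text \<open>Valid for every \<open>u\<close> and not only in the limit: after division by
  \<open>u\<^sup>2\<close> the second moment remains, which serves as a dominating function over the
  environments.\<close>

lemma cmod_char_first_order_le:
  assumes "integrable M (\<lambda>x. x\<^sup>2)"
  shows "cmod (char M u - 1 - \<i> * u * expectation (\<lambda>x. x)) \<le> u\<^sup>2 * expectation (\<lambda>x. x\<^sup>2)"
proof -
  have int: "k \<le> 1 \<Longrightarrow> integrable M (\<lambda>x. x ^ k)" for k
    using integrable_of_square[OF assms] by (cases k) auto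
  have "cmod (char M u - (1 + \<i> * u * expectation (\<lambda>x. x)))
    \<le> \<bar>u\<bar> / 2 * expectation (\<lambda>x. min (4 * \<bar>x\<bar>) (\<bar>u\<bar> * x\<^sup>2))"
    using char_approx2[of 1 u, OF int] prob_space by (simp add: power2_eq_square)
  also have "\<dots> \<le> \<bar>u\<bar> / 2 * expectation (\<lambda>x. \<bar>u\<bar> * x\<^sup>2)"
    using assms integrable_of_square[OF assms]
    by (intro mult_left_mono integral_mono integrable_min) auto
  also have "\<dots> = u\<^sup>2 * expectation (\<lambda>x. x\<^sup>2) / 2"
    by (simp add: power2_eq_square)
  also have "\<dots> \<le> u\<^sup>2 * expectation (\<lambda>x. x\<^sup>2)" by simp
  finally show ?thesis by (simp add: algebra_simps)
qed

text \<open>No third moment is at hand. The Taylor remainder is controlled by the mean of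
  \<open>min (6 * x\<^sup>2) (\<bar>u\<bar> * \<bar>x\<bar> ^ 3)\<close>, which tends to zero by
  dominated convergence with majorant \<open>6 * x\<^sup>2\<close>.\<close>

lemma char_second_order_tendsto:
  assumes int: "integrable M (\<lambda>x. x\<^sup>2)" and s: "s \<longlonglongrightarrow> 0" "\<forall>\<^sub>F n in sequentially. s n \<noteq> 0"
  shows "(\<lambda>n. (char M (\<theta> * s n) - 1 - \<i> * (\<theta> * s n) * expectation (\<lambda>x. x)) / (s n)\<^sup>2)
    \<longlonglongrightarrow> - (\<theta>\<^sup>2 * expectation (\<lambda>x. x\<^sup>2) / 2)"
proof -
  have int': "k \<le> 2 \<Longrightarrow> integrable M (\<lambda>x. x ^ k)" for k
    using integrable_of_square[OF int] int by (cases "k = 2"; cases "k = 1"; cases "k = 0") auto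
  define E where "E n = expectation (\<lambda>x. min (6 * x\<^sup>2) (\<bar>\<theta> * s n\<bar> * \<bar>x\<bar> ^ 3))" for n
  have "E \<longlonglongrightarrow> expectation (\<lambda>x. 0)"
    unfolding E_def
  proof (rule integral_dominated_convergence)
    show "AE x in M. (\<lambda>n. min (6 * x\<^sup>2) (\<bar>\<theta> * s n\<bar> * \<bar>x\<bar> ^ 3)) \<longlonglongrightarrow> 0"
    proof (rule AE_I2)
      fix x
      have "(\<lambda>n. min (6 * x\<^sup>2) (\<bar>\<theta> * s n\<bar> * \<bar>x\<bar> ^ 3)) \<longlonglongrightarrow> min (6 * x\<^sup>2) (\<bar>\<theta> * 0\<bar> * \<bar>x\<bar> ^ 3)"
        by (intro tendsto_intros s)
      then show "(\<lambda>n. min (6 * x\<^sup>2) (\<bar>\<theta> * s n\<bar> * \<bar>x\<bar> ^ 3)) \<longlonglongrightarrow> 0" by simp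
    qed
    show "integrable M (\<lambda>x. 6 * x\<^sup>2)" using int by simp
  qed auto
  then have E0: "(\<lambda>n. \<theta>\<^sup>2 / 6 * E n) \<longlonglongrightarrow> 0" by (auto intro: tendsto_mult_right_zero)
  have bd: "norm ((char M (\<theta> * s n) - 1 - \<i> * (\<theta> * s n) * expectation (\<lambda>x. x)) / (s n)\<^sup>2
      - - complex_of_real (\<theta>\<^sup>2 * expectation (\<lambda>x. x\<^sup>2) / 2)) \<le> \<theta>\<^sup>2 / 6 * E n" if n: "s n \<noteq> 0" for n
  proof -
    let ?u = "\<theta> * s n"
    have "cmod (char M ?u - (\<Sum>k\<le>2. (\<i> * ?u) ^ k / fact k * expectation (\<lambda>x. x ^ k))) \<le> ?u\<^sup>2 / 6 * E n"
      using char_approx2[of 2 ?u, OF int'] by (simp add: E_def fact_numeral)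
    also have "(\<Sum>k\<le>2. (\<i> * ?u) ^ k / fact k * expectation (\<lambda>x. x ^ k))
      = 1 + \<i> * ?u * expectation (\<lambda>x. x) - ?u\<^sup>2 * expectation (\<lambda>x. x\<^sup>2) / 2"
      using prob_space by (simp add: numeral_2_eq_2 power2_eq_square algebra_simps)
    finally have *: "cmod (char M ?u - (1 + \<i> * ?u * expectation (\<lambda>x. x) - ?u\<^sup>2 * expectation (\<lambda>x. x\<^sup>2) / 2)) \<le> ?u\<^sup>2 / 6 * E n" .
    have "(char M ?u - 1 - \<i> * (\<theta> * s n) * expectation (\<lambda>x. x)) / (s n)\<^sup>2
      - - complex_of_real (\<theta>\<^sup>2 * expectation (\<lambda>x. x\<^sup>2) / 2)
      = (char M ?u - (1 + \<i> * ?u * expectation (\<lambda>x. x) - ?u\<^sup>2 * expectation (\<lambda>x. x\<^sup>2) / 2)) / complex_of_real ((s n)\<^sup>2)"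
      using n by (simp add: field_simps power2_eq_square)
    then have "norm ((char M ?u - 1 - \<i> * (\<theta> * s n) * expectation (\<lambda>x. x)) / (s n)\<^sup>2
      - - complex_of_real (\<theta>\<^sup>2 * expectation (\<lambda>x. x\<^sup>2) / 2))
      = cmod (char M ?u - (1 + \<i> * ?u * expectation (\<lambda>x. x) - ?u\<^sup>2 * expectation (\<lambda>x. x\<^sup>2) / 2)) / (s n)\<^sup>2"
      by (simp add: norm_divide norm_power)
    also have "\<dots> \<le> (?u\<^sup>2 / 6 * E n) / (s n)\<^sup>2" by (intro divide_right_mono *) simp
    also have "\<dots> = \<theta>\<^sup>2 / 6 * E n" using n by (simp add: power_mult_distrib)
    finally show ?thesis .
  qed
  have "(\<lambda>n. (char M (\<theta> * s n) - 1 - \<i> * (\<theta> * s n) * expectation (\<lambda>x. x)) / (s n)\<^sup>2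
      - - complex_of_real (\<theta>\<^sup>2 * expectation (\<lambda>x. x\<^sup>2) / 2)) \<longlonglongrightarrow> 0"
    by (rule Lim_null_comparison[OF _ E0]) (use s(2) bd in \<open>auto elim: eventually_mono\<close>)
  then show ?thesis by (subst LIM_zero_iff[symmetric]) simp
qed

end

text \<open>The joint characteristic function, at frequencies \<theta>s scaled by \<open>s\<close>,
  of independent draws from the same law, one draw per frequency. This is one step of several copies
  of the walk in a common environment.\<close>

definition char_prod :: "real measure \<Rightarrow> real list \<Rightarrow> real \<Rightarrow> complex"
  where "char_prod M \<theta>s s = (\<Prod>\<theta>\<leftarrow>\<theta>s. char M (\<theta> * s))"

lemma char_prod_simps [simp]:
  "char_prod M [] s = 1"
  "char_prod M (\<theta> # \<theta>s) s = char M (\<theta> * s) * char_prod M \<theta>s s"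
  by (auto simp: char_prod_def)

context real_distribution
begin

lemma cmod_char_prod_le_1: "cmod (char_prod M \<theta>s s) \<le> 1"
  by (induction \<theta>s) (auto simp: norm_mult intro!: mult_le_one cmod_char_le_1)

lemma cmod_char_prod_minus_1_le:
  assumes "integrable M (\<lambda>x. x)"
  shows "cmod (char_prod M \<theta>s s - 1) \<le> \<bar>s\<bar> * (\<Sum>\<theta>\<leftarrow>\<theta>s. \<bar>\<theta>\<bar>) * expectation (\<lambda>x. \<bar>x\<bar>)"
proof (induction \<theta>s)
  case (Cons \<theta> \<theta>s)
  have "cmod (char_prod M (\<theta> # \<theta>s) s - 1)
    = cmod ((char M (\<theta> * s) - 1) * char_prod M \<theta>s s + (char_prod M \<theta>s s - 1))"
    by (simp add: algebra_simps)
  also have "\<dots> \<le> cmod (char M (\<theta> * s) - 1) * cmod (char_prod M \<theta>s s) + cmod (char_prod M \<theta>s s - 1)"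
    by (metis norm_mult norm_triangle_ineq)
  also have "\<dots> \<le> (\<bar>\<theta> * s\<bar> * expectation (\<lambda>x. \<bar>x\<bar>)) * 1 + cmod (char_prod M \<theta>s s - 1)"
    by (intro add_mono mult_mono cmod_char_minus_1_le assms cmod_char_prod_le_1) auto
  also have "\<dots> \<le> (\<bar>\<theta> * s\<bar> * expectation (\<lambda>x. \<bar>x\<bar>)) * 1 + \<bar>s\<bar> * (\<Sum>\<theta>\<leftarrow>\<theta>s. \<bar>\<theta>\<bar>) * expectation (\<lambda>x. \<bar>x\<bar>)"
    using Cons by simp
  finally show ?case by (simp add: algebra_simps abs_mult)
qed simp

lemma expectation_abs_power2_le:
  assumes "integrable M (\<lambda>x. x\<^sup>2)"
  shows "(expectation (\<lambda>x. \<bar>x\<bar>))\<^sup>2 \<le> expectation (\<lambda>x. x\<^sup>2)"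
proof -
  have "0 \<le> variance (\<lambda>x. \<bar>x\<bar>)" by (rule variance_positive)
  also have "\<dots> = expectation (\<lambda>x. \<bar>x\<bar>\<^sup>2) - (expectation (\<lambda>x. \<bar>x\<bar>))\<^sup>2"
    using assms integrable_of_square[OF assms] by (intro variance_eq) auto
  finally show ?thesis by simp
qed

text \<open>Supplies the dominating function for \<open>annealed_char_prod_tendsto\<close>; the
  linear term is kept apart because it vanishes only after averaging over the environment.\<close>

lemma cmod_char_prod_first_order_le:
  assumes int: "integrable M (\<lambda>x. x\<^sup>2)"
  shows "cmod (char_prod M \<theta>s s - 1 - \<i> * (s * sum_list \<theta>s * expectation (\<lambda>x. x)))
    \<le> s\<^sup>2 * (\<Sum>\<theta>\<leftarrow>\<theta>s. \<bar>\<theta>\<bar>)\<^sup>2 * expectation (\<lambda>x. x\<^sup>2)"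
proof (induction \<theta>s)
  case (Cons \<theta> \<theta>s)
  note int1 = integrable_of_square[OF int]
  define m where "m = expectation (\<lambda>x. x)"
  define a where "a = expectation (\<lambda>x. \<bar>x\<bar>)"
  define q where "q = expectation (\<lambda>x. x\<^sup>2)"
  define A where "A = (\<Sum>\<theta>\<leftarrow>\<theta>s. \<bar>\<theta>\<bar>)"
  define P where "P = char_prod M \<theta>s s"
  have A: "A \<ge> 0" unfolding A_def by (intro sum_list_nonneg) auto
  have a: "a \<ge> 0" unfolding a_def by simp
  have ma: "\<bar>m\<bar> \<le> a" unfolding m_def a_def by (rule integral_abs_bound)
  have aq: "a * a \<le> q" using expectation_abs_power2_le[OF int] by (simp add: a_def q_def power2_eq_square)
  have q: "q \<ge> 0" unfolding q_def by simp
  have s2: "s\<^sup>2 = \<bar>s\<bar> * \<bar>s\<bar>" by (simp add: power2_eq_square)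
  \<comment> \<open>The middle term is a product of two first-order quantities. It is of second
    order in \<open>s\<close>, with the square of the absolute mean as a factor, which
    \<open>expectation_abs_power2_le\<close> bounds by the second moment.\<close>
  have "char_prod M (\<theta> # \<theta>s) s - 1 - \<i> * (s * sum_list (\<theta> # \<theta>s) * m)
    = (char M (\<theta> * s) - 1 - \<i> * (\<theta> * s) * m) * P + \<i> * (\<theta> * s * m) * (P - 1) + (P - 1 - \<i> * (s * sum_list \<theta>s * m))"
    by (simp add: P_def algebra_simps)
  also have "cmod \<dots> \<le> cmod (char M (\<theta> * s) - 1 - \<i> * (\<theta> * s) * m) * cmod P + cmod (\<i> * (\<theta> * s * m)) * cmod (P - 1)
      + cmod (P - 1 - \<i> * (s * sum_list \<theta>s * m))"
    by (metis (no_types, lifting) add_mono norm_mult norm_triangle_ineq norm_triangle_mono order_refl)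
  also have "\<dots> \<le> ((\<theta> * s)\<^sup>2 * q) * 1 + (\<bar>\<theta>\<bar> * \<bar>s\<bar> * a) * (\<bar>s\<bar> * A * a) + s\<^sup>2 * A\<^sup>2 * q"
  proof (intro add_mono mult_mono)
    show "cmod (char M (\<theta> * s) - 1 - \<i> * (\<theta> * s) * m) \<le> (\<theta> * s)\<^sup>2 * q"
      using cmod_char_first_order_le[OF int, of "\<theta> * s"] by (simp add: m_def q_def)
    show "cmod P \<le> 1" unfolding P_def by (rule cmod_char_prod_le_1)
    show "cmod (\<i> * (\<theta> * s * m)) \<le> \<bar>\<theta>\<bar> * \<bar>s\<bar> * a"
      using ma by (auto simp: norm_mult abs_mult intro!: mult_left_mono)
    show "cmod (P - 1) \<le> \<bar>s\<bar> * A * a"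
      using cmod_char_prod_minus_1_le[OF int1] by (simp add: P_def A_def a_def)
    show "cmod (P - 1 - \<i> * (s * sum_list \<theta>s * m)) \<le> s\<^sup>2 * A\<^sup>2 * q"
      using Cons by (simp add: P_def A_def q_def m_def)
  qed (use a q A in auto)
  also have "(\<bar>\<theta>\<bar> * \<bar>s\<bar> * a) * (\<bar>s\<bar> * A * a) = s\<^sup>2 * (\<bar>\<theta>\<bar> * A) * (a * a)"
    unfolding s2 by (simp only: mult_ac)
  also have "s\<^sup>2 * (\<bar>\<theta>\<bar> * A) * (a * a) \<le> s\<^sup>2 * (\<bar>\<theta>\<bar> * A) * q"
    using aq A by (intro mult_left_mono) auto
  also have "(\<theta> * s)\<^sup>2 * q * 1 + s\<^sup>2 * (\<bar>\<theta>\<bar> * A) * q + s\<^sup>2 * A\<^sup>2 * q = s\<^sup>2 * (\<bar>\<theta>\<bar>\<^sup>2 + \<bar>\<theta>\<bar> * A + A\<^sup>2) * q"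
    by (simp add: algebra_simps)
  also have "\<dots> \<le> s\<^sup>2 * (\<bar>\<theta>\<bar> + A)\<^sup>2 * q"
    using A q by (intro mult_right_mono mult_left_mono) (auto simp: power2_sum)
  finally show ?case by (simp add: m_def q_def A_def)
qed simp

text \<open>Formally the logarithm of a single factor is \<open>\<i> * \<theta> * s * m -
  \<theta>\<^sup>2 * s\<^sup>2 * (q - m\<^sup>2) / 2\<close> up to higher order. Over the list the
  variances add as squares of frequencies, whereas the means add first and are squared by the
  exponential. The induction obtains this by the product rule, without logarithms.\<close>

lemma char_prod_second_order_tendsto:
  assumes int: "integrable M (\<lambda>x. x\<^sup>2)" and s: "s \<longlonglongrightarrow> 0" "\<forall>\<^sub>F n in sequentially. s n \<noteq> 0"
  defines "m \<equiv> expectation (\<lambda>x. x)" and "q \<equiv> expectation (\<lambda>x. x\<^sup>2)"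
  shows "(\<lambda>n. (char_prod M \<theta>s (s n) - 1 - \<i> * (s n * sum_list \<theta>s * m)) / (s n)\<^sup>2)
    \<longlonglongrightarrow> - (((\<Sum>\<theta>\<leftarrow>\<theta>s. \<theta>\<^sup>2) * (q - m\<^sup>2) + (sum_list \<theta>s)\<^sup>2 * m\<^sup>2) / 2)"
proof (induction \<theta>s)
  case (Cons \<theta> \<theta>s)
  define P where "P n = char_prod M \<theta>s (s n)" for n
  define \<Theta> where "\<Theta> = sum_list \<theta>s"
  define Q where "Q = (\<Sum>\<theta>\<leftarrow>\<theta>s. \<theta>\<^sup>2)"
  define L where "L = - complex_of_real ((Q * (q - m\<^sup>2) + \<Theta>\<^sup>2 * m\<^sup>2) / 2)"
  have s': "(\<lambda>n. complex_of_real (s n)) \<longlonglongrightarrow> 0" using tendsto_of_real[OF s(1)] by simp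
  have IH: "(\<lambda>n. (P n - 1 - \<i> * (s n * \<Theta> * m)) / (s n)\<^sup>2) \<longlonglongrightarrow> L"
    using Cons by (simp add: P_def L_def \<Theta>_def Q_def)
  \<comment> \<open>The lower-order limits needed for the product rule follow from the second-order
    one by multiplying with \<open>s n\<close>.\<close>
  have first: "(\<lambda>n. (P n - 1) / s n) \<longlonglongrightarrow> \<i> * (\<Theta> * m)"
  proof -
    have "(\<lambda>n. (P n - 1 - \<i> * (s n * \<Theta> * m)) / (s n)\<^sup>2 * s n + \<i> * (\<Theta> * m)) \<longlonglongrightarrow> L * 0 + \<i> * (\<Theta> * m)"
      by (intro tendsto_intros IH s')
    moreover have "\<forall>\<^sub>F n in sequentially. (P n - 1 - \<i> * (s n * \<Theta> * m)) / (s n)\<^sup>2 * s n + \<i> * (\<Theta> * m) = (P n - 1) / s n"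
      by (rule eventually_mono[OF s(2)]) (simp add: field_simps power2_eq_square)
    ultimately show ?thesis by (simp add: tendsto_cong)
  qed
  have zeroth: "P \<longlonglongrightarrow> 1"
  proof -
    have "(\<lambda>n. (P n - 1) / s n * s n + 1) \<longlonglongrightarrow> \<i> * (\<Theta> * m) * 0 + 1"
      by (intro tendsto_intros first s')
    moreover have "\<forall>\<^sub>F n in sequentially. (P n - 1) / s n * s n + 1 = P n"
      by (rule eventually_mono[OF s(2)]) simp
    ultimately show ?thesis by (simp add: tendsto_cong)
  qed
  have sums: "(\<Sum>\<theta>\<leftarrow>\<theta> # \<theta>s. \<theta>\<^sup>2) = \<theta>\<^sup>2 + Q" "sum_list (\<theta> # \<theta>s) = \<theta> + \<Theta>"
    by (simp_all add: Q_def \<Theta>_def)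
  let ?g = "\<lambda>n. (char M (\<theta> * s n) - 1 - \<i> * (\<theta> * s n) * m) / (s n)\<^sup>2"
  have h: "?g \<longlonglongrightarrow> - complex_of_real (\<theta>\<^sup>2 * q / 2)"
    using char_second_order_tendsto[OF int s, of \<theta>] by (simp add: m_def q_def)
  have "(\<lambda>n. ?g n * P n + \<i> * (\<theta> * m) * ((P n - 1) / s n) + (P n - 1 - \<i> * (s n * \<Theta> * m)) / (s n)\<^sup>2)
    \<longlonglongrightarrow> - complex_of_real (\<theta>\<^sup>2 * q / 2) * 1 + \<i> * (\<theta> * m) * (\<i> * (\<Theta> * m)) + L"
    by (intro tendsto_add[OF tendsto_add[OF tendsto_mult[OF h zeroth] tendsto_mult[OF tendsto_const first]] IH])
  moreover have "\<forall>\<^sub>F n in sequentially.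
      ?g n * P n + \<i> * (\<theta> * m) * ((P n - 1) / s n) + (P n - 1 - \<i> * (s n * \<Theta> * m)) / (s n)\<^sup>2
      = (char_prod M (\<theta> # \<theta>s) (s n) - 1 - \<i> * (s n * sum_list (\<theta> # \<theta>s) * m)) / (s n)\<^sup>2"
    by (rule eventually_mono[OF s(2)]) (simp add: P_def \<Theta>_def field_simps power2_eq_square)
  ultimately have "(\<lambda>n. (char_prod M (\<theta> # \<theta>s) (s n) - 1 - \<i> * (s n * sum_list (\<theta> # \<theta>s) * m)) / (s n)\<^sup>2)
    \<longlonglongrightarrow> - complex_of_real (\<theta>\<^sup>2 * q / 2) * 1 + \<i> * (\<theta> * m) * (\<i> * (\<Theta> * m)) + L"
    by (rule Lim_transform_eventually)
  also have "- complex_of_real (\<theta>\<^sup>2 * q / 2) * 1 + \<i> * (\<theta> * m) * (\<i> * (\<Theta> * m)) + L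
    = - complex_of_real (((\<Sum>\<theta>\<leftarrow>\<theta> # \<theta>s. \<theta>\<^sup>2) * (q - m\<^sup>2) + (sum_list (\<theta> # \<theta>s))\<^sup>2 * m\<^sup>2) / 2)"
    unfolding sums L_def by (simp add: field_simps power2_eq_square)
  finally show ?case by (simp only: of_real_minus)
qed simp

end

text \<open>A complex logarithm is avoided by comparison with \<open>exp (- c / n)\<close>: in the
  closed unit disc \<open>r\<close>-th powers differ by at most \<open>r\<close> times the
  difference of the bases, and here that difference is \<open>o(1/n)\<close> while
  \<open>r n\<close> is of order \<open>n\<close>.\<close>

lemma power_tendsto_exp:
  fixes a :: "nat \<Rightarrow> complex" and c :: real
  assumes a: "\<And>n. cmod (a n) \<le> 1" "(\<lambda>n. real n * (a n - 1)) \<longlonglongrightarrow> - complex_of_real c"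
    and c: "c \<ge> 0" and r: "(\<lambda>n. real (r n) / real n) \<longlonglongrightarrow> \<rho>"
  shows "(\<lambda>n. a n ^ r n) \<longlonglongrightarrow> exp (- c * \<rho>)"
proof -
  define b where "b n = exp (- c / real n)" for n
  have b: "0 < b n" "b n \<le> 1" for n using c by (auto simp: b_def)
  have "(\<lambda>n. real n * (b n - 1)) \<longlonglongrightarrow> - c"
    unfolding b_def by real_asymp
  from tendsto_of_real[OF this]
  have "(\<lambda>n. real n * (a n - 1) - complex_of_real (real n * (b n - 1))) \<longlonglongrightarrow> - complex_of_real c - complex_of_real (- c)"
    by (intro tendsto_diff a) auto
  then have "(\<lambda>n. real n * (a n - b n)) \<longlonglongrightarrow> 0" by (simp add: algebra_simps)
  from tendsto_mult[OF tendsto_norm[OF this] r]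
  have lim: "(\<lambda>n. cmod (real n * (a n - b n)) * (real (r n) / real n)) \<longlonglongrightarrow> 0" by simp
  have diff: "(\<lambda>n. a n ^ r n - complex_of_real (b n ^ r n)) \<longlonglongrightarrow> 0"
  proof (rule Lim_null_comparison[OF _ lim])
    show "\<forall>\<^sub>F n in sequentially. norm (a n ^ r n - complex_of_real (b n ^ r n)) \<le> cmod (real n * (a n - b n)) * (real (r n) / real n)"
    proof (rule eventually_mono[OF eventually_gt_at_top[of 0]])
      fix n :: nat assume n: "0 < n"
      have "norm (a n ^ r n - complex_of_real (b n) ^ r n) \<le> r n * norm (a n - complex_of_real (b n))"
        using b[of n] by (intro norm_power_diff a) auto
      also have "\<dots> = cmod (real n * (a n - b n)) * (real (r n) / real n)"
        using n by (simp add: norm_mult)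
      finally show "norm (a n ^ r n - complex_of_real (b n ^ r n)) \<le> cmod (real n * (a n - b n)) * (real (r n) / real n)" by simp
    qed
  qed
  have "(\<lambda>n. complex_of_real (b n ^ r n)) \<longlonglongrightarrow> complex_of_real (exp (- c * \<rho>))"
  proof -
    have "(\<lambda>n. exp (- c * (real (r n) / real n))) \<longlonglongrightarrow> exp (- c * \<rho>)"
      by (intro tendsto_intros r)
    moreover have "b n ^ r n = exp (- c * (real (r n) / real n))" for n
      by (simp add: b_def exp_of_nat_mult[symmetric] field_simps)
    ultimately show ?thesis by (intro tendsto_of_real) simp
  qed
  then show ?thesis by (rule Lim_transform) (rule diff)
qed

subsection \<open>Random environments\<close>

lemma real_distribution_prob_algebra:
  "\<nu> \<in> space (prob_algebra borel) \<Longrightarrow> real_distribution \<nu>"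
  by (simp add: space_prob_algebra real_distribution_def real_distribution_axioms_def)

lemma measurable_char_prob_algebra [measurable]:
  "(\<lambda>\<nu>. char \<nu> t) \<in> borel_measurable (prob_algebra borel)"
  unfolding char_def
  by (rule measurable_compose[OF measurable_prob_algebraD[OF measurable_ident_sets[OF refl]] integral_measurable_subprob_algebra]) simp

lemma measurable_char_prod [measurable]:
  "(\<lambda>\<nu>. char_prod \<nu> \<theta>s s) \<in> borel_measurable (prob_algebra borel)"
  by (induction \<theta>s) (simp_all add: borel_measurable_times measurable_char_prob_algebra)

lemma (in prob_space) annealed_square_integrable:
  assumes \<kappa>: "\<kappa> \<in> measurable M (prob_algebra borel)"
    and fin: "(\<integral>\<^sup>+\<omega>. \<integral>\<^sup>+x. ennreal (x\<^sup>2) \<partial>\<kappa> \<omega> \<partial>M) < \<infinity>"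
  shows "AE \<omega> in M. integrable (\<kappa> \<omega>) (\<lambda>x. x\<^sup>2)"
    and "integrable M (\<lambda>\<omega>. \<integral>x. x\<^sup>2 \<partial>\<kappa> \<omega>)"
    and "integrable M (\<lambda>\<omega>. \<integral>x. x \<partial>\<kappa> \<omega>)"
    and "integrable M (\<lambda>\<omega>. (\<integral>x. x \<partial>\<kappa> \<omega>)\<^sup>2)"
    and "ennreal (expectation (\<lambda>\<omega>. \<integral>x. x\<^sup>2 \<partial>\<kappa> \<omega>)) = (\<integral>\<^sup>+\<omega>. \<integral>\<^sup>+x. ennreal (x\<^sup>2) \<partial>\<kappa> \<omega> \<partial>M)"
proof -
  have sub: "\<kappa> \<in> measurable M (subprob_algebra borel)" using \<kappa> by (rule measurable_prob_algebraD)
  have \<kappa>D: "real_distribution (\<kappa> \<omega>)" if "\<omega> \<in> space M" for \<omega>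
    using measurable_space[OF \<kappa> that] by (rule real_distribution_prob_algebra)
  have nn: "(\<lambda>\<omega>. \<integral>\<^sup>+x. ennreal (x\<^sup>2) \<partial>\<kappa> \<omega>) \<in> borel_measurable M"
    by (rule measurable_compose[OF sub nn_integral_measurable_subprob_algebra]) simp
  have meas: "(\<lambda>\<omega>. \<integral>x. x\<^sup>2 \<partial>\<kappa> \<omega>) \<in> borel_measurable M" "(\<lambda>\<omega>. \<integral>x. x \<partial>\<kappa> \<omega>) \<in> borel_measurable M"
    by (rule measurable_compose[OF sub integral_measurable_subprob_algebra], simp)+
  have "AE \<omega> in M. (\<integral>\<^sup>+x. ennreal (x\<^sup>2) \<partial>\<kappa> \<omega>) \<noteq> \<infinity>"
    using fin by (intro nn_integral_PInf_AE nn) auto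
  then show int: "AE \<omega> in M. integrable (\<kappa> \<omega>) (\<lambda>x. x\<^sup>2)"
  proof (rule AE_mp, intro AE_I2 impI)
    fix \<omega> assume \<omega>: "\<omega> \<in> space M" and "(\<integral>\<^sup>+x. ennreal (x\<^sup>2) \<partial>\<kappa> \<omega>) \<noteq> \<infinity>"
    interpret K: real_distribution "\<kappa> \<omega>" using \<omega> by (rule \<kappa>D)
    show "integrable (\<kappa> \<omega>) (\<lambda>x. x\<^sup>2)"
      using \<open>(\<integral>\<^sup>+x. ennreal (x\<^sup>2) \<partial>\<kappa> \<omega>) \<noteq> \<infinity>\<close> by (intro integrableI_bounded) (auto simp: less_top)
  qed
  \<comment> \<open>Equality of the inner integrals is available only outside a null set: where the
    square is not integrable, the Bochner integral is 0 and the nonnegative one infinite.\<close>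
  have eq: "(\<integral>\<^sup>+\<omega>. ennreal (\<integral>x. x\<^sup>2 \<partial>\<kappa> \<omega>) \<partial>M) = (\<integral>\<^sup>+\<omega>. \<integral>\<^sup>+x. ennreal (x\<^sup>2) \<partial>\<kappa> \<omega> \<partial>M)"
    by (rule nn_integral_cong_AE, rule AE_mp[OF int], rule AE_I2) (simp add: nn_integral_eq_integral)
  show q: "integrable M (\<lambda>\<omega>. \<integral>x. x\<^sup>2 \<partial>\<kappa> \<omega>)"
    using fin eq meas(1) by (intro integrableI_bounded) simp_all
  show "ennreal (expectation (\<lambda>\<omega>. \<integral>x. x\<^sup>2 \<partial>\<kappa> \<omega>)) = (\<integral>\<^sup>+\<omega>. \<integral>\<^sup>+x. ennreal (x\<^sup>2) \<partial>\<kappa> \<omega> \<partial>M)"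
    unfolding eq[symmetric] using q by (intro nn_integral_eq_integral[symmetric]) auto
  have "AE \<omega> in M. norm ((\<integral>x. x \<partial>\<kappa> \<omega>)\<^sup>2) \<le> norm (\<integral>x. x\<^sup>2 \<partial>\<kappa> \<omega>)"
  proof (rule AE_mp[OF int], intro AE_I2 impI)
    fix \<omega> assume \<omega>: "\<omega> \<in> space M" and i: "integrable (\<kappa> \<omega>) (\<lambda>x. x\<^sup>2)"
    interpret K: real_distribution "\<kappa> \<omega>" using \<omega> by (rule \<kappa>D)
    have "\<bar>K.expectation (\<lambda>x. x)\<bar> \<le> K.expectation (\<lambda>x. \<bar>x\<bar>)" by (rule integral_abs_bound)
    then have "(K.expectation (\<lambda>x. x))\<^sup>2 \<le> (K.expectation (\<lambda>x. \<bar>x\<bar>))\<^sup>2"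
      by (metis abs_ge_zero power2_abs power_mono)
    then show "norm ((\<integral>x. x \<partial>\<kappa> \<omega>)\<^sup>2) \<le> norm (\<integral>x. x\<^sup>2 \<partial>\<kappa> \<omega>)"
      using K.expectation_abs_power2_le[OF i] by simp
  qed
  then show m2: "integrable M (\<lambda>\<omega>. (\<integral>x. x \<partial>\<kappa> \<omega>)\<^sup>2)"
    using meas(2) by (intro Bochner_Integration.integrable_bound[OF q]) simp_all
  show "integrable M (\<lambda>\<omega>. \<integral>x. x \<partial>\<kappa> \<omega>)"
    using meas(2) m2 by (rule square_integrable_imp_integrable)
qed

text \<open>In a fixed environment the linear term is of order \<open>s\<close> and would dominate.
  It is subtracted before dividing by \<open>s\<^sup>2\<close>, so that dominated convergence
  applies, and costs nothing on average because the quenched means average to zero.\<close>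

lemma (in prob_space) annealed_char_prod_tendsto:
  fixes \<kappa> :: "'a \<Rightarrow> real measure"
  assumes \<kappa>: "\<kappa> \<in> measurable M (prob_algebra borel)"
    and fin: "(\<integral>\<^sup>+\<omega>. \<integral>\<^sup>+x. ennreal (x\<^sup>2) \<partial>\<kappa> \<omega> \<partial>M) < \<infinity>"
    and s: "s \<longlonglongrightarrow> 0" "\<forall>\<^sub>F n in sequentially. s n \<noteq> 0"
  defines "m \<equiv> \<lambda>\<omega>. \<integral>x. x \<partial>\<kappa> \<omega>" and "q \<equiv> \<lambda>\<omega>. \<integral>x. x\<^sup>2 \<partial>\<kappa> \<omega>"
  assumes mean: "expectation m = 0"
  shows "(\<lambda>n. (expectation (\<lambda>\<omega>. char_prod (\<kappa> \<omega>) \<theta>s (s n)) - 1) / (s n)\<^sup>2)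
    \<longlonglongrightarrow> - complex_of_real (((\<Sum>\<theta>\<leftarrow>\<theta>s. \<theta>\<^sup>2) * (expectation q - expectation (\<lambda>\<omega>. (m \<omega>)\<^sup>2))
      + (sum_list \<theta>s)\<^sup>2 * expectation (\<lambda>\<omega>. (m \<omega>)\<^sup>2)) / 2)"
proof -
  note sq = annealed_square_integrable[OF \<kappa> fin, folded m_def q_def]
  have \<kappa>D: "real_distribution (\<kappa> \<omega>)" if "\<omega> \<in> space M" for \<omega>
    using measurable_space[OF \<kappa> that] by (rule real_distribution_prob_algebra)
  define \<Theta> where "\<Theta> = sum_list \<theta>s"
  define g where "g n \<omega> = (char_prod (\<kappa> \<omega>) \<theta>s (s n) - 1 - \<i> * (s n * \<Theta> * m \<omega>)) / (s n)\<^sup>2" for n \<omega>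
  define h where "h \<omega> = - complex_of_real (((\<Sum>\<theta>\<leftarrow>\<theta>s. \<theta>\<^sup>2) * (q \<omega> - (m \<omega>)\<^sup>2) + \<Theta>\<^sup>2 * (m \<omega>)\<^sup>2) / 2)" for \<omega>
  have meas_char [measurable]: "(\<lambda>\<omega>. char_prod (\<kappa> \<omega>) \<theta>s (s n)) \<in> borel_measurable M" for n
    using \<kappa> by (rule measurable_compose) simp
  have int_char: "integrable M (\<lambda>\<omega>. char_prod (\<kappa> \<omega>) \<theta>s (s n))" for n
    by (rule integrable_const_bound[where B=1], rule AE_I2)
      (auto intro!: real_distribution.cmod_char_prod_le_1 \<kappa>D)
  have [measurable]: "m \<in> borel_measurable M" "q \<in> borel_measurable M" using sq by auto
  have "(\<lambda>n. expectation (g n)) \<longlonglongrightarrow> expectation h"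
  proof (rule integral_dominated_convergence)
    show "integrable M (\<lambda>\<omega>. (\<Sum>\<theta>\<leftarrow>\<theta>s. \<bar>\<theta>\<bar>)\<^sup>2 * q \<omega>)" using sq by simp
    show "AE \<omega> in M. (\<lambda>n. g n \<omega>) \<longlonglongrightarrow> h \<omega>"
    proof (rule AE_mp[OF sq(1)], intro AE_I2 impI)
      fix \<omega> assume \<omega>: "\<omega> \<in> space M" "integrable (\<kappa> \<omega>) (\<lambda>x. x\<^sup>2)"
      show "(\<lambda>n. g n \<omega>) \<longlonglongrightarrow> h \<omega>"
        using real_distribution.char_prod_second_order_tendsto[OF \<kappa>D \<omega>(2) s, of \<theta>s] \<omega>
        by (simp add: g_def h_def m_def q_def \<Theta>_def)
    qed
    show "AE \<omega> in M. norm (g n \<omega>) \<le> (\<Sum>\<theta>\<leftarrow>\<theta>s. \<bar>\<theta>\<bar>)\<^sup>2 * q \<omega>" for n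
    proof (rule AE_mp[OF sq(1)], intro AE_I2 impI)
      fix \<omega> assume \<omega>: "\<omega> \<in> space M" "integrable (\<kappa> \<omega>) (\<lambda>x. x\<^sup>2)"
      have "norm (g n \<omega>) = cmod (char_prod (\<kappa> \<omega>) \<theta>s (s n) - 1 - \<i> * (s n * \<Theta> * m \<omega>)) / (s n)\<^sup>2"
        by (simp add: g_def norm_divide norm_power)
      also have "\<dots> \<le> ((s n)\<^sup>2 * (\<Sum>\<theta>\<leftarrow>\<theta>s. \<bar>\<theta>\<bar>)\<^sup>2 * q \<omega>) / (s n)\<^sup>2"
        using real_distribution.cmod_char_prod_first_order_le[OF \<kappa>D \<omega>(2), of \<theta>s "s n"] \<omega>
        by (intro divide_right_mono) (auto simp: \<Theta>_def m_def q_def)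
      \<comment> \<open>Division by zero gives 0, so the bound also covers the indices with
        \<open>s n = 0\<close>.\<close>
      also have "\<dots> \<le> (\<Sum>\<theta>\<leftarrow>\<theta>s. \<bar>\<theta>\<bar>)\<^sup>2 * q \<omega>"
        by (cases "s n = 0") (auto simp: q_def)
      finally show "norm (g n \<omega>) \<le> (\<Sum>\<theta>\<leftarrow>\<theta>s. \<bar>\<theta>\<bar>)\<^sup>2 * q \<omega>" .
    qed
  qed (auto simp: g_def[abs_def] h_def[abs_def])
  moreover have "expectation (g n) = (expectation (\<lambda>\<omega>. char_prod (\<kappa> \<omega>) \<theta>s (s n)) - 1) / (s n)\<^sup>2" for n
  proof -
    have im: "integrable M (\<lambda>\<omega>. \<i> * (s n * \<Theta> * m \<omega>))" using sq by (intro integrable_mult_right integrable_of_real) auto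
    have "expectation (\<lambda>\<omega>. \<i> * (s n * \<Theta> * m \<omega>)) = 0"
      using mean by simp
    then have "expectation (\<lambda>\<omega>. char_prod (\<kappa> \<omega>) \<theta>s (s n) - 1 - \<i> * (s n * \<Theta> * m \<omega>))
      = expectation (\<lambda>\<omega>. char_prod (\<kappa> \<omega>) \<theta>s (s n)) - 1"
      using int_char im by (simp add: prob_space)
    then show ?thesis unfolding g_def by simp
  qed
  moreover have "expectation h = - complex_of_real (((\<Sum>\<theta>\<leftarrow>\<theta>s. \<theta>\<^sup>2) * (expectation q - expectation (\<lambda>\<omega>. (m \<omega>)\<^sup>2))
      + (sum_list \<theta>s)\<^sup>2 * expectation (\<lambda>\<omega>. (m \<omega>)\<^sup>2)) / 2)"
  proof -
    have "expectation h = - complex_of_real (expectation (\<lambda>\<omega>. ((\<Sum>\<theta>\<leftarrow>\<theta>s. \<theta>\<^sup>2) * (q \<omega> - (m \<omega>)\<^sup>2) + \<Theta>\<^sup>2 * (m \<omega>)\<^sup>2) / 2))"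
      unfolding h_def by (simp only: Bochner_Integration.integral_minus integral_complex_of_real)
    moreover have "integrable M (\<lambda>\<omega>. (m \<omega>)\<^sup>2)" using sq(4) by (simp add: m_def)
    ultimately show ?thesis using sq(2) by (simp add: \<Theta>_def algebra_simps)
  qed
  ultimately show ?thesis by simp
qed

subsection \<open>Conditional expectations\<close>

lemma subalgebra_generated_algebra:
  assumes "\<And>i. i \<in> I \<Longrightarrow> Y i \<in> measurable M K"
  shows "subalgebra M (generated_algebra M I K Y)"
proof -
  have Y: "(\<lambda>\<omega>. \<lambda>i\<in>I. Y i \<omega>) \<in> measurable M (\<Pi>\<^sub>M i\<in>I. K)"
    using assms by (rule measurable_restrict)
  have "(\<lambda>\<omega>. \<lambda>i\<in>I. Y i \<omega>) \<in> space M \<rightarrow> space (\<Pi>\<^sub>M i\<in>I. K)"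
    using measurable_space[OF Y] by blast
  then have "sets (generated_algebra M I K Y) = {(\<lambda>\<omega>. \<lambda>i\<in>I. Y i \<omega>) -` A \<inter> space M |A. A \<in> sets (\<Pi>\<^sub>M i\<in>I. K)}"
    unfolding generated_algebra_def by (rule sets_vimage_algebra2)
  then have "sets (generated_algebra M I K Y) \<subseteq> sets M"
    by (auto intro: measurable_sets[OF Y])
  then show ?thesis by (simp add: subalgebra_def generated_algebra_def)
qed

lemma measurable_generated_algebra:
  assumes "\<And>i. i \<in> I \<Longrightarrow> Y i \<in> measurable M K" "i \<in> I"
  shows "Y i \<in> measurable (generated_algebra M I K Y) K"
proof -
  have Y: "(\<lambda>\<omega>. \<lambda>i\<in>I. Y i \<omega>) \<in> measurable M (\<Pi>\<^sub>M i\<in>I. K)"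
    using assms(1) by (rule measurable_restrict)
  have "(\<lambda>\<omega>. \<lambda>i\<in>I. Y i \<omega>) \<in> space M \<rightarrow> space (\<Pi>\<^sub>M i\<in>I. K)"
    using measurable_space[OF Y] by blast
  then have "(\<lambda>\<omega>. \<lambda>i\<in>I. Y i \<omega>) \<in> measurable (generated_algebra M I K Y) (\<Pi>\<^sub>M i\<in>I. K)"
    unfolding generated_algebra_def by (rule measurable_vimage_algebra1)
  from measurable_compose[OF this measurable_component_singleton[OF assms(2)]]
  show ?thesis using assms(2) by simp
qed

text \<open>The candidate is a sum of complex characters that is not known to be real. Its imaginary
  part satisfies the characterization of the conditional expectation of 0 and hence vanishes almost
  everywhere.\<close>

lemma (in sigma_finite_subalgebra) real_cond_exp_complex_charact:
  fixes Z :: "'a \<Rightarrow> complex"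
  assumes Y: "integrable M Y" and Z: "integrable M Z" "Z \<in> borel_measurable F"
    and eq: "\<And>A. A \<in> sets F \<Longrightarrow> (\<integral>\<omega>. indicator A \<omega> * complex_of_real (Y \<omega>) \<partial>M) = (\<integral>\<omega>. indicator A \<omega> * Z \<omega> \<partial>M)"
  shows "AE \<omega> in M. complex_of_real (real_cond_exp M F Y \<omega>) = Z \<omega>"
proof -
  have sets: "A \<in> sets F \<Longrightarrow> A \<in> sets M" for A using subalg by (auto simp: subalgebra_def)
  have int: "integrable M (\<lambda>\<omega>. indicator A \<omega> * complex_of_real (Y \<omega>))"
    "integrable M (\<lambda>\<omega>. indicator A \<omega> * Z \<omega>)" if "A \<in> sets F" for A
    using sets[OF that] Y Z borel_measurable_integrable[OF Y] borel_measurable_integrable[OF Z(1)]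
    by - (rule Bochner_Integration.integrable_bound[OF Y], measurable, auto simp: indicator_def norm_mult,
      rule Bochner_Integration.integrable_bound[OF Z(1)], measurable, auto simp: indicator_def norm_mult)
  have ind: "Re (indicator A \<omega> * z) = indicator A \<omega> * Re z" "Im (indicator A \<omega> * z) = indicator A \<omega> * Im z"
    for A \<omega> z by (auto split: split_indicator)
  have re: "(\<integral>\<omega>. indicator A \<omega> * Y \<omega> \<partial>M) = (\<integral>\<omega>. indicator A \<omega> * Re (Z \<omega>) \<partial>M)" if "A \<in> sets F" for A
    using integral_Re[OF int(1)[OF that]] integral_Re[OF int(2)[OF that]] eq[OF that]
    by (simp only: ind Re_complex_of_real)
  have im: "(\<integral>\<omega>. indicator A \<omega> * 0 \<partial>M) = (\<integral>\<omega>. indicator A \<omega> * Im (Z \<omega>) \<partial>M)" if "A \<in> sets F" for A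
    using integral_Im[OF int(1)[OF that]] integral_Im[OF int(2)[OF that]] eq[OF that]
    by (simp only: ind Im_complex_of_real)
  have 1: "AE \<omega> in M. real_cond_exp M F Y \<omega> = Re (Z \<omega>)"
    using Y Z re by (intro real_cond_exp_charact) (auto simp: set_lebesgue_integral_def)
  have 2: "AE \<omega> in M. real_cond_exp M F (\<lambda>_. 0) \<omega> = Im (Z \<omega>)"
    using Y Z im by (intro real_cond_exp_charact) (auto simp: set_lebesgue_integral_def)
  have 3: "AE \<omega> in M. real_cond_exp M F (\<lambda>_. 0) \<omega> = 0"
    by (rule real_cond_exp_F_meas) auto
  show ?thesis using 1 2 3 by eventually_elim (simp add: complex_eq_iff)
qed

text \<open>The passage from indicators over simple functions to bounded measurable
  \<open>h\<close>. The weights \<open>C\<close> and \<open>C'\<close> stand for all factors that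
  belong to other steps, which makes the lemma usable inside an induction over the steps.\<close>

lemma (in prob_space) integral_kernel_extend:
  fixes C C' :: "'a \<Rightarrow> complex" and h :: "real \<Rightarrow> complex"
  assumes C: "integrable M C" "integrable M C'"
    and Y [measurable]: "Y \<in> borel_measurable M" and \<kappa>: "\<kappa> \<in> measurable M (prob_algebra borel)"
    and eq: "\<And>B. B \<in> sets borel \<Longrightarrow> (\<integral>\<omega>. C \<omega> * indicator B (Y \<omega>) \<partial>M) = (\<integral>\<omega>. C' \<omega> * measure (\<kappa> \<omega>) B \<partial>M)"
    and h [measurable]: "h \<in> borel_measurable borel" and bd: "\<And>x. cmod (h x) \<le> 1"
  shows "(\<integral>\<omega>. C \<omega> * h (Y \<omega>) \<partial>M) = (\<integral>\<omega>. C' \<omega> * (\<integral>x. h x \<partial>\<kappa> \<omega>) \<partial>M)"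
proof -
  have sub: "\<kappa> \<in> measurable M (subprob_algebra borel)" using \<kappa> by (rule measurable_prob_algebraD)
  have \<kappa>D: "real_distribution (\<kappa> \<omega>)" if "\<omega> \<in> space M" for \<omega>
    using measurable_space[OF \<kappa> that] by (rule real_distribution_prob_algebra)
  have meas_int: "(\<lambda>\<omega>. \<integral>x. g x \<partial>\<kappa> \<omega>) \<in> borel_measurable M" if "g \<in> borel_measurable borel" for g :: "real \<Rightarrow> complex"
    using that by (intro measurable_compose[OF sub integral_measurable_subprob_algebra])
  have meas_measure: "(\<lambda>\<omega>. measure (\<kappa> \<omega>) B) \<in> borel_measurable M" if "B \<in> sets borel" for B
    using that by (intro measurable_compose[OF sub measurable_measure_subprob_algebra])
  \<comment> \<open>The approximating sequence satisfies
    \<open>cmod (g i x) \<le> 2 * cmod (h x)\<close>, which is where the constant 2 in both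
    dominating functions comes from.\<close>
  obtain g where g: "\<And>i. simple_function borel (g i)" "\<And>x. (\<lambda>i. g i x) \<longlonglongrightarrow> h x" "\<And>i x. cmod (g i x) \<le> 2 * cmod (h x)"
    using borel_measurable_implies_sequence_metric[OF h, of 0] by auto
  have gm [measurable]: "g i \<in> borel_measurable borel" for i
    using g(1) by (rule borel_measurable_simple_function)
  have g2: "cmod (g i x) \<le> 2" for i x using g(3)[of i x] bd[of x] by linarith
  have simple: "(\<integral>\<omega>. C \<omega> * g i (Y \<omega>) \<partial>M) = (\<integral>\<omega>. C' \<omega> * (\<integral>x. g i x \<partial>\<kappa> \<omega>) \<partial>M)" for i
  proof -
    define R where "R = range (g i)"
    have fin: "finite R" using simple_functionD(1)[OF g(1)[of i]] by (simp add: R_def)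
    have B: "g i -` {y} \<in> sets borel" for y
      using measurable_sets[OF gm[of i], of "{y}"] by simp
    have rep: "g i x = (\<Sum>y\<in>R. y * indicator (g i -` {y}) x)" for x
      using fin by (simp add: indicator_def R_def if_distrib[of "\<lambda>a. _ * a"] sum.delta' cong: if_cong)
    have "(\<integral>\<omega>. C \<omega> * g i (Y \<omega>) \<partial>M) = (\<integral>\<omega>. (\<Sum>y\<in>R. y * (C \<omega> * indicator (g i -` {y}) (Y \<omega>))) \<partial>M)"
      by (subst rep) (simp add: sum_distrib_left mult_ac)
    also have "\<dots> = (\<Sum>y\<in>R. y * (\<integral>\<omega>. C \<omega> * indicator (g i -` {y}) (Y \<omega>) \<partial>M))"
    proof (subst Bochner_Integration.integral_sum)
      fix y
      have [measurable]: "g i -` {y} \<in> sets borel" by (rule B)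
      have "integrable M (\<lambda>\<omega>. C \<omega> * indicator (g i -` {y}) (Y \<omega>))"
        using borel_measurable_integrable[OF C(1)]
        by (intro Bochner_Integration.integrable_bound[OF C(1)]) (auto simp: norm_mult indicator_def intro!: borel_measurable_times)
      then show "integrable M (\<lambda>\<omega>. y * (C \<omega> * indicator (g i -` {y}) (Y \<omega>)))" by simp
    qed simp
    also have "\<dots> = (\<Sum>y\<in>R. y * (\<integral>\<omega>. C' \<omega> * measure (\<kappa> \<omega>) (g i -` {y}) \<partial>M))"
      using eq[OF B] by simp
    also have "\<dots> = (\<integral>\<omega>. (\<Sum>y\<in>R. y * (C' \<omega> * measure (\<kappa> \<omega>) (g i -` {y}))) \<partial>M)"
    proof (subst Bochner_Integration.integral_sum)
      fix y
      have "integrable M (\<lambda>\<omega>. C' \<omega> * complex_of_real (measure (\<kappa> \<omega>) (g i -` {y})))"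
      proof (rule Bochner_Integration.integrable_bound[OF C(2)])
        show "(\<lambda>\<omega>. C' \<omega> * complex_of_real (measure (\<kappa> \<omega>) (g i -` {y}))) \<in> borel_measurable M"
          using meas_measure[OF B[of y]] borel_measurable_integrable[OF C(2)] by simp
        show "AE \<omega> in M. cmod (C' \<omega> * complex_of_real (measure (\<kappa> \<omega>) (g i -` {y}))) \<le> cmod (C' \<omega>)"
        proof (rule AE_I2)
          fix \<omega> assume "\<omega> \<in> space M"
          then interpret K: real_distribution "\<kappa> \<omega>" by (rule \<kappa>D)
          show "cmod (C' \<omega> * complex_of_real (measure (\<kappa> \<omega>) (g i -` {y}))) \<le> cmod (C' \<omega>)"
            by (simp add: norm_mult mult_left_le)
        qed
      qed
      then show "integrable M (\<lambda>\<omega>. y * (C' \<omega> * complex_of_real (measure (\<kappa> \<omega>) (g i -` {y}))))" by simp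
    qed simp
    also have "\<dots> = (\<integral>\<omega>. C' \<omega> * (\<integral>x. g i x \<partial>\<kappa> \<omega>) \<partial>M)"
    proof (rule Bochner_Integration.integral_cong[OF refl])
      fix \<omega> assume "\<omega> \<in> space M"
      then interpret K: real_distribution "\<kappa> \<omega>" by (rule \<kappa>D)
      have indK: "integrable (\<kappa> \<omega>) (\<lambda>x. indicator (g i -` {y}) x :: complex)"
        "(\<integral>x. indicator (g i -` {y}) x \<partial>\<kappa> \<omega>) = complex_of_real (measure (\<kappa> \<omega>) (g i -` {y}))" for y
      proof -
        have *: "(\<lambda>x. indicator (g i -` {y}) x :: complex) = (\<lambda>x. complex_of_real (indicator (g i -` {y}) x))"
          by (auto split: split_indicator)
        have "integrable (\<kappa> \<omega>) (\<lambda>x. indicator (g i -` {y}) x :: real)"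
          using B[of y] by (intro K.integrable_const_bound[where B=1]) (auto simp: indicator_def)
        then show "integrable (\<kappa> \<omega>) (\<lambda>x. indicator (g i -` {y}) x :: complex)" unfolding * by (rule integrable_of_real)
        show "(\<integral>x. indicator (g i -` {y}) x \<partial>\<kappa> \<omega>) = complex_of_real (measure (\<kappa> \<omega>) (g i -` {y}))"
          unfolding * integral_complex_of_real using B[of y] by simp
      qed
      have "(\<integral>x. g i x \<partial>\<kappa> \<omega>) = (\<Sum>y\<in>R. y * measure (\<kappa> \<omega>) (g i -` {y}))"
        using indK by (subst rep, subst Bochner_Integration.integral_sum) (auto intro!: integrable_mult_right)
      then show "(\<Sum>y\<in>R. y * (C' \<omega> * measure (\<kappa> \<omega>) (g i -` {y}))) = C' \<omega> * (\<integral>x. g i x \<partial>\<kappa> \<omega>)"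
        by (simp add: sum_distrib_left mult_ac)
    qed
    finally show ?thesis .
  qed
  have l: "(\<lambda>i. \<integral>\<omega>. C \<omega> * g i (Y \<omega>) \<partial>M) \<longlonglongrightarrow> (\<integral>\<omega>. C \<omega> * h (Y \<omega>) \<partial>M)"
  proof (rule integral_dominated_convergence)
    show "integrable M (\<lambda>\<omega>. 2 * cmod (C \<omega>))" using C by simp
    show "AE \<omega> in M. (\<lambda>i. C \<omega> * g i (Y \<omega>)) \<longlonglongrightarrow> C \<omega> * h (Y \<omega>)"
      by (intro AE_I2 tendsto_intros g)
    show "AE \<omega> in M. norm (C \<omega> * g i (Y \<omega>)) \<le> 2 * cmod (C \<omega>)" for i
      by (rule AE_I2) (metis g2 mult.commute mult_right_mono norm_ge_zero norm_mult)
  qed (use borel_measurable_integrable[OF C(1)] in auto)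
  have r: "(\<lambda>i. \<integral>\<omega>. C' \<omega> * (\<integral>x. g i x \<partial>\<kappa> \<omega>) \<partial>M) \<longlonglongrightarrow> (\<integral>\<omega>. C' \<omega> * (\<integral>x. h x \<partial>\<kappa> \<omega>) \<partial>M)"
  proof (rule integral_dominated_convergence)
    show "integrable M (\<lambda>\<omega>. 2 * cmod (C' \<omega>))" using C by simp
    show "AE \<omega> in M. (\<lambda>i. C' \<omega> * (\<integral>x. g i x \<partial>\<kappa> \<omega>)) \<longlonglongrightarrow> C' \<omega> * (\<integral>x. h x \<partial>\<kappa> \<omega>)"
    proof (rule AE_I2)
      fix \<omega> assume "\<omega> \<in> space M"
      then interpret K: real_distribution "\<kappa> \<omega>" by (rule \<kappa>D)
      have "(\<lambda>i. \<integral>x. g i x \<partial>\<kappa> \<omega>) \<longlonglongrightarrow> (\<integral>x. h x \<partial>\<kappa> \<omega>)"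
        by (rule integral_dominated_convergence[where w="\<lambda>_. 2"]) (auto simp: g g2)
      then show "(\<lambda>i. C' \<omega> * (\<integral>x. g i x \<partial>\<kappa> \<omega>)) \<longlonglongrightarrow> C' \<omega> * (\<integral>x. h x \<partial>\<kappa> \<omega>)"
        by (intro tendsto_intros)
    qed
    show "AE \<omega> in M. norm (C' \<omega> * (\<integral>x. g i x \<partial>\<kappa> \<omega>)) \<le> 2 * cmod (C' \<omega>)" for i
    proof (rule AE_I2)
      fix \<omega> assume "\<omega> \<in> space M"
      then interpret K: real_distribution "\<kappa> \<omega>" by (rule \<kappa>D)
      have "cmod (\<integral>x. g i x \<partial>\<kappa> \<omega>) \<le> (\<integral>x. cmod (g i x) \<partial>\<kappa> \<omega>)"
        by (rule integral_norm_bound)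
      also have "\<dots> \<le> 2"
        by (intro K.integral_le_const K.integrable_const_bound[where B=2]) (auto simp: g2)
      finally have "cmod (\<integral>x. g i x \<partial>\<kappa> \<omega>) \<le> 2" .
      then show "norm (C' \<omega> * (\<integral>x. g i x \<partial>\<kappa> \<omega>)) \<le> 2 * cmod (C' \<omega>)"
        by (metis mult.commute mult_right_mono norm_ge_zero norm_mult)
    qed
  qed (use borel_measurable_integrable[OF C(2)] meas_int in auto)
  show ?thesis using LIMSEQ_unique[OF l] r simple by simp
qed

subsection \<open>The quenched law of the steps\<close>

lemma complex_of_real_indicator: "complex_of_real (indicator A x) = indicator A x"
  by (simp add: indicator_def)

lemma prod_indicator:
  "finite J \<Longrightarrow> (\<Prod>i\<in>J. indicator (B i) (y i)) = (if \<forall>i\<in>J. y i \<in> B i then 1 else 0 :: real)"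
  by (induction rule: finite_induct) auto

context random_walk_in_random_environment
begin

abbreviation env :: "'a measure"
  where "env \<equiv> generated_algebra M {1..} (prob_algebra borel) \<mu>"

lemma env_measurable: "n \<ge> 1 \<Longrightarrow> \<mu> n \<in> measurable M (prob_algebra borel)"
  using indep_env unfolding indep_vars_def by auto

lemma env_subprob: "n \<ge> 1 \<Longrightarrow> \<mu> n \<in> measurable M (subprob_algebra borel)"
  by (rule measurable_prob_algebraD[OF env_measurable])

lemma subalgebra_env: "subalgebra M env"
  by (rule subalgebra_generated_algebra) (simp add: env_measurable)

lemma sets_env: "A \<in> sets env \<Longrightarrow> A \<in> sets M"
  using subalgebra_env by (auto simp: subalgebra_def)

lemma env_measurable_env: "n \<ge> 1 \<Longrightarrow> \<mu> n \<in> measurable env (prob_algebra borel)"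
  by (rule measurable_generated_algebra) (auto simp: env_measurable)

lemma finite_measure_subalgebra_env: "finite_measure_subalgebra M env"
  using subalgebra_env finite_measure_axioms
  by (intro finite_measure_subalgebra.intro finite_measure_subalgebra_axioms.intro)

sublocale E: sigma_finite_subalgebra M env
  by (rule finite_measure_subalgebra_is_sigma_finite[OF finite_measure_subalgebra_env])

lemma env_real_distribution: "n \<ge> 1 \<Longrightarrow> \<omega> \<in> space M \<Longrightarrow> real_distribution (\<mu> n \<omega>)"
  using measurable_space[OF env_measurable] by (intro real_distribution_prob_algebra) auto

lemma measurable_env_measure: "n \<ge> 1 \<Longrightarrow> B \<in> sets borel \<Longrightarrow> (\<lambda>\<omega>. measure (\<mu> n \<omega>) B) \<in> borel_measurable M"
  by (rule measurable_compose[OF env_subprob measurable_measure_subprob_algebra])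

lemma measurable_env_integral:
  fixes g :: "real \<Rightarrow> complex"
  shows "n \<ge> 1 \<Longrightarrow> g \<in> borel_measurable borel \<Longrightarrow> (\<lambda>\<omega>. \<integral>x. g x \<partial>\<mu> n \<omega>) \<in> borel_measurable M"
  by (rule measurable_compose[OF env_subprob integral_measurable_subprob_algebra])

lemma step_event: "n \<ge> 1 \<Longrightarrow> B \<in> sets borel \<Longrightarrow> {\<omega> \<in> space M. X n \<omega> \<in> B} \<in> sets M"
  using measurable_sets[OF step_measurable, of n B] by (simp add: vimage_def Int_def conj_commute)

lemma steps_event:
  assumes "finite J" "J \<subseteq> {1..}" "\<And>i. i \<in> J \<Longrightarrow> B i \<in> sets borel"
  shows "{\<omega> \<in> space M. \<forall>i\<in>J. X i \<omega> \<in> B i} \<in> sets M"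
  using assms by (intro sets.sets_Collect_finite_All step_event) auto

lemma cond_indep_events:
  assumes A: "A \<in> sets env" and J: "finite J" "J \<subseteq> {1..}" "\<And>i. i \<in> J \<Longrightarrow> B i \<in> sets borel"
  shows "(\<integral>\<omega>. indicator A \<omega> * (\<Prod>i\<in>J. indicator (B i) (X i \<omega>)) \<partial>M)
    = (\<integral>\<omega>. indicator A \<omega> * (\<Prod>i\<in>J. measure (\<mu> i \<omega>) (B i)) \<partial>M :: real)"
proof -
  let ?E = "{\<omega> \<in> space M. \<forall>i\<in>J. X i \<omega> \<in> B i}"
  have E: "?E \<in> sets M"
    using J by (rule steps_event)
  have "(\<integral>\<omega>. indicator A \<omega> * (\<Prod>i\<in>J. indicator (B i) (X i \<omega>)) \<partial>M) = (\<integral>\<omega>. indicator A \<omega> * indicator ?E \<omega> \<partial>M :: real)"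
    using J(1) by (intro Bochner_Integration.integral_cong) (simp_all add: prod_indicator[OF J(1)] indicator_def)
  also have "\<dots> = (\<integral>\<omega>. indicator A \<omega> * real_cond_exp M env (indicator ?E) \<omega> \<partial>M)"
    using E A sets_env[OF A] by (intro E.real_cond_exp_intg(2)[symmetric])
      (auto intro!: integrable_const_bound[where B=1] simp: indicator_def)
  also have "\<dots> = (\<integral>\<omega>. indicator A \<omega> * (\<Prod>i\<in>J. measure (\<mu> i \<omega>) (B i)) \<partial>M)"
  proof (rule integral_cong_AE)
    have "AE \<omega> in M. real_cond_exp M env (indicator ?E) \<omega> = (\<Prod>i\<in>J. measure (\<mu> i \<omega>) (B i))"
      using J by (rule cond_indep_steps)
    then show "AE \<omega> in M. indicator A \<omega> * real_cond_exp M env (indicator ?E) \<omega>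
        = indicator A \<omega> * (\<Prod>i\<in>J. measure (\<mu> i \<omega>) (B i))"
      by eventually_elim simp
    show "(\<lambda>\<omega>. indicator A \<omega> * (\<Prod>i\<in>J. measure (\<mu> i \<omega>) (B i))) \<in> borel_measurable M"
      using sets_env[OF A] J(2,3)
      by (intro borel_measurable_times borel_measurable_indicator borel_measurable_prod measurable_env_measure) auto
  qed (use sets_env[OF A] in simp)
  finally show ?thesis .
qed

text \<open>The indicator factors are carried along so that the factors can be generalized from
  indicators to functions one step at a time.\<close>

lemma cond_indep_mixed:
  fixes h :: "nat \<Rightarrow> real \<Rightarrow> complex"
  assumes A: "A \<in> sets env" and J: "finite J" "J \<subseteq> {1..}" and J': "finite J'" "J' \<subseteq> {1..}" "J \<inter> J' = {}"
    and B: "\<And>i. i \<in> J' \<Longrightarrow> B i \<in> sets borel"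
    and h: "\<And>i. h i \<in> borel_measurable borel" "\<And>i x. cmod (h i x) \<le> 1"
  shows "(\<integral>\<omega>. indicator A \<omega> * (\<Prod>i\<in>J. h i (X i \<omega>)) * (\<Prod>i\<in>J'. indicator (B i) (X i \<omega>)) \<partial>M)
    = (\<integral>\<omega>. indicator A \<omega> * (\<Prod>i\<in>J. \<integral>x. h i x \<partial>\<mu> i \<omega>) * (\<Prod>i\<in>J'. complex_of_real (measure (\<mu> i \<omega>) (B i))) \<partial>M)"
  using J J' B
proof (induction J arbitrary: J' B rule: finite_induct)
  case empty
  have "(\<integral>\<omega>. complex_of_real (indicator A \<omega> * (\<Prod>i\<in>J'. indicator (B i) (X i \<omega>))) \<partial>M)
    = (\<integral>\<omega>. complex_of_real (indicator A \<omega> * (\<Prod>i\<in>J'. measure (\<mu> i \<omega>) (B i))) \<partial>M)"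
    unfolding integral_complex_of_real using cond_indep_events[OF A, of J' B] empty by simp
  then show ?case by (simp add: complex_of_real_indicator)
next
  case (insert j J)
  have j: "j \<ge> 1" "j \<notin> J'" using insert by auto
  let ?C = "\<lambda>\<omega>. indicator A \<omega> * (\<Prod>i\<in>J. h i (X i \<omega>)) * (\<Prod>i\<in>J'. indicator (B i) (X i \<omega>)) :: complex"
  let ?C' = "\<lambda>\<omega>. indicator A \<omega> * (\<Prod>i\<in>J. \<integral>x. h i x \<partial>\<mu> i \<omega>) * (\<Prod>i\<in>J'. complex_of_real (measure (\<mu> i \<omega>) (B i)))"
  have A': "A \<in> sets M" by (rule sets_env[OF A])
  have hint: "cmod (\<integral>x. h i x \<partial>\<mu> i \<omega>) \<le> 1" if "i \<ge> 1" "\<omega> \<in> space M" for i \<omega>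
  proof -
    interpret K: real_distribution "\<mu> i \<omega>" using that by (rule env_real_distribution)
    have "cmod (\<integral>x. h i x \<partial>\<mu> i \<omega>) \<le> (\<integral>x. cmod (h i x) \<partial>\<mu> i \<omega>)" by (rule integral_norm_bound)
    also have "\<dots> \<le> 1" using h by (intro K.integral_le_const K.integrable_const_bound[where B=1]) auto
    finally show ?thesis .
  qed
  have C: "integrable M ?C"
  proof (rule integrable_const_bound[where B=1])
    show "AE \<omega> in M. cmod (?C \<omega>) \<le> 1"
      by (rule AE_I2) (auto simp: norm_mult prod_norm[symmetric] indicator_def intro!: mult_le_one prod_le_1 prod_nonneg h)
    show "?C \<in> borel_measurable M"
      using A' insert.prems step_measurable h(1)
      by (intro borel_measurable_times borel_measurable_prod borel_measurable_indicator measurable_compose[OF step_measurable]) (auto simp: subset_eq)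
  qed
  have C': "integrable M ?C'"
  proof (rule integrable_const_bound[where B=1])
    show "AE \<omega> in M. cmod (?C' \<omega>) \<le> 1"
    proof (rule AE_I2)
      fix \<omega> assume \<omega>: "\<omega> \<in> space M"
      have "measure (\<mu> i \<omega>) (B i) \<le> 1" if "i \<in> J'" for i
      proof -
        interpret K: real_distribution "\<mu> i \<omega>" using that insert.prems \<omega> by (intro env_real_distribution) auto
        show ?thesis by simp
      qed
      moreover have "cmod (\<integral>x. h i x \<partial>\<mu> i \<omega>) \<le> 1" if "i \<in> J" for i
        using that insert.prems \<omega> by (intro hint) auto
      ultimately show "cmod (?C' \<omega>) \<le> 1"
        by (auto simp: norm_mult prod_norm[symmetric] indicator_def intro!: mult_le_one prod_le_1 prod_nonneg)
    qed
    show "?C' \<in> borel_measurable M"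
    proof (intro borel_measurable_times borel_measurable_prod borel_measurable_indicator A')
      show "(\<lambda>\<omega>. \<integral>x. h i x \<partial>\<mu> i \<omega>) \<in> borel_measurable M" if "i \<in> J" for i
        using that insert.prems h(1) by (intro measurable_env_integral) auto
      show "(\<lambda>\<omega>. complex_of_real (measure (\<mu> i \<omega>) (B i))) \<in> borel_measurable M" if "i \<in> J'" for i
      proof -
        have "(\<lambda>\<omega>. measure (\<mu> i \<omega>) (B i)) \<in> borel_measurable M"
          using that insert.prems by (intro measurable_env_measure) auto
        then show ?thesis by (rule measurable_compose) simp
      qed
    qed
  qed
  have "(\<integral>\<omega>. ?C \<omega> * h j (X j \<omega>) \<partial>M) = (\<integral>\<omega>. ?C' \<omega> * (\<integral>x. h j x \<partial>\<mu> j \<omega>) \<partial>M)"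
  proof (rule integral_kernel_extend[OF C C' step_measurable[OF j(1)] env_measurable[OF j(1)] _ h])
    fix S :: "real set" assume S: "S \<in> sets borel"
    \<comment> \<open>The index \<open>j\<close> joins the indicator factors with an arbitrary set
      \<open>S\<close>. The induction hypothesis, general in \<open>J'\<close> and \<open>B\<close>,
      is then exactly the identity for indicators that is to be extended to
      \<open>h j\<close>.\<close>
    let ?B = "B(j := S)"
    have *: "(\<Prod>i\<in>insert j J'. indicator (?B i) (X i \<omega>)) = indicator S (X j \<omega>) * (\<Prod>i\<in>J'. indicator (B i) (X i \<omega>) :: complex)"
      "(\<Prod>i\<in>insert j J'. complex_of_real (measure (\<mu> i \<omega>) (?B i))) = measure (\<mu> j \<omega>) S * (\<Prod>i\<in>J'. complex_of_real (measure (\<mu> i \<omega>) (B i)))" for \<omega>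
      using j(2) insert.prems by (auto intro!: prod.cong)
    have "(\<integral>\<omega>. indicator A \<omega> * (\<Prod>i\<in>J. h i (X i \<omega>)) * (\<Prod>i\<in>insert j J'. indicator (?B i) (X i \<omega>)) \<partial>M)
      = (\<integral>\<omega>. indicator A \<omega> * (\<Prod>i\<in>J. \<integral>x. h i x \<partial>\<mu> i \<omega>) * (\<Prod>i\<in>insert j J'. complex_of_real (measure (\<mu> i \<omega>) (?B i))) \<partial>M)"
      using insert.prems insert.hyps S by (intro insert.IH) auto
    then show "(\<integral>\<omega>. ?C \<omega> * indicator S (X j \<omega>) \<partial>M) = (\<integral>\<omega>. ?C' \<omega> * measure (\<mu> j \<omega>) S \<partial>M)"
      unfolding * by (simp only: mult_ac)
  qed
  then show ?case using insert.hyps by (simp add: mult_ac)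
qed

lemma cond_indep_prod:
  fixes h :: "nat \<Rightarrow> real \<Rightarrow> complex"
  assumes "A \<in> sets env" "finite J" "J \<subseteq> {1..}"
    and "\<And>i. h i \<in> borel_measurable borel" "\<And>i x. cmod (h i x) \<le> 1"
  shows "(\<integral>\<omega>. indicator A \<omega> * (\<Prod>i\<in>J. h i (X i \<omega>)) \<partial>M) = (\<integral>\<omega>. indicator A \<omega> * (\<Prod>i\<in>J. \<integral>x. h i x \<partial>\<mu> i \<omega>) \<partial>M)"
  using cond_indep_mixed[of A J "{}" "\<lambda>_. {}" h] assms by simp

lemma quenched_char:
  assumes "A \<in> sets env"
  shows "(\<integral>\<omega>. indicator A \<omega> * iexp (\<Sum>i=1..n. t i * X i \<omega>) \<partial>M)
    = (\<integral>\<omega>. indicator A \<omega> * (\<Prod>i=1..n. char (\<mu> i \<omega>) (t i)) \<partial>M)"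
proof -
  have "iexp (\<Sum>i=1..n. t i * X i \<omega>) = (\<Prod>i=1..n. iexp (t i * X i \<omega>))" for \<omega>
    by (simp add: sum_distrib_left exp_sum)
  moreover have "(\<integral>\<omega>. indicator A \<omega> * (\<Prod>i=1..n. (\<lambda>x. iexp (t i * x)) (X i \<omega>)) \<partial>M)
    = (\<integral>\<omega>. indicator A \<omega> * (\<Prod>i=1..n. \<integral>x. (\<lambda>x. iexp (t i * x)) x \<partial>\<mu> i \<omega>) \<partial>M)"
    by (rule cond_indep_prod[OF assms]) auto
  ultimately show ?thesis by (simp add: char_def)
qed

lemma measurable_quenched_char:
  "(\<lambda>\<omega>. \<Prod>i=1..n. char (\<mu> i \<omega>) (t i)) \<in> borel_measurable env"
  by (intro borel_measurable_prod measurable_compose[OF env_measurable_env]) auto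

lemma cmod_quenched_char_le: "\<omega> \<in> space M \<Longrightarrow> cmod (\<Prod>i=1..n. char (\<mu> i \<omega>) (t i)) \<le> 1"
  by (auto simp: prod_norm[symmetric] intro!: prod_le_1 real_distribution.cmod_char_le_1 env_real_distribution)

subsection \<open>The annealed law of the steps\<close>

lemma expectation_env_cong:
  fixes g :: "real measure \<Rightarrow> 'c :: {banach, second_countable_topology}"
  assumes "n \<ge> 1" "g \<in> borel_measurable (prob_algebra borel)"
  shows "expectation (\<lambda>\<omega>. g (\<mu> n \<omega>)) = expectation (\<lambda>\<omega>. g (\<mu> 1 \<omega>))"
  using integral_distr[OF env_measurable assms(2), of n] integral_distr[OF env_measurable assms(2), of 1]
    ident_env[OF assms(1)] assms(1) by simp

lemma expectation_env_prod:
  fixes g :: "nat \<Rightarrow> real measure \<Rightarrow> 'c :: {real_normed_field, banach, second_countable_topology}"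
  assumes J: "finite J" "J \<subseteq> {1..}" and g: "\<And>i. i \<in> J \<Longrightarrow> g i \<in> borel_measurable (prob_algebra borel)"
    "\<And>i \<omega>. i \<in> J \<Longrightarrow> \<omega> \<in> space M \<Longrightarrow> norm (g i (\<mu> i \<omega>)) \<le> 1"
  shows "expectation (\<lambda>\<omega>. \<Prod>i\<in>J. g i (\<mu> i \<omega>)) = (\<Prod>i\<in>J. expectation (\<lambda>\<omega>. g i (\<mu> 1 \<omega>)))"
proof -
  have "indep_vars (\<lambda>_. borel) (\<lambda>i \<omega>. g i (\<mu> i \<omega>)) J"
    by (rule indep_vars_compose2[OF indep_vars_subset[OF indep_env J(2)]]) (use g in auto)
  moreover have "integrable M (\<lambda>\<omega>. g i (\<mu> i \<omega>))" if "i \<in> J" for i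
    using g[OF that] J that by (intro integrable_const_bound[where B=1] measurable_compose[OF env_measurable]) (auto simp: subset_eq)
  ultimately have "expectation (\<lambda>\<omega>. \<Prod>i\<in>J. g i (\<mu> i \<omega>)) = (\<Prod>i\<in>J. expectation (\<lambda>\<omega>. g i (\<mu> i \<omega>)))"
    using J(1) by (intro indep_vars_lebesgue_integral) auto
  also have "\<dots> = (\<Prod>i\<in>J. expectation (\<lambda>\<omega>. g i (\<mu> 1 \<omega>)))"
    using J g by (intro prod.cong expectation_env_cong) (auto simp: subset_eq)
  finally show ?thesis .
qed

lemma prob_steps:
  assumes J: "finite J" "J \<subseteq> {1..}" and B: "\<And>i. i \<in> J \<Longrightarrow> B i \<in> sets borel"
  shows "prob {\<omega> \<in> space M. \<forall>i\<in>J. X i \<omega> \<in> B i} = (\<Prod>i\<in>J. expectation (\<lambda>\<omega>. measure (\<mu> 1 \<omega>) (B i)))"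
proof -
  have sp: "space M \<in> sets env" using subalgebra_env sets.top[of env] by (simp add: subalgebra_def)
  let ?E = "{\<omega> \<in> space M. \<forall>i\<in>J. X i \<omega> \<in> B i}"
  have E: "?E \<in> sets M"
    using J B by (rule steps_event)
  have "prob ?E = (\<integral>\<omega>. indicator ?E \<omega> \<partial>M)" using E by simp
  also have "\<dots> = (\<integral>\<omega>. indicator (space M) \<omega> * (\<Prod>i\<in>J. indicator (B i) (X i \<omega>)) \<partial>M)"
    using J(1) by (intro Bochner_Integration.integral_cong) (simp_all add: prod_indicator[OF J(1)] indicator_def)
  also have "\<dots> = (\<integral>\<omega>. indicator (space M) \<omega> * (\<Prod>i\<in>J. measure (\<mu> i \<omega>) (B i)) \<partial>M)"
    using J B by (intro cond_indep_events sp)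
  also have "\<dots> = expectation (\<lambda>\<omega>. \<Prod>i\<in>J. measure (\<mu> i \<omega>) (B i))"
    by (intro Bochner_Integration.integral_cong) auto
  also have "\<dots> = (\<Prod>i\<in>J. expectation (\<lambda>\<omega>. measure (\<mu> 1 \<omega>) (B i)))"
  proof (rule expectation_env_prod[OF J])
    show "(\<lambda>\<nu>. measure \<nu> (B i)) \<in> borel_measurable (prob_algebra borel)" if "i \<in> J" for i
      using B[OF that] by (intro measurable_compose[OF measurable_prob_algebraD[OF measurable_ident_sets[OF refl]] measurable_measure_subprob_algebra])
    show "norm (measure (\<mu> i \<omega>) (B i)) \<le> 1" if "i \<in> J" "\<omega> \<in> space M" for i \<omega>
    proof -
      interpret K: real_distribution "\<mu> i \<omega>" using that J by (intro env_real_distribution) auto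
      show ?thesis by simp
    qed
  qed
  finally show ?thesis .
qed

lemma prob_step: "n \<ge> 1 \<Longrightarrow> B \<in> sets borel \<Longrightarrow> prob {\<omega> \<in> space M. X n \<omega> \<in> B} = expectation (\<lambda>\<omega>. measure (\<mu> 1 \<omega>) B)"
  using prob_steps[of "{n}" "\<lambda>_. B"] by simp

text \<open>Given the environment the steps are independent, and their conditional laws are
  themselves i.i.d.; averaging factorizes once more. Classical tools for sums of i.i.d. variables
  thus become available under the annealed law.\<close>

lemma indep_steps: "indep_vars (\<lambda>_. borel) X {1..}"
proof -
  have "indep_sets (\<lambda>i. {X i -` A \<inter> space M |A. A \<in> sets borel}) {1..}"
  proof (rule indep_setsI)
    fix i :: nat assume "i \<in> {1..}"
    then show "{X i -` A \<inter> space M |A. A \<in> sets borel} \<subseteq> events"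
      using measurable_sets[OF step_measurable] by auto
  next
    fix A J assume J: "J \<noteq> {}" "J \<subseteq> {1::nat..}" "finite J" and A: "\<forall>j\<in>J. A j \<in> {X j -` A \<inter> space M |A. A \<in> sets borel}"
    then obtain B where B: "\<And>j. j \<in> J \<Longrightarrow> B j \<in> sets borel \<and> A j = X j -` B j \<inter> space M" by (simp add: Bex_def) metis
    have "(\<Inter>j\<in>J. A j) = {\<omega> \<in> space M. \<forall>i\<in>J. X i \<omega> \<in> B i}" using B J(1) by auto
    then have "prob (\<Inter>j\<in>J. A j) = (\<Prod>i\<in>J. expectation (\<lambda>\<omega>. measure (\<mu> 1 \<omega>) (B i)))"
      using prob_steps[of J B] J B by simp
    also have "\<dots> = (\<Prod>j\<in>J. prob (A j))"
    proof (rule prod.cong[OF refl])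
      fix j assume j: "j \<in> J"
      have "A j = {\<omega> \<in> space M. X j \<omega> \<in> B j}" using B[OF j] by auto
      then show "expectation (\<lambda>\<omega>. measure (\<mu> 1 \<omega>) (B j)) = prob (A j)"
        using prob_step[of j "B j"] B[OF j] j J by auto
    qed
    finally show "prob (\<Inter>j\<in>J. A j) = (\<Prod>j\<in>J. prob (A j))" .
  qed
  then show ?thesis unfolding indep_vars_def2 using step_measurable by auto
qed

text \<open>The annealed law of a step is the mean of the random law \<open>\<mu> 1\<close>,
  whichever step is taken. Writing it as a bind turns integrals of the step into iterated integrals
  over the environment.\<close>

lemma distr_step: "n \<ge> 1 \<Longrightarrow> distr M borel (X n) = M \<bind> \<mu> 1"
proof (rule measure_eqI)
  assume n: "n \<ge> 1"
  have sub: "\<mu> 1 \<in> measurable M (subprob_algebra borel)" by (rule env_subprob) simp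
  show sets: "sets (distr M borel (X n)) = sets (M \<bind> \<mu> 1)"
    using sets_bind[of M "\<mu> 1" borel, OF sets_kernel[OF sub] not_empty] by (simp only: sets_distr)
  fix B assume "B \<in> sets (distr M borel (X n))"
  then have B: "B \<in> sets borel" by simp
  have "emeasure (distr M borel (X n)) B = emeasure M {\<omega> \<in> space M. X n \<omega> \<in> B}"
    using B n step_measurable[OF n] by (subst emeasure_distr) (auto simp: vimage_def Int_def conj_commute)
  also have "\<dots> = ennreal (expectation (\<lambda>\<omega>. measure (\<mu> 1 \<omega>) B))"
    using prob_step[OF n B] by (simp add: emeasure_eq_measure)
  also have "\<dots> = (\<integral>\<^sup>+\<omega>. ennreal (measure (\<mu> 1 \<omega>) B) \<partial>M)"
  proof (rule nn_integral_eq_integral[symmetric])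
    show "integrable M (\<lambda>\<omega>. measure (\<mu> 1 \<omega>) B)"
    proof (rule integrable_const_bound[where B=1])
      show "AE \<omega> in M. norm (measure (\<mu> 1 \<omega>) B) \<le> 1"
      proof (rule AE_I2)
        fix \<omega> assume "\<omega> \<in> space M"
        then interpret K: real_distribution "\<mu> 1 \<omega>" by (intro env_real_distribution) auto
        show "norm (measure (\<mu> 1 \<omega>) B) \<le> 1" using K.prob_le_1[of B] by simp
      qed
    qed (rule measurable_env_measure[OF _ B], simp)
  qed simp
  also have "\<dots> = (\<integral>\<^sup>+\<omega>. emeasure (\<mu> 1 \<omega>) B \<partial>M)"
  proof (rule nn_integral_cong)
    fix \<omega> assume "\<omega> \<in> space M"
    then interpret K: real_distribution "\<mu> 1 \<omega>" by (intro env_real_distribution) auto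
    show "ennreal (measure (\<mu> 1 \<omega>) B) = emeasure (\<mu> 1 \<omega>) B" by (rule K.emeasure_eq_measure[symmetric])
  qed
  also have "\<dots> = emeasure (M \<bind> \<mu> 1) B"
    using not_empty by (rule emeasure_bind[OF _ sub B, symmetric])
  finally show "emeasure (distr M borel (X n)) B = emeasure (M \<bind> \<mu> 1) B" .
qed

lemma distr_step_eq: "n \<ge> 1 \<Longrightarrow> distr M borel (X n) = distr M borel (X 1)"
  by (simp add: distr_step)

lemma nn_integral_step:
  assumes "g \<in> borel_measurable borel"
  shows "(\<integral>\<^sup>+\<omega>. g (X 1 \<omega>) \<partial>M) = (\<integral>\<^sup>+\<omega>. \<integral>\<^sup>+x. g x \<partial>\<mu> 1 \<omega> \<partial>M)"
proof -
  have "(\<integral>\<^sup>+\<omega>. g (X 1 \<omega>) \<partial>M) = (\<integral>\<^sup>+x. g x \<partial>distr M borel (X 1))"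
    using assms step_measurable[of 1] by (simp add: nn_integral_distr)
  also have "\<dots> = (\<integral>\<^sup>+\<omega>. \<integral>\<^sup>+x. g x \<partial>\<mu> 1 \<omega> \<partial>M)"
    unfolding distr_step[OF order_refl] by (rule nn_integral_bind[OF assms env_subprob]) simp
  finally show ?thesis .
qed

end

subsection \<open>Blocks of steps\<close>

text \<open>Rounding makes the blocks \<open>{n * j div m<..n * Suc j div m}\<close> unequal in
  length, so the block of a step is found as the first one whose right endpoint has been
  reached.\<close>

definition block_of :: "nat \<Rightarrow> nat \<Rightarrow> nat \<Rightarrow> nat"
  where "block_of m n i = (LEAST j. i \<le> n * Suc j div m)"

lemma block_of_eq:
  assumes "i \<in> {n * j div m<..n * Suc j div m}"
  shows "block_of m n i = j"
  unfolding block_of_def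
proof (rule Least_equality)
  fix y assume y: "i \<le> n * Suc y div m"
  show "j \<le> y"
  proof (rule ccontr)
    assume "\<not> j \<le> y"
    then have "n * Suc y div m \<le> n * j div m" by (intro div_le_mono mult_le_mono2) simp
    with y assms show False by simp
  qed
qed (use assms in simp)

lemma block_endpoints_mono: "n * j div m \<le> n * Suc j div (m :: nat)"
  by (intro div_le_mono mult_le_mono2) simp

lemma ivl_blocks:
  "{0<..n * Suc k div m} = {0<..n * k div m} \<union> {n * k div m<..n * Suc k div (m :: nat)}"
  "{0<..n * k div m} \<inter> {n * k div m<..n * Suc k div m} = {}"
  using block_endpoints_mono[of n k m] by (auto simp del: mult_Suc_right)

lemma prod_over_blocks:
  "(\<Prod>i\<in>{0<..n * k div m}. g i) = (\<Prod>j<k. \<Prod>i\<in>{n * j div m<..n * Suc j div m}. g i)"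
  by (induction k) (simp_all add: ivl_blocks(1) prod.union_disjoint ivl_blocks(2) del: mult_Suc_right)

lemma sum_over_blocks:
  "(\<Sum>i\<in>{0<..n * k div m}. g i) = (\<Sum>j<k. \<Sum>i\<in>{n * j div m<..n * Suc j div m}. g i)"
  by (induction k) (simp_all add: ivl_blocks(1) sum.union_disjoint ivl_blocks(2) del: mult_Suc_right)

lemma prod_block_of:
  assumes "m > 0"
  shows "(\<Prod>i=1..n. g (block_of m n i) i) = (\<Prod>j<m. \<Prod>i\<in>{n * j div m<..n * Suc j div m}. g j i)"
proof -
  have "{1..n} = {0<..n * m div m}" using assms by auto
  then have "(\<Prod>i=1..n. g (block_of m n i) i)
    = (\<Prod>j<m. \<Prod>i\<in>{n * j div m<..n * Suc j div m}. g (block_of m n i) i)"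
    by (simp only: prod_over_blocks)
  also have "\<dots> = (\<Prod>j<m. \<Prod>i\<in>{n * j div m<..n * Suc j div m}. g j i)"
    by (intro prod.cong refl) (simp only: block_of_eq)
  finally show ?thesis .
qed

lemma sum_block_of:
  assumes "m > 0"
  shows "(\<Sum>i=1..n. g (block_of m n i) i) = (\<Sum>j<m. \<Sum>i\<in>{n * j div m<..n * Suc j div m}. g j i)"
proof -
  have "{1..n} = {0<..n * m div m}" using assms by auto
  then have "(\<Sum>i=1..n. g (block_of m n i) i)
    = (\<Sum>j<m. \<Sum>i\<in>{n * j div m<..n * Suc j div m}. g (block_of m n i) i)"
    by (simp only: sum_over_blocks)
  also have "\<dots> = (\<Sum>j<m. \<Sum>i\<in>{n * j div m<..n * Suc j div m}. g j i)"
    by (intro sum.cong refl) (simp only: block_of_eq)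
  finally show ?thesis .
qed

lemma real_div_bounds:
  "real (a div m) \<le> real a / real m" "m > 0 \<Longrightarrow> real a / real m - 1 < real (a div m)"
proof -
  have eq: "real a = real m * real (a div m) + real (a mod m)"
    by (metis mult_div_mod_eq of_nat_add of_nat_mult)
  show "real (a div m) \<le> real a / real m"
    using eq by (cases "m = 0") (simp_all add: field_simps)
  assume m: "m > 0"
  have "real (a mod m) < real m" using m by simp
  with eq show "real a / real m - 1 < real (a div m)" using m by (simp add: field_simps)
qed

lemma block_endpoint_tendsto:
  assumes "m > 0"
  shows "(\<lambda>n. real (n * j div m) / real n) \<longlonglongrightarrow> real j / real m"
proof (rule real_tendsto_sandwich)
  show "\<forall>\<^sub>F n in sequentially. real j / real m - 1 / real n \<le> real (n * j div m) / real n"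
  proof (rule eventually_mono[OF eventually_gt_at_top[of 0]])
    fix n :: nat assume n: "n > 0"
    have "real j / real m - 1 / real n = (real (n * j) / real m - 1) / real n" using n by (simp add: field_simps)
    also have "\<dots> \<le> real (n * j div m) / real n"
      using real_div_bounds(2)[OF assms, of "n * j"] by (intro divide_right_mono) auto
    finally show "real j / real m - 1 / real n \<le> real (n * j div m) / real n" .
  qed
  show "\<forall>\<^sub>F n in sequentially. real (n * j div m) / real n \<le> real j / real m"
  proof (rule eventually_mono[OF eventually_gt_at_top[of 0]])
    fix n :: nat assume n: "n > 0"
    have "real (n * j div m) / real n \<le> (real (n * j) / real m) / real n"
      using real_div_bounds(1)[of "n * j" m] by (intro divide_right_mono) auto
    also have "\<dots> = real j / real m" using n by simp
    finally show "real (n * j div m) / real n \<le> real j / real m" .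
  qed
  show "(\<lambda>n. real j / real m - 1 / real n) \<longlonglongrightarrow> real j / real m"
    using tendsto_diff[OF tendsto_const lim_1_over_n, of "real j / real m"] by simp
qed simp

lemma block_length_tendsto:
  assumes "m > 0"
  shows "(\<lambda>n. real (n * Suc j div m - n * j div m) / real n) \<longlonglongrightarrow> 1 / real m"
proof -
  have "(\<lambda>n. real (n * Suc j div m) / real n - real (n * j div m) / real n) \<longlonglongrightarrow> real (Suc j) / real m - real j / real m"
    by (intro tendsto_diff block_endpoint_tendsto assms)
  moreover have "real (n * Suc j div m) / real n - real (n * j div m) / real n = real (n * Suc j div m - n * j div m) / real n" for n
    using block_endpoints_mono[of n j m] by (simp add: of_nat_diff diff_divide_distrib del: mult_Suc_right)
  moreover have "real (Suc j) / real m - real j / real m = 1 / real m" by (simp add: add_divide_distrib)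
  ultimately show ?thesis by simp
qed

lemma prod_list_prod_swap:
  "(\<Prod>\<theta>\<leftarrow>\<theta>s. \<Prod>i\<in>I. g \<theta> i) = (\<Prod>i\<in>I. \<Prod>\<theta>\<leftarrow>\<theta>s. g \<theta> i :: 'b :: comm_monoid_mult)"
  by (induction \<theta>s) (simp_all add: prod.distrib)

context random_walk_in_random_environment
begin

subsection \<open>Moments\<close>

lemma walk_1: "walk X 1 = X 1"
  by (simp add: walk_def fun_eq_iff)

text \<open>By the tower property and \<open>x \<le> 1 + x\<^sup>2\<close>, applied to the quenched
  moment, the annealed moment of order \<alpha> is finite; it dominates the second moment since
  \<open>\<alpha> > 2\<close>.\<close>

lemma square_integrable_step:
  assumes \<alpha>: "\<alpha> > 2"
    and fin: "(\<integral>\<^sup>+\<omega>. (quenched_nn_exp M \<mu> (\<lambda>\<omega>. ennreal (\<bar>walk X 1 \<omega>\<bar> powr \<alpha>)) \<omega>)\<^sup>2 \<partial>M) < \<infinity>"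
  shows "integrable M (\<lambda>\<omega>. (X 1 \<omega>)\<^sup>2)"
proof -
  have X1 [measurable]: "X 1 \<in> borel_measurable M" by (rule step_measurable) simp
  note X1 [simplified, measurable]
  define g where "g \<omega> = ennreal (\<bar>X 1 \<omega>\<bar> powr \<alpha>)" for \<omega>
  have [measurable]: "g \<in> borel_measurable M" unfolding g_def[abs_def] by measurable
  have fin': "(\<integral>\<^sup>+\<omega>. (nn_cond_exp M env g \<omega>)\<^sup>2 \<partial>M) < \<infinity>"
    using fin unfolding quenched_nn_exp_def walk_1 g_def .
  have [measurable]: "nn_cond_exp M env g \<in> borel_measurable M" by simp
  have "(\<integral>\<^sup>+\<omega>. g \<omega> \<partial>M) = (\<integral>\<^sup>+\<omega>. nn_cond_exp M env g \<omega> \<partial>M)"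
    using E.nn_cond_exp_intg[of "\<lambda>_. 1" g] by simp
  also have "\<dots> \<le> (\<integral>\<^sup>+\<omega>. 1 + (nn_cond_exp M env g \<omega>)\<^sup>2 \<partial>M)"
  proof (rule nn_integral_mono)
    fix \<omega>
    have "x \<le> 1 + x\<^sup>2" for x :: ennreal
    proof (cases "x \<le> 1")
      case True then show ?thesis by (simp add: add_increasing2)
    next
      case False
      then have "x * 1 \<le> x * x" by (intro mult_left_mono) auto
      then show ?thesis by (simp add: power2_eq_square add_increasing)
    qed
    then show "nn_cond_exp M env g \<omega> \<le> 1 + (nn_cond_exp M env g \<omega>)\<^sup>2" .
  qed
  also have "\<dots> = 1 + (\<integral>\<^sup>+\<omega>. (nn_cond_exp M env g \<omega>)\<^sup>2 \<partial>M)"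
    by (subst nn_integral_add) (auto simp: emeasure_space_1)
  also have "\<dots> < \<infinity>" using fin' by simp
  finally have "(\<integral>\<^sup>+\<omega>. g \<omega> \<partial>M) < \<infinity>" .
  then have "integrable M (\<lambda>\<omega>. \<bar>X 1 \<omega>\<bar> powr \<alpha>)"
    using X1 unfolding g_def by (intro integrableI_bounded) auto
  then have "integrable M (\<lambda>\<omega>. 1 + \<bar>X 1 \<omega>\<bar> powr \<alpha>)" by simp
  then show ?thesis
  proof (rule Bochner_Integration.integrable_bound)
    have "x\<^sup>2 \<le> 1 + \<bar>x\<bar> powr \<alpha>" for x :: real
    proof (cases "\<bar>x\<bar> \<le> 1")
      case True
      then have "\<bar>x\<bar>\<^sup>2 \<le> 1" by (intro power_le_one) auto
      then show ?thesis by (simp add: add_increasing2)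
    next
      case False
      then have "\<bar>x\<bar> powr 2 \<le> \<bar>x\<bar> powr \<alpha>" using \<alpha> by (intro powr_mono) auto
      moreover have "\<bar>x\<bar> powr 2 = x\<^sup>2" using False by simp
      ultimately show ?thesis by simp
    qed
    then show "AE \<omega> in M. norm ((X 1 \<omega>)\<^sup>2) \<le> norm (1 + \<bar>X 1 \<omega>\<bar> powr \<alpha>)"
      by (intro AE_I2) (simp add: add_nonneg_nonneg)
  qed simp
qed

lemma finite_annealed_square:
  assumes "integrable M (\<lambda>\<omega>. (X 1 \<omega>)\<^sup>2)"
  shows "(\<integral>\<^sup>+\<omega>. \<integral>\<^sup>+x. ennreal (x\<^sup>2) \<partial>\<mu> 1 \<omega> \<partial>M) = ennreal (expectation (\<lambda>\<omega>. (X 1 \<omega>)\<^sup>2))"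
  using nn_integral_step[of "\<lambda>x. ennreal (x\<^sup>2)"] nn_integral_eq_integral[OF assms] by simp

text \<open>\<open>cond_indep_prod\<close> speaks about bounded functions and the identity is
  unbounded, so it is truncated at level \<open>N\<close>. On the environment side the truncated
  means are dominated by
  \<open>1 + (\<integral>x. x\<^sup>2 \<partial>\<mu> 1 \<omega>)\<close>.\<close>

lemma quenched_mean_1_eq:
  assumes sq: "integrable M (\<lambda>\<omega>. (X 1 \<omega>)\<^sup>2)"
  shows "AE \<omega> in M. quenched_mean M \<mu> X 1 \<omega> = (\<integral>x. x \<partial>\<mu> 1 \<omega>)"
  unfolding quenched_mean_def quenched_exp_def walk_1
proof (rule E.real_cond_exp_charact)
  have \<mu>1: "\<mu> 1 \<in> measurable M (prob_algebra borel)" by (rule env_measurable) simp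
  have sub: "\<mu> 1 \<in> measurable M (subprob_algebra borel)" by (rule env_subprob) simp
  have fin: "(\<integral>\<^sup>+\<omega>. \<integral>\<^sup>+x. ennreal (x\<^sup>2) \<partial>\<mu> 1 \<omega> \<partial>M) < \<infinity>"
    using finite_annealed_square[OF sq] by simp
  note as = annealed_square_integrable[OF \<mu>1 fin]
  have X1 [measurable]: "X 1 \<in> borel_measurable M" by (rule step_measurable) simp
  note X1 [simplified, measurable]
  show iX: "integrable M (X 1)" using X1 sq by (rule square_integrable_imp_integrable)
  show "integrable M (\<lambda>\<omega>. \<integral>x. x \<partial>\<mu> 1 \<omega>)" by (rule as(3))
  show "(\<lambda>\<omega>. \<integral>x. x \<partial>\<mu> 1 \<omega>) \<in> borel_measurable env"
    by (rule measurable_compose[OF measurable_prob_algebraD[OF env_measurable_env] integral_measurable_subprob_algebra]) auto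
  fix A assume A: "A \<in> sets env"
  define c where "c N x = (if \<bar>x\<bar> \<le> real N then x else 0)" for N :: nat and x :: real
  have c: "\<bar>c N x\<bar> \<le> \<bar>x\<bar>" "\<bar>c N x\<bar> \<le> real N + 1" for N x by (auto simp: c_def)
  have c_lim: "(\<lambda>N. c N x) \<longlonglongrightarrow> x" for x
  proof (rule tendsto_eventually)
    show "\<forall>\<^sub>F N in sequentially. c N x = x"
      using eventually_ge_at_top[of "nat \<lceil>\<bar>x\<bar>\<rceil>"] by eventually_elim (auto simp: c_def nat_le_iff ceiling_le_iff)
  qed
  have [measurable]: "c N \<in> borel_measurable borel" for N unfolding c_def[abs_def] by measurable
  have [measurable]: "A \<in> sets M" by (rule sets_env[OF A])
  have c_meas: "(\<lambda>\<omega>. \<integral>x. c N x \<partial>\<mu> 1 \<omega>) \<in> borel_measurable M" for N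
    by (rule measurable_compose[OF sub integral_measurable_subprob_algebra]) simp
  have trunc: "(\<integral>\<omega>. indicator A \<omega> * c N (X 1 \<omega>) \<partial>M) = (\<integral>\<omega>. indicator A \<omega> * (\<integral>x. c N x \<partial>\<mu> 1 \<omega>) \<partial>M)" for N
  proof -
    \<comment> \<open>Scaling puts the truncation into the unit disc, as
      \<open>cond_indep_prod\<close> requires; \<open>N + 1\<close> rather than \<open>N\<close>
      keeps the divisor nonzero.\<close>
    let ?h = "\<lambda>x. complex_of_real (c N x / (real N + 1))"
    have "(\<integral>\<omega>. indicator A \<omega> * (\<Prod>i\<in>{1}. ?h (X i \<omega>)) \<partial>M) = (\<integral>\<omega>. indicator A \<omega> * (\<Prod>i\<in>{1}. \<integral>x. ?h x \<partial>\<mu> i \<omega>) \<partial>M)"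
      using c(2)[of N] by (intro cond_indep_prod[OF A]) (auto simp: norm_divide simp del: of_real_divide)
    then have "(\<integral>\<omega>. indicator A \<omega> * ?h (X 1 \<omega>) \<partial>M) = (\<integral>\<omega>. indicator A \<omega> * (\<integral>x. ?h x \<partial>\<mu> 1 \<omega>) \<partial>M)"
      by simp
    then have "(\<integral>\<omega>. indicator A \<omega> * (c N (X 1 \<omega>) / (real N + 1)) \<partial>M)
      = (\<integral>\<omega>. indicator A \<omega> * (\<integral>x. c N x / (real N + 1) \<partial>\<mu> 1 \<omega>) \<partial>M)"
      by (simp only: integral_complex_of_real complex_of_real_indicator[symmetric] of_real_mult[symmetric] of_real_eq_iff)
    then show ?thesis by simp
  qed
  have "(\<lambda>N. \<integral>\<omega>. indicator A \<omega> * c N (X 1 \<omega>) \<partial>M) \<longlonglongrightarrow> (\<integral>\<omega>. indicator A \<omega> * X 1 \<omega> \<partial>M)"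
  proof (rule integral_dominated_convergence)
    show "integrable M (\<lambda>\<omega>. \<bar>X 1 \<omega>\<bar>)" using iX by simp
    show "AE \<omega> in M. (\<lambda>N. indicator A \<omega> * c N (X 1 \<omega>)) \<longlonglongrightarrow> indicator A \<omega> * X 1 \<omega>"
      by (intro AE_I2 tendsto_intros c_lim)
    show "AE \<omega> in M. norm (indicator A \<omega> * c N (X 1 \<omega>)) \<le> \<bar>X 1 \<omega>\<bar>" for N
      using c(1) by (intro AE_I2) (auto simp: indicator_def)
  qed measurable
  moreover have "(\<lambda>N. \<integral>\<omega>. indicator A \<omega> * (\<integral>x. c N x \<partial>\<mu> 1 \<omega>) \<partial>M) \<longlonglongrightarrow> (\<integral>\<omega>. indicator A \<omega> * (\<integral>x. x \<partial>\<mu> 1 \<omega>) \<partial>M)"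
  proof (rule integral_dominated_convergence)
    show "integrable M (\<lambda>\<omega>. 1 + (\<integral>x. x\<^sup>2 \<partial>\<mu> 1 \<omega>))" using as(2) by simp
    show "AE \<omega> in M. (\<lambda>N. indicator A \<omega> * (\<integral>x. c N x \<partial>\<mu> 1 \<omega>)) \<longlonglongrightarrow> indicator A \<omega> * (\<integral>x. x \<partial>\<mu> 1 \<omega>)"
    proof (rule AE_mp[OF as(1)], intro AE_I2 impI)
      fix \<omega> assume \<omega>: "\<omega> \<in> space M" and i: "integrable (\<mu> 1 \<omega>) (\<lambda>x. x\<^sup>2)"
      interpret K: real_distribution "\<mu> 1 \<omega>" by (rule env_real_distribution[OF order_refl \<omega>])
      have "(\<lambda>N. \<integral>x. c N x \<partial>\<mu> 1 \<omega>) \<longlonglongrightarrow> (\<integral>x. x \<partial>\<mu> 1 \<omega>)"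
      proof (rule integral_dominated_convergence[where w="\<lambda>x. \<bar>x\<bar>"])
        show "integrable (\<mu> 1 \<omega>) (\<lambda>x. \<bar>x\<bar>)" using K.integrable_of_square[OF i] by (rule integrable_abs)
        show "(\<lambda>x. x) \<in> borel_measurable (\<mu> 1 \<omega>)" "c N \<in> borel_measurable (\<mu> 1 \<omega>)" for N
          unfolding measurable_cong_sets[OF K.events_eq_borel refl] by measurable
      qed (simp_all add: c_lim c(1))
      then show "(\<lambda>N. indicator A \<omega> * (\<integral>x. c N x \<partial>\<mu> 1 \<omega>)) \<longlonglongrightarrow> indicator A \<omega> * (\<integral>x. x \<partial>\<mu> 1 \<omega>)"
        by (intro tendsto_intros)
    qed
    show "AE \<omega> in M. norm (indicator A \<omega> * (\<integral>x. c N x \<partial>\<mu> 1 \<omega>)) \<le> 1 + (\<integral>x. x\<^sup>2 \<partial>\<mu> 1 \<omega>)" for N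
    proof (rule AE_mp[OF as(1)], intro AE_I2 impI)
      fix \<omega> assume \<omega>: "\<omega> \<in> space M" and i: "integrable (\<mu> 1 \<omega>) (\<lambda>x. x\<^sup>2)"
      interpret K: real_distribution "\<mu> 1 \<omega>" by (rule env_real_distribution[OF order_refl \<omega>])
      have "\<bar>\<integral>x. c N x \<partial>\<mu> 1 \<omega>\<bar> \<le> (\<integral>x. \<bar>c N x\<bar> \<partial>\<mu> 1 \<omega>)" by (rule integral_abs_bound)
      also have "\<dots> \<le> (\<integral>x. 1 + x\<^sup>2 \<partial>\<mu> 1 \<omega>)"
      proof (rule integral_mono)
        show "integrable (\<mu> 1 \<omega>) (\<lambda>x. \<bar>c N x\<bar>)"
        proof (rule K.integrable_const_bound[where B="real N + 1"])
          show "(\<lambda>x. \<bar>c N x\<bar>) \<in> borel_measurable (\<mu> 1 \<omega>)"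
            unfolding measurable_cong_sets[OF K.events_eq_borel refl] by measurable
        qed (use c(2) in simp)
        show "\<bar>c N x\<bar> \<le> 1 + x\<^sup>2" for x
        proof -
          have "0 \<le> (\<bar>x\<bar> - 1)\<^sup>2" by simp
          then have "2 * \<bar>x\<bar> \<le> 1 + x\<^sup>2" by (simp add: power2_diff)
          then show ?thesis using c(1)[of N x] by linarith
        qed
        show "integrable (\<mu> 1 \<omega>) (\<lambda>x. 1 + x\<^sup>2)"
          by (intro Bochner_Integration.integrable_add K.integrable_const i)
      qed
      also have "\<dots> = 1 + (\<integral>x. x\<^sup>2 \<partial>\<mu> 1 \<omega>)"
        using Bochner_Integration.integral_add[OF K.integrable_const i, of 1] K.prob_space by simp
      finally show "norm (indicator A \<omega> * (\<integral>x. c N x \<partial>\<mu> 1 \<omega>)) \<le> 1 + (\<integral>x. x\<^sup>2 \<partial>\<mu> 1 \<omega>)"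
        by (auto simp: indicator_def)
    qed
  qed (use c_meas borel_measurable_integrable[OF as(3)] in \<open>simp_all del: One_nat_def\<close>)
  ultimately have "(\<integral>\<omega>. indicator A \<omega> * X 1 \<omega> \<partial>M) = (\<integral>\<omega>. indicator A \<omega> * (\<integral>x. x \<partial>\<mu> 1 \<omega>) \<partial>M)"
    using trunc LIMSEQ_unique by simp
  then show "(\<integral>\<omega>\<in>A. X 1 \<omega> \<partial>M) = (\<integral>\<omega>\<in>A. (\<integral>x. x \<partial>\<mu> 1 \<omega>) \<partial>M)"
    by (simp add: set_lebesgue_integral_def)
qed

text \<open>\<open>X 1\<close> minus its quenched mean is orthogonal to the quenched mean, so the
  second moments of the two parts add up to \<open>1 + \<sigma>\<^sup>2\<close>. For the expansion
  this means \<open>E(q - a\<^sup>2) = 1\<close> and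
  \<open>E a\<^sup>2 = \<sigma>\<^sup>2\<close>.\<close>

lemma step_moments:
  assumes sq: "integrable M (\<lambda>\<omega>. (X 1 \<omega>)\<^sup>2)"
    and mean: "(\<integral>\<omega>. quenched_mean M \<mu> X 1 \<omega> \<partial>M) = 0"
    and var: "(\<integral>\<omega>. quenched_var M \<mu> X 1 \<omega> \<partial>M) = 1"
    and \<sigma>: "\<sigma>\<^sup>2 = (\<integral>\<omega>. (quenched_mean M \<mu> X 1 \<omega>)\<^sup>2 \<partial>M)"
  shows "expectation (X 1) = 0" "expectation (\<lambda>\<omega>. (X 1 \<omega>)\<^sup>2) = 1 + \<sigma>\<^sup>2"
    "expectation (\<lambda>\<omega>. \<integral>x. x \<partial>\<mu> 1 \<omega>) = 0" "expectation (\<lambda>\<omega>. (\<integral>x. x \<partial>\<mu> 1 \<omega>)\<^sup>2) = \<sigma>\<^sup>2"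
    "expectation (\<lambda>\<omega>. \<integral>x. x\<^sup>2 \<partial>\<mu> 1 \<omega>) = 1 + \<sigma>\<^sup>2"
proof -
  have \<mu>1: "\<mu> 1 \<in> measurable M (prob_algebra borel)" by (rule env_measurable) simp
  have fin: "(\<integral>\<^sup>+\<omega>. \<integral>\<^sup>+x. ennreal (x\<^sup>2) \<partial>\<mu> 1 \<omega> \<partial>M) < \<infinity>"
    using finite_annealed_square[OF sq] by simp
  note as = annealed_square_integrable[OF \<mu>1 fin]
  have X1 [measurable]: "X 1 \<in> borel_measurable M" by (rule step_measurable) simp
  note X1 [simplified, measurable]
  have iX: "integrable M (X 1)" using X1 sq by (rule square_integrable_imp_integrable)
  define c where "c = quenched_mean M \<mu> X 1"
  have c_eq: "c = real_cond_exp M env (X 1)"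
    by (simp only: c_def quenched_mean_def quenched_exp_def walk_1)
  have [measurable]: "c \<in> borel_measurable M" "c \<in> borel_measurable env" unfolding c_eq by simp_all
  have ae: "AE \<omega> in M. c \<omega> = (\<integral>x. x \<partial>\<mu> 1 \<omega>)" unfolding c_def by (rule quenched_mean_1_eq[OF sq])
  have m_meas: "(\<lambda>\<omega>. \<integral>x. x \<partial>\<mu> 1 \<omega>) \<in> borel_measurable M" using as(3) by simp
  have "integrable M (\<lambda>\<omega>. (\<integral>x. x \<partial>\<mu> 1 \<omega>)\<^sup>2) = integrable M (\<lambda>\<omega>. (c \<omega>)\<^sup>2)"
    using ae m_meas by (intro integrable_cong_AE) auto
  then have c2: "integrable M (\<lambda>\<omega>. (c \<omega>)\<^sup>2)" using as(4) by simp
  show "expectation (\<lambda>\<omega>. \<integral>x. x \<partial>\<mu> 1 \<omega>) = 0"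
  proof -
    have "expectation (\<lambda>\<omega>. \<integral>x. x \<partial>\<mu> 1 \<omega>) = expectation c"
      using ae m_meas by (intro integral_cong_AE) auto
    then show ?thesis using mean by (simp add: c_def)
  qed
  show "expectation (\<lambda>\<omega>. (\<integral>x. x \<partial>\<mu> 1 \<omega>)\<^sup>2) = \<sigma>\<^sup>2"
    unfolding \<sigma> c_def[symmetric] using ae m_meas by (intro integral_cong_AE) auto
  show "expectation (X 1) = 0"
    using E.real_cond_exp_int(2)[OF iX] mean unfolding c_def[symmetric] c_eq by simp
  have cX: "integrable M (\<lambda>\<omega>. c \<omega> * X 1 \<omega>)"
  proof (rule Bochner_Integration.integrable_bound[OF Bochner_Integration.integrable_add[OF c2 sq]])
    have "\<bar>a * b\<bar> \<le> a\<^sup>2 + b\<^sup>2" for a b :: real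
    proof -
      have "0 \<le> (\<bar>a\<bar> - \<bar>b\<bar>)\<^sup>2" by simp
      then have "2 * (\<bar>a\<bar> * \<bar>b\<bar>) \<le> a\<^sup>2 + b\<^sup>2" by (simp add: power2_diff)
      then show ?thesis by (simp add: abs_mult) (smt (verit) mult_nonneg_nonneg abs_ge_zero)
    qed
    then show "AE \<omega> in M. norm (c \<omega> * X 1 \<omega>) \<le> norm ((c \<omega>)\<^sup>2 + (X 1 \<omega>)\<^sup>2)" by (intro AE_I2) simp
  qed simp
  have eX2: "expectation (\<lambda>\<omega>. (X 1 \<omega>)\<^sup>2) = 1 + \<sigma>\<^sup>2"
  proof -
    have cc: "expectation (\<lambda>\<omega>. c \<omega> * X 1 \<omega>) = expectation (\<lambda>\<omega>. (c \<omega>)\<^sup>2)"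
    proof -
      have "expectation (\<lambda>\<omega>. c \<omega> * real_cond_exp M env (X 1) \<omega>) = expectation (\<lambda>\<omega>. c \<omega> * X 1 \<omega>)"
        by (rule E.real_cond_exp_intg(2)[OF cX]) measurable
      then show ?thesis unfolding c_eq[symmetric] by (simp add: power2_eq_square)
    qed
    have expand: "(\<lambda>\<omega>. (X 1 \<omega> - c \<omega>)\<^sup>2) = (\<lambda>\<omega>. (X 1 \<omega>)\<^sup>2 + (c \<omega>)\<^sup>2 - 2 * (c \<omega> * X 1 \<omega>))"
      by (simp add: fun_eq_iff power2_diff)
    have iv: "integrable M (\<lambda>\<omega>. (X 1 \<omega> - c \<omega>)\<^sup>2)" unfolding expand using sq c2 cX by simp
    have "1 = expectation (real_cond_exp M env (\<lambda>\<omega>. (X 1 \<omega> - c \<omega>)\<^sup>2))"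
      using var by (simp only: quenched_var_def quenched_exp_def centered_walk_def walk_1 c_def)
    also have "\<dots> = expectation (\<lambda>\<omega>. (X 1 \<omega> - c \<omega>)\<^sup>2)" by (rule E.real_cond_exp_int(2)[OF iv])
    also have "\<dots> = expectation (\<lambda>\<omega>. (X 1 \<omega>)\<^sup>2) - expectation (\<lambda>\<omega>. (c \<omega>)\<^sup>2)"
      unfolding expand using sq c2 cX cc by simp
    finally show ?thesis using \<sigma> by (simp add: c_def)
  qed
  then show "expectation (\<lambda>\<omega>. (X 1 \<omega>)\<^sup>2) = 1 + \<sigma>\<^sup>2" .
  have "ennreal (expectation (\<lambda>\<omega>. \<integral>x. x\<^sup>2 \<partial>\<mu> 1 \<omega>)) = ennreal (1 + \<sigma>\<^sup>2)"
    using as(5) finite_annealed_square[OF sq] eX2 by simp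
  then show "expectation (\<lambda>\<omega>. \<integral>x. x\<^sup>2 \<partial>\<mu> 1 \<omega>) = 1 + \<sigma>\<^sup>2"
    by (subst (asm) ennreal_inj) (auto intro!: integral_nonneg_AE add_nonneg_nonneg)
qed

subsection \<open>Joint moments of quenched characteristic functions\<close>

text \<open>A version of the conditional expectation of \<open>wave m \<theta>\<close> of the block
  increments given the environment, by \<open>quenched_wave_cond\<close>. The explicit product is
  bounded by 1 at every point and factorizes over the environments.\<close>

definition quenched_wave :: "nat \<Rightarrow> nat \<Rightarrow> (nat \<Rightarrow> real) \<Rightarrow> 'a \<Rightarrow> complex"
  where "quenched_wave m n \<theta> \<omega> = (\<Prod>i=1..n. char (\<mu> i \<omega>) (\<theta> (block_of m n i) / sqrt (real n)))"

text \<open>Exchanging the two products leaves one \<open>char_prod\<close> for each step.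
  Independence of the environments splits the expectation, and all factors in a block agree in mean,
  so a block contributes a power whose exponent is close to \<open>n / m\<close>. The expansion at
  \<open>s = 1 / sqrt n\<close> then gives the exponential.\<close>

lemma quenched_wave_moments_tendsto:
  assumes m: "m > 0" and sq: "integrable M (\<lambda>\<omega>. (X 1 \<omega>)\<^sup>2)"
    and moments: "expectation (\<lambda>\<omega>. \<integral>x. x \<partial>\<mu> 1 \<omega>) = 0" "expectation (\<lambda>\<omega>. (\<integral>x. x \<partial>\<mu> 1 \<omega>)\<^sup>2) = \<sigma>\<^sup>2"
      "expectation (\<lambda>\<omega>. \<integral>x. x\<^sup>2 \<partial>\<mu> 1 \<omega>) = 1 + \<sigma>\<^sup>2"
  shows "(\<lambda>n. expectation (\<lambda>\<omega>. \<Prod>\<theta>\<leftarrow>\<theta>s. quenched_wave m n \<theta> \<omega>))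
    \<longlonglongrightarrow> (\<Prod>j<m. complex_of_real (exp (- (((\<Sum>\<theta>\<leftarrow>\<theta>s. (\<theta> j)\<^sup>2) + \<sigma>\<^sup>2 * (\<Sum>\<theta>\<leftarrow>\<theta>s. \<theta> j)\<^sup>2) / 2) * (1 / real m))))"
proof -
  have \<mu>1: "\<mu> 1 \<in> measurable M (prob_algebra borel)" by (rule env_measurable) simp
  have fin: "(\<integral>\<^sup>+\<omega>. \<integral>\<^sup>+x. ennreal (x\<^sup>2) \<partial>\<mu> 1 \<omega> \<partial>M) < \<infinity>"
    using finite_annealed_square[OF sq] by simp
  define a where "a j n = expectation (\<lambda>\<omega>. char_prod (\<mu> 1 \<omega>) (map (\<lambda>\<theta>. \<theta> j) \<theta>s) (1 / sqrt (real n)))" for j n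
  have eq: "expectation (\<lambda>\<omega>. \<Prod>\<theta>\<leftarrow>\<theta>s. quenched_wave m n \<theta> \<omega>) = (\<Prod>j<m. a j n ^ (n * Suc j div m - n * j div m))" for n
  proof -
    have "(\<Prod>\<theta>\<leftarrow>\<theta>s. quenched_wave m n \<theta> \<omega>)
      = (\<Prod>i=1..n. char_prod (\<mu> i \<omega>) (map (\<lambda>\<theta>. \<theta> (block_of m n i)) \<theta>s) (1 / sqrt (real n)))" for \<omega>
      unfolding quenched_wave_def prod_list_prod_swap by (simp add: char_prod_def o_def)
    then have "expectation (\<lambda>\<omega>. \<Prod>\<theta>\<leftarrow>\<theta>s. quenched_wave m n \<theta> \<omega>)
      = expectation (\<lambda>\<omega>. \<Prod>i=1..n. char_prod (\<mu> i \<omega>) (map (\<lambda>\<theta>. \<theta> (block_of m n i)) \<theta>s) (1 / sqrt (real n)))"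
      by simp
    also have "\<dots> = (\<Prod>i=1..n. a (block_of m n i) n)"
      unfolding a_def
      by (intro expectation_env_prod) (auto intro!: real_distribution.cmod_char_prod_le_1 env_real_distribution)
    also have "\<dots> = (\<Prod>j<m. \<Prod>i\<in>{n * j div m<..n * Suc j div m}. a j n)"
      using prod_block_of[OF m, of "\<lambda>j i. a j n" n] by simp
    finally show ?thesis by simp
  qed
  have "(\<lambda>n. a j n ^ (n * Suc j div m - n * j div m))
      \<longlonglongrightarrow> complex_of_real (exp (- (((\<Sum>\<theta>\<leftarrow>\<theta>s. (\<theta> j)\<^sup>2) + \<sigma>\<^sup>2 * (\<Sum>\<theta>\<leftarrow>\<theta>s. \<theta> j)\<^sup>2) / 2) * (1 / real m)))" for j
  proof (rule power_tendsto_exp[OF _ _ _ block_length_tendsto[OF m]])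
    let ?c = "((\<Sum>\<theta>\<leftarrow>\<theta>s. (\<theta> j)\<^sup>2) + \<sigma>\<^sup>2 * (\<Sum>\<theta>\<leftarrow>\<theta>s. \<theta> j)\<^sup>2) / 2"
    show "cmod (a j n) \<le> 1" for n
    proof -
      let ?P = "\<lambda>\<omega>. char_prod (\<mu> 1 \<omega>) (map (\<lambda>\<theta>. \<theta> j) \<theta>s) (1 / sqrt (real n))"
      have P: "cmod (?P \<omega>) \<le> 1" if "\<omega> \<in> space M" for \<omega>
        using that by (intro real_distribution.cmod_char_prod_le_1 env_real_distribution) auto
      have P_meas: "?P \<in> borel_measurable M" by (rule measurable_compose[OF \<mu>1]) simp
      have "cmod (a j n) \<le> expectation (\<lambda>\<omega>. cmod (?P \<omega>))" unfolding a_def by (rule integral_norm_bound)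
      also have "\<dots> \<le> 1"
        using P P_meas by (intro integral_le_const integrable_const_bound[where B=1]) auto
      finally show ?thesis .
    qed
    show "0 \<le> ?c" by (auto intro!: sum_list_nonneg add_nonneg_nonneg)
    have s: "(\<lambda>n. 1 / sqrt (real n)) \<longlonglongrightarrow> 0" by real_asymp
    have ev: "\<forall>\<^sub>F n in sequentially. 1 / sqrt (real n) \<noteq> 0"
      using eventually_gt_at_top[of 0] by eventually_elim simp
    have "(\<lambda>n. (a j n - 1) / (1 / sqrt (real n))\<^sup>2) \<longlonglongrightarrow> - complex_of_real ?c"
      using annealed_char_prod_tendsto[OF \<mu>1 fin s ev moments(1), of "map (\<lambda>\<theta>. \<theta> j) \<theta>s"] moments(2,3)
      by (simp add: a_def o_def mult.commute)
    moreover have "\<forall>\<^sub>F n in sequentially. (a j n - 1) / complex_of_real ((1 / sqrt (real n))\<^sup>2) = real n * (a j n - 1)"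
      using eventually_gt_at_top[of 0] by eventually_elim (simp add: power_divide)
    ultimately show "(\<lambda>n. real n * (a j n - 1)) \<longlonglongrightarrow> - complex_of_real ?c"
      by (rule Lim_transform_eventually)
  qed
  then show ?thesis unfolding eq by (intro tendsto_prod)
qed

end

subsection \<open>Maximal inequality\<close>

context prob_space
begin

lemma second_moment_sum:
  fixes Y :: "'i \<Rightarrow> 'a \<Rightarrow> real"
  assumes "finite I" "indep_vars (\<lambda>_. borel) Y I" "\<And>i. i \<in> I \<Longrightarrow> integrable M (\<lambda>\<omega>. (Y i \<omega>)\<^sup>2)"
    "\<And>i. i \<in> I \<Longrightarrow> expectation (Y i) = 0" "\<And>i. i \<in> I \<Longrightarrow> expectation (\<lambda>\<omega>. (Y i \<omega>)\<^sup>2) = v"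
  shows "integrable M (\<lambda>\<omega>. (\<Sum>i\<in>I. Y i \<omega>)\<^sup>2) \<and> expectation (\<lambda>\<omega>. (\<Sum>i\<in>I. Y i \<omega>)\<^sup>2) = real (card I) * v
    \<and> (\<lambda>\<omega>. \<Sum>i\<in>I. Y i \<omega>) \<in> borel_measurable M"
  using assms
proof (induction I rule: finite_induct)
  case (insert i I)
  let ?S = "\<lambda>\<omega>. \<Sum>i\<in>I. Y i \<omega>"
  have IH: "integrable M (\<lambda>\<omega>. (?S \<omega>)\<^sup>2)" "expectation (\<lambda>\<omega>. (?S \<omega>)\<^sup>2) = real (card I) * v" "?S \<in> borel_measurable M"
    using insert.IH[OF indep_vars_subset[OF insert.prems(1)]] insert.prems by auto
  have Yi: "Y i \<in> borel_measurable M" using insert.prems(1) by (auto simp: indep_vars_def)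
  have Yi2: "integrable M (\<lambda>\<omega>. (Y i \<omega>)\<^sup>2)" using insert.prems by simp
  have iY: "integrable M (Y i)" using Yi Yi2 by (rule square_integrable_imp_integrable)
  have iS: "integrable M ?S" using IH(3,1) by (rule square_integrable_imp_integrable)
  have ind: "indep_var borel (Y i) borel ?S"
    using insert by (intro indep_vars_sum) auto
  have prod: "integrable M (\<lambda>\<omega>. Y i \<omega> * ?S \<omega>)" "expectation (\<lambda>\<omega>. Y i \<omega> * ?S \<omega>) = 0"
    using indep_var_integrable[OF ind iY iS] indep_var_lebesgue_integral[OF ind iY iS] insert.prems by auto
  have eq: "(\<lambda>\<omega>. (\<Sum>i\<in>insert i I. Y i \<omega>)\<^sup>2) = (\<lambda>\<omega>. (Y i \<omega>)\<^sup>2 + (?S \<omega>)\<^sup>2 + 2 * (Y i \<omega> * ?S \<omega>))"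
    using insert.hyps by (simp add: fun_eq_iff power2_sum)
  show ?case
    unfolding eq using insert.hyps insert.prems Yi IH Yi2 prod by (auto simp: algebra_simps)
qed simp

lemma tail_second_moment:
  assumes "Z \<in> borel_measurable M" "integrable M (\<lambda>\<omega>. (Z \<omega>)\<^sup>2)" "a > 0"
  shows "prob {\<omega> \<in> space M. \<bar>Z \<omega>\<bar> > a} \<le> expectation (\<lambda>\<omega>. (Z \<omega>)\<^sup>2) / a\<^sup>2"
proof -
  have "prob {\<omega> \<in> space M. \<bar>Z \<omega>\<bar> > a} \<le> prob {\<omega> \<in> space M. (Z \<omega>)\<^sup>2 \<ge> a\<^sup>2}"
  proof (rule finite_measure_mono)
    show "{\<omega> \<in> space M. \<bar>Z \<omega>\<bar> > a} \<subseteq> {\<omega> \<in> space M. (Z \<omega>)\<^sup>2 \<ge> a\<^sup>2}"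
      using assms(3) by (auto simp: abs_le_square_iff[symmetric])
    show "{\<omega> \<in> space M. (Z \<omega>)\<^sup>2 \<ge> a\<^sup>2} \<in> sets M" using assms(1) by measurable
  qed
  also have "\<dots> \<le> expectation (\<lambda>\<omega>. (Z \<omega>)\<^sup>2) / a\<^sup>2"
    using assms by (intro integral_Markov_inequality_measure[where A="{}"]) auto
  finally show ?thesis .
qed

text \<open>Decompose according to the first time \<open>k\<close> at which the partial sums
  exceed \<open>2 a\<close>; the later increment is independent of this event and small with probability
  at least one half.\<close>

lemma ottaviani:
  fixes Y :: "nat \<Rightarrow> 'a \<Rightarrow> real"
  assumes indep: "indep_vars (\<lambda>_. borel) Y {..<l}"
    and half: "\<And>k. k \<le> l \<Longrightarrow> prob {\<omega> \<in> space M. \<bar>\<Sum>i\<in>{k..<l}. Y i \<omega>\<bar> > a} \<le> 1 / 2"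
  shows "prob {\<omega> \<in> space M. \<exists>k\<le>l. \<bar>\<Sum>i<k. Y i \<omega>\<bar> > 2 * a} \<le> 2 * prob {\<omega> \<in> space M. \<bar>\<Sum>i<l. Y i \<omega>\<bar> > a}"
proof -
  have Y [measurable]: "i < l \<Longrightarrow> Y i \<in> borel_measurable M" for i
    using indep by (auto simp: indep_vars_def)
  have T [measurable]: "k \<le> l \<Longrightarrow> (\<lambda>\<omega>. \<Sum>i<k. Y i \<omega>) \<in> borel_measurable M" for k
    by (intro borel_measurable_sum) auto
  have R [measurable]: "(\<lambda>\<omega>. \<Sum>i\<in>{k..<l}. Y i \<omega>) \<in> borel_measurable M" for k
    by (intro borel_measurable_sum) auto
  \<comment> \<open>First passage at \<open>k\<close> is phrased for sequences. It can then be
    evaluated on the restriction to \<open>{..<k}\<close>, which is independent of the restriction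
    to \<open>{k..<l}\<close>.\<close>
  define P where "P k x \<longleftrightarrow> \<bar>\<Sum>i<k. x i\<bar> > 2 * a \<and> (\<forall>j\<in>{..<k}. \<bar>\<Sum>i<j. x i\<bar> \<le> 2 * a)" for k and x :: "nat \<Rightarrow> real"
  define A where "A k = {\<omega> \<in> space M. P k (\<lambda>i. Y i \<omega>)}" for k
  define F where "F k = {\<omega> \<in> space M. \<bar>\<Sum>i\<in>{k..<l}. Y i \<omega>\<bar> \<le> a}" for k
  have A_sets [measurable]: "A k \<in> sets M" if "k \<le> l" for k
  proof -
    have "\<And>j. j \<in> {..<k} \<Longrightarrow> (\<lambda>\<omega>. \<Sum>i<j. Y i \<omega>) \<in> borel_measurable M" using that by (intro T) auto
    then show ?thesis using T[OF that] unfolding A_def P_def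
      by (intro sets.sets_Collect_conj sets.sets_Collect_finite_All borel_measurable_less borel_measurable_le) auto
  qed
  have F_sets [measurable]: "F k \<in> sets M" for k unfolding F_def by measurable
  have disj: "disjoint_family_on A {..l}"
    unfolding disjoint_family_on_def
  proof (intro ballI impI)
    fix i j :: nat assume "i \<noteq> j"
    then consider "i < j" | "j < i" by linarith
    then show "A i \<inter> A j = {}" by cases (force simp: A_def P_def)+
  qed
  have indepAF: "prob (A k \<inter> F k) = prob (A k) * prob (F k)" if k: "k \<le> l" for k
  proof -
    let ?PA = "Pi\<^sub>M {..<k} (\<lambda>_. borel :: real measure)" and ?PB = "Pi\<^sub>M {k..<l} (\<lambda>_. borel :: real measure)"
    have iv: "indep_var ?PA (\<lambda>\<omega>. restrict (\<lambda>i. Y i \<omega>) {..<k}) ?PB (\<lambda>\<omega>. restrict (\<lambda>i. Y i \<omega>) {k..<l})"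
      using k by (intro indep_var_restrict[OF indep]) auto
    have sA: "{x \<in> space ?PA. P k x} \<in> sets ?PA"
    proof -
      have "(\<lambda>x. \<Sum>i<j. x i) \<in> borel_measurable ?PA" if "j \<le> k" for j
        using that by (intro borel_measurable_sum measurable_component_singleton) auto
      then show ?thesis unfolding P_def
        by (intro sets.sets_Collect_conj sets.sets_Collect_finite_All borel_measurable_less borel_measurable_le) auto
    qed
    have sB: "{x \<in> space ?PB. \<bar>\<Sum>i\<in>{k..<l}. x i\<bar> \<le> a} \<in> sets ?PB"
    proof -
      have "(\<lambda>x. \<Sum>i\<in>{k..<l}. x i) \<in> borel_measurable ?PB"
        by (intro borel_measurable_sum measurable_component_singleton) auto
      then show ?thesis by measurable
    qed
    have PP: "P k (restrict (\<lambda>i. Y i \<omega>) {..<k}) = P k (\<lambda>i. Y i \<omega>)" for \<omega>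
    proof -
      have "(\<Sum>i<j. restrict (\<lambda>i. Y i \<omega>) {..<k} i) = (\<Sum>i<j. Y i \<omega>)" if "j \<le> k" for j
        using that by (intro sum.cong) auto
      then show ?thesis unfolding P_def by auto
    qed
    have "(\<lambda>\<omega>. restrict (\<lambda>i. Y i \<omega>) {..<k}) -` {x \<in> space ?PA. P k x} \<inter> space M = A k"
      by (auto simp: A_def PP space_PiM)
    moreover have "(\<lambda>\<omega>. restrict (\<lambda>i. Y i \<omega>) {k..<l}) -` {x \<in> space ?PB. \<bar>\<Sum>i\<in>{k..<l}. x i\<bar> \<le> a} \<inter> space M = F k"
      by (auto simp: F_def space_PiM)
    moreover have "(\<lambda>\<omega>. (restrict (\<lambda>i. Y i \<omega>) {..<k}, restrict (\<lambda>i. Y i \<omega>) {k..<l})) -`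
        ({x \<in> space ?PA. P k x} \<times> {x \<in> space ?PB. \<bar>\<Sum>i\<in>{k..<l}. x i\<bar> \<le> a}) \<inter> space M = A k \<inter> F k"
      by (auto simp: A_def F_def PP space_PiM)
    ultimately show ?thesis using indep_varD[OF iv sA sB] by simp
  qed
  have union: "{\<omega> \<in> space M. \<exists>k\<le>l. \<bar>\<Sum>i<k. Y i \<omega>\<bar> > 2 * a} = (\<Union>k\<in>{..l}. A k)"
  proof (intro equalityI subsetI)
    fix \<omega> assume "\<omega> \<in> {\<omega> \<in> space M. \<exists>k\<le>l. \<bar>\<Sum>i<k. Y i \<omega>\<bar> > 2 * a}"
    then obtain k where k: "\<omega> \<in> space M" "k \<le> l" "\<bar>\<Sum>i<k. Y i \<omega>\<bar> > 2 * a" by blast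
    define k' where "k' = (LEAST k. \<bar>\<Sum>i<k. Y i \<omega>\<bar> > 2 * a)"
    have "\<bar>\<Sum>i<k'. Y i \<omega>\<bar> > 2 * a" "k' \<le> k"
      unfolding k'_def using k(3) by (rule LeastI, rule Least_le)
    moreover have "\<bar>\<Sum>i<j. Y i \<omega>\<bar> \<le> 2 * a" if "j < k'" for j
      using not_less_Least[OF that[unfolded k'_def]] by simp
    ultimately have "\<omega> \<in> A k'" "k' \<le> l" using k by (auto simp: A_def P_def)
    then show "\<omega> \<in> (\<Union>k\<in>{..l}. A k)" by auto
  qed (auto simp: A_def P_def)
  have F_half: "1 / 2 \<le> prob (F k)" if "k \<le> l" for k
  proof -
    have "F k = space M - {\<omega> \<in> space M. \<bar>\<Sum>i\<in>{k..<l}. Y i \<omega>\<bar> > a}" by (auto simp: F_def)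
    then have "prob (F k) = 1 - prob {\<omega> \<in> space M. \<bar>\<Sum>i\<in>{k..<l}. Y i \<omega>\<bar> > a}"
      by (simp add: prob_compl)
    then show ?thesis using half[OF that] by simp
  qed
  have "prob (\<Union>k\<in>{..l}. A k) = (\<Sum>k\<le>l. prob (A k))"
    using disj by (intro finite_measure_finite_Union) auto
  also have "\<dots> \<le> (\<Sum>k\<le>l. 2 * prob (A k \<inter> F k))"
  proof (rule sum_mono)
    fix k assume "k \<in> {..l}"
    then have "prob (A k \<inter> F k) = prob (A k) * prob (F k)" "1 / 2 \<le> prob (F k)"
      using indepAF F_half by auto
    then have "prob (A k) * (1 / 2) \<le> prob (A k \<inter> F k)" by (metis measure_nonneg mult_left_mono)
    then show "prob (A k) \<le> 2 * prob (A k \<inter> F k)" by simp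
  qed
  also have "\<dots> = 2 * prob (\<Union>k\<in>{..l}. A k \<inter> F k)"
    using disj by (subst finite_measure_finite_Union)
      (auto simp: sum_distrib_left disjoint_family_on_def)
  also have "\<dots> \<le> 2 * prob {\<omega> \<in> space M. \<bar>\<Sum>i<l. Y i \<omega>\<bar> > a}"
  proof (intro mult_left_mono finite_measure_mono subsetI)
    fix \<omega> assume "\<omega> \<in> (\<Union>k\<in>{..l}. A k \<inter> F k)"
    then obtain k where k: "k \<le> l" "\<omega> \<in> space M" "\<bar>\<Sum>i<k. Y i \<omega>\<bar> > 2 * a" "\<bar>\<Sum>i\<in>{k..<l}. Y i \<omega>\<bar> \<le> a"
      by (auto simp: A_def F_def P_def)
    have "(\<Sum>i<l. Y i \<omega>) = (\<Sum>i<k. Y i \<omega>) + (\<Sum>i\<in>{k..<l}. Y i \<omega>)"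
      using sum.atLeastLessThan_concat[of 0 k l "\<lambda>i. Y i \<omega>"] k(1) by (simp add: atLeast0LessThan)
    then show "\<omega> \<in> {\<omega> \<in> space M. \<bar>\<Sum>i<l. Y i \<omega>\<bar> > a}" using k by auto
  qed auto
  finally show ?thesis using union by simp
qed

text \<open>Chebyshev would give only the power \<open>x\<^sup>2\<close> in the denominator. The
  fourth power is inherited from the normal limit, whose fourth moment is 3; the larger constant 4
  leaves room for the limit to be reached only approximately.\<close>

lemma eventually_tail_sum_le:
  fixes Y :: "nat \<Rightarrow> 'a \<Rightarrow> real"
  assumes indep: "indep_vars (\<lambda>_. borel) Y UNIV" and mean: "\<And>i. expectation (Y i) = 0"
    and sq: "\<And>i. integrable M (\<lambda>\<omega>. (Y i \<omega>)\<^sup>2)" and v: "\<And>i. expectation (\<lambda>\<omega>. (Y i \<omega>)\<^sup>2) = v" "v > 0"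
    and distr: "\<And>i. distr M borel (Y i) = \<nu>" and x: "x > 0"
  shows "\<forall>\<^sub>F l in sequentially. prob {\<omega> \<in> space M. \<bar>\<Sum>i<l. Y i \<omega>\<bar> > x * sqrt (real l * v)} \<le> 4 / x ^ 4"
proof -
  have Y [measurable]: "Y i \<in> borel_measurable M" for i using indep by (auto simp: indep_vars_def)
  define Z where "Z l \<omega> = (\<Sum>i<l. Y i \<omega>) / sqrt (real l * v)" for l \<omega>
  have [measurable]: "Z l \<in> borel_measurable M" for l unfolding Z_def[abs_def] by measurable
  \<comment> \<open>A bounded continuous majorant of the indicator of
    \<open>\<bar>y\<bar> > x\<close>: bounded for weak convergence, and below
    \<open>y ^ 4 / x ^ 4\<close> for the moment bound.\<close>
  define g where "g y = min 1 (y ^ 4 / x ^ 4)" for y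
  have clt: "weak_conv_m (\<lambda>l. distr M borel (Z l)) std_normal_distribution"
    using central_limit_theorem_zero_mean[OF indep mean, of "sqrt v" \<nu>] sq v distr mean
    by (simp add: Z_def[abs_def])
  interpret S: real_distribution std_normal_distribution by (rule real_dist_normal_dist)
  have "(\<lambda>l. integral\<^sup>L (distr M borel (Z l)) g) \<longlonglongrightarrow> integral\<^sup>L std_normal_distribution g"
  proof (rule weak_conv_imp_integral_bdd_continuous_conv[OF _ _ clt])
    show "real_distribution (distr M borel (Z l))" for l by (rule real_distribution_distr) simp
    show "real_distribution std_normal_distribution" by (rule real_dist_normal_dist)
    show "isCont g y" for y unfolding g_def using x by (intro continuous_intros) auto
    show "norm (g y) \<le> 1" for y using x by (auto simp: g_def)
  qed
  moreover have "integral\<^sup>L std_normal_distribution g < 4 / x ^ 4"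
  proof -
    have "integral\<^sup>L std_normal_distribution g \<le> integral\<^sup>L std_normal_distribution (\<lambda>y. y ^ 4 / x ^ 4)"
    proof (rule integral_mono)
      show "integrable std_normal_distribution (\<lambda>y. y ^ 4 / x ^ 4)"
        using integrable_std_normal_distribution_moment[of 4] by simp
      show "integrable std_normal_distribution g"
        using x by (intro S.integrable_const_bound[where B=1]) (auto simp: g_def[abs_def])
    qed (simp add: g_def)
    also have "\<dots> = 3 / x ^ 4"
      using std_normal_distribution_even_moments[of 2] by (simp add: fact_numeral)
    also have "\<dots> < 4 / x ^ 4" using x by (intro divide_strict_right_mono) auto
    finally show ?thesis .
  qed
  ultimately have "\<forall>\<^sub>F l in sequentially. integral\<^sup>L (distr M borel (Z l)) g < 4 / x ^ 4"
    by (rule order_tendstoD)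
  with eventually_gt_at_top[of 0] show ?thesis
  proof eventually_elim
    fix l :: nat assume l: "0 < l" and lt: "integral\<^sup>L (distr M borel (Z l)) g < 4 / x ^ 4"
    have gm: "g \<in> borel_measurable borel" unfolding g_def[abs_def] by measurable
    have ig: "integrable M (\<lambda>\<omega>. g (Z l \<omega>))"
      using x by (intro integrable_const_bound[where B=1] measurable_compose[OF _ gm]) (auto simp: g_def)
    have "prob {\<omega> \<in> space M. \<bar>\<Sum>i<l. Y i \<omega>\<bar> > x * sqrt (real l * v)}
      = expectation (indicator {\<omega> \<in> space M. \<bar>\<Sum>i<l. Y i \<omega>\<bar> > x * sqrt (real l * v)})"
      by simp
    also have "\<dots> \<le> expectation (\<lambda>\<omega>. g (Z l \<omega>))"
    proof (rule integral_mono)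
      show "integrable M (\<lambda>\<omega>. g (Z l \<omega>))" by (rule ig)
      fix \<omega>
      show "indicator {\<omega> \<in> space M. \<bar>\<Sum>i<l. Y i \<omega>\<bar> > x * sqrt (real l * v)} \<omega> \<le> g (Z l \<omega>)"
      proof (cases "\<bar>\<Sum>i<l. Y i \<omega>\<bar> > x * sqrt (real l * v)")
        case True
        then have "\<bar>Z l \<omega>\<bar> \<ge> x" using l v(2) by (simp add: Z_def abs_divide pos_le_divide_eq)
        then have "x ^ 4 \<le> \<bar>Z l \<omega>\<bar> ^ 4" using x by (intro power_mono) auto
        then have "g (Z l \<omega>) = 1" using x by (simp add: g_def power_even_abs)
        then show ?thesis by (simp add: indicator_def)
      next
        case False
        then show ?thesis using x by (simp add: g_def)
      qed
      show "integrable M (indicator {\<omega> \<in> space M. \<bar>\<Sum>i<l. Y i \<omega>\<bar> > x * sqrt (real l * v)} :: 'a \<Rightarrow> real)"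
        by (rule integrable_const_bound[where B=1], rule AE_I2, simp add: indicator_def, measurable)
    qed
    also have "\<dots> = integral\<^sup>L (distr M borel (Z l)) g" using gm by (subst integral_distr) auto
    finally show "prob {\<omega> \<in> space M. \<bar>\<Sum>i<l. Y i \<omega>\<bar> > x * sqrt (real l * v)} \<le> 4 / x ^ 4" using lt by simp
  qed
qed

end

subsection \<open>Comparison with the interpolation on a coarse grid\<close>

text \<open>The zero tail from index \<open>m\<close> on places the sequence in the set on which
  \<open>trig_poly_approx\<close> compares functions.\<close>

definition block_increment :: "nat \<Rightarrow> nat \<Rightarrow> (nat \<Rightarrow> real) \<Rightarrow> nat \<Rightarrow> real"
  where "block_increment m n s j
    = (if j < m then (s (n * Suc j div m) - s (n * j div m)) / sqrt (real n) else 0)"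

lemma sum_block_increment:
  assumes "s 0 = 0" "j \<le> m"
  shows "(\<Sum>i<j. block_increment m n s i) = s (n * j div m) / sqrt (real n)"
proof -
  have "(\<Sum>i<j. block_increment m n s i) = (\<Sum>i<j. (s (n * Suc i div m) - s (n * i div m)) / sqrt (real n))"
    using assms(2) by (intro sum.cong) (auto simp: block_increment_def)
  also have "\<dots> = (s (n * j div m) - s (n * 0 div m)) / sqrt (real n)"
    by (simp only: sum_divide_distrib[symmetric] sum_lessThan_telescope[of "\<lambda>i. s (n * i div m)"])
  finally show ?thesis using assms(1) by simp
qed

text \<open>Both lines at \<open>t\<close> are averages of values of the walk taken between the left
  endpoint \<open>p\<close> of the block of \<open>t\<close> and \<open>p + (n div m + 2)\<close>,
  so each is within \<open>e\<close> of the value at \<open>p\<close>. The extra 2 absorbs the two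
  floors, in \<open>p\<close> and in \<open>n div m\<close>, each of which loses less than
  1.\<close>

lemma dist_coarse_broken_line:
  assumes t: "t \<in> {0..1}" and mn: "m > 0" "n > 0" and s0: "s 0 = 0"
    and small: "\<And>j i. j < m \<Longrightarrow> i \<le> n div m + 2 \<Longrightarrow> \<bar>s (n * j div m + i) - s (n * j div m)\<bar> \<le> e * sqrt (real n)"
  shows "\<bar>broken_line n s t - broken_line m (\<lambda>j. sqrt (real m) * (\<Sum>i<j. block_increment m n s i)) t\<bar> \<le> 2 * e"
proof -
  obtain k c where k: "k \<le> n" "real k \<le> t * real n" "t * real n < real k + 1" "0 \<le> c" "c \<le> 1" "k = n \<longrightarrow> c = 0"
    and eqn: "\<forall>s. broken_line n s t = ((1 - c) * s k + c * s (Suc k)) / sqrt (real n)"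
    by (rule broken_line_between[OF t mn(2)]) (rule that; assumption)
  obtain j d where j: "j \<le> m" "real j \<le> t * real m" "t * real m < real j + 1" "0 \<le> d" "d \<le> 1" "j = m \<longrightarrow> d = 0"
    and eqm: "\<forall>s. broken_line m s t = ((1 - d) * s j + d * s (Suc j)) / sqrt (real m)"
    by (rule broken_line_between[OF t mn(1)]) (rule that; assumption)
  let ?V = "\<lambda>j. \<Sum>i<j. block_increment m n s i"
  note V = sum_block_increment[of s _ m n, OF s0]
  have bm: "broken_line m (\<lambda>j. sqrt (real m) * ?V j) t = (1 - d) * ?V j + d * ?V (Suc j)"
    using mn(1) unfolding eqm[rule_format] by (simp add: field_simps)
  have sn: "sqrt (real n) > 0" using mn by simp
  have e: "e \<ge> 0" using small[of 0 0] mn(1) sn by (simp add: zero_le_mult_iff)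
  show ?thesis
  \<comment> \<open>\<open>j = m\<close> means \<open>t = 1\<close>, where there is no block to the
    right and both lines end in the same value.\<close>
  proof (cases "j = m")
    case True
    then have "1 * real m \<le> t * real m" using j by simp
    then have t1: "t = 1" using mn t by simp
    then have kn: "k = n" using k(1,3) t1 by simp
    have "broken_line n s t = s n / sqrt (real n)" using kn k(6) unfolding eqn[rule_format] by simp
    moreover have "?V m = s n / sqrt (real n)" using V[of m] mn by simp
    ultimately show ?thesis using True j(6) bm e by simp
  next
    case False
    then have jm: "j < m" "Suc j \<le> m" using j by auto
    define p where "p = n * j div m"
    have p_le: "real p \<le> real n * real j / real m" using real_div_bounds(1)[of "n * j" m] by (simp add: p_def)
    have p_gt: "real n * real j / real m - 1 < real p" using real_div_bounds(2)[OF mn(1), of "n * j"] by (simp add: p_def)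
    have l_gt: "real n / real m - 1 < real (n div m)" using real_div_bounds(2)[OF mn(1), of n] by simp
    have pl: "real n * (real j + 1) / real m < real (p + (n div m + 2))"
      using p_gt l_gt by (simp add: add_divide_distrib distrib_left)
    have tn: "real n * real j / real m \<le> t * real n" "t * real n < real n * (real j + 1) / real m"
    proof -
      have "real n * real j \<le> real n * (t * real m)" "real n * (t * real m) < real n * (real j + 1)"
        using j mn by (auto intro: mult_left_mono)
      then show "real n * real j / real m \<le> t * real n" "t * real n < real n * (real j + 1) / real m"
        using mn(1) by (simp_all add: pos_divide_le_eq pos_less_divide_eq mult_ac)
    qed
    have "real p < real k + 1" using p_le tn k by linarith
    then have pk: "p \<le> k" by linarith
    have "real k < real (p + (n div m + 2))" using k tn pl by linarith
    then have kl: "Suc k \<le> p + (n div m + 2)" by linarith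
    have pq: "p \<le> n * Suc j div m" unfolding p_def by (rule block_endpoints_mono)
    have "real (n * Suc j div m) \<le> real n * (real j + 1) / real m"
      using real_div_bounds(1)[of "n * Suc j" m] by (simp add: algebra_simps)
    then have ql: "n * Suc j div m \<le> p + (n div m + 2)" using pl by linarith
    have near: "\<bar>s q / sqrt (real n) - s p / sqrt (real n)\<bar> \<le> e" if "p \<le> q" "q \<le> p + (n div m + 2)" for q
    proof -
      have "\<bar>s (p + (q - p)) - s p\<bar> \<le> e * sqrt (real n)"
        unfolding p_def using that jm by (intro small) (auto simp: p_def)
      then have "\<bar>s q - s p\<bar> / sqrt (real n) \<le> e" using that sn by (simp add: pos_divide_le_eq)
      then show ?thesis by (simp add: abs_divide diff_divide_distrib[symmetric])
    qed
    have "\<bar>(1 - c) * (s k / sqrt (real n)) + c * (s (Suc k) / sqrt (real n)) - s p / sqrt (real n)\<bar> \<le> e"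
      using pk kl by (intro abs_convex_diff_le k near) auto
    then have 1: "\<bar>broken_line n s t - s p / sqrt (real n)\<bar> \<le> e"
      unfolding eqn[rule_format] by (simp add: add_divide_distrib)
    have "\<bar>(1 - d) * ?V j + d * ?V (Suc j) - s p / sqrt (real n)\<bar> \<le> e"
      unfolding V[OF j(1)] V[OF jm(2)] using pq ql
      by (intro abs_convex_diff_le j near) (auto simp: p_def)
    with 1 bm show ?thesis by linarith
  qed
qed

context random_walk_in_random_environment
begin

subsection \<open>Tightness\<close>

lemma indep_shifted_steps: "indep_vars (\<lambda>_. borel) (\<lambda>i. X (Suc (p + i))) UNIV"
proof -
  \<comment> \<open>The independent family is reindexed by grouping it into the singletons
    \<open>{Suc (p + j)}\<close>.\<close>
  have "indep_vars (\<lambda>j. PiM {Suc (p + j)} (\<lambda>_. borel)) (\<lambda>j \<omega>. restrict (\<lambda>i. X i \<omega>) {Suc (p + j)}) UNIV"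
    by (rule indep_vars_restrict[OF indep_steps]) (auto simp: disjoint_family_on_def)
  from indep_vars_compose2[OF this, of "\<lambda>j f. f (Suc (p + j))" "\<lambda>_. borel"]
  show ?thesis by (simp add: measurable_component_singleton)
qed

lemma walk_eq_sum: "walk X k \<omega> = (\<Sum>i<k. X (Suc i) \<omega>)"
  unfolding walk_def by (simp add: sum.atLeast1_atMost_eq)

lemma walk_diff_eq_sum: "walk X (p + k) \<omega> - walk X p \<omega> = (\<Sum>i<k. X (Suc (p + i)) \<omega>)"
proof -
  have "(\<Sum>i<p + k. X (Suc i) \<omega>) = (\<Sum>i<p. X (Suc i) \<omega>) + (\<Sum>i<k. X (Suc (p + i)) \<omega>)"
    by (induction k) auto
  then show ?thesis by (simp add: walk_eq_sum)
qed

lemma measurable_walk [measurable]: "walk X k \<in> borel_measurable M"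
  unfolding walk_def[abs_def] by (intro borel_measurable_sum step_measurable) auto

lemma distr_walk_diff:
  "distr M borel (\<lambda>\<omega>. walk X (p + k) \<omega> - walk X p \<omega>) = distr M borel (walk X k)"
proof (rule Levy_uniqueness)
  have "char (distr M borel (\<lambda>\<omega>. \<Sum>i<k. X (Suc (p + i)) \<omega>)) t = (\<Prod>i<k. char (distr M borel (X 1)) t)" for t p
    using char_distr_sum[OF indep_vars_subset[OF indep_shifted_steps[of p], of "{..<k}"]] distr_step_eq[of "Suc (p + _)"]
    by simp
  from this[of p] this[of 0]
  show "char (distr M borel (\<lambda>\<omega>. walk X (p + k) \<omega> - walk X p \<omega>)) = char (distr M borel (walk X k))"
    unfolding walk_diff_eq_sum by (simp add: fun_eq_iff walk_eq_sum[abs_def])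
qed (auto intro!: real_distribution_distr)

lemma prob_walk_diff:
  "prob {\<omega> \<in> space M. \<bar>walk X (p + k) \<omega> - walk X p \<omega>\<bar> > a} = prob {\<omega> \<in> space M. \<bar>walk X k \<omega>\<bar> > a}"
proof -
  have "measure (distr M borel Z) {x. \<bar>x\<bar> > a} = prob {\<omega> \<in> space M. \<bar>Z \<omega>\<bar> > a}"
    if [measurable]: "Z \<in> borel_measurable M" for Z
    by (subst measure_distr) (auto simp: vimage_def Int_def conj_commute)
  from this[of "\<lambda>\<omega>. walk X (p + k) \<omega> - walk X p \<omega>"] this[of "walk X k"] show ?thesis
    by (simp add: distr_walk_diff)
qed

text \<open>The event on which \<open>dist_coarse_broken_line\<close> fails to apply. In the last
  blocks the window may reach beyond \<open>n\<close>, which is harmless because the walk is defined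
  for all times.\<close>

definition rough :: "nat \<Rightarrow> nat \<Rightarrow> real \<Rightarrow> 'a set"
  where "rough m n e = {\<omega> \<in> space M. \<exists>j\<in>{..<m}. \<exists>i\<in>{..n div m + 2}.
    \<bar>walk X (n * j div m + i) \<omega> - walk X (n * j div m) \<omega>\<bar> > e * sqrt (real n)}"

lemma rough_sets [measurable]: "rough m n e \<in> sets M"
  unfolding rough_def
  by (intro sets.sets_Collect_finite_Ex borel_measurable_less borel_measurable_const borel_measurable_abs
      borel_measurable_diff measurable_walk finite_atMost finite_lessThan)

lemma step_second_moments:
  assumes "n \<ge> 1" and sq: "integrable M (\<lambda>\<omega>. (X 1 \<omega>)\<^sup>2)"
  shows "integrable M (\<lambda>\<omega>. (X n \<omega>)\<^sup>2)" "expectation (X n) = expectation (X 1)"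
    "expectation (\<lambda>\<omega>. (X n \<omega>)\<^sup>2) = expectation (\<lambda>\<omega>. (X 1 \<omega>)\<^sup>2)"
proof -
  note d = distr_step_eq[OF assms(1)]
  have m: "X n \<in> borel_measurable M" "X 1 \<in> borel_measurable M" using assms(1) by (auto intro: step_measurable)
  show "integrable M (\<lambda>\<omega>. (X n \<omega>)\<^sup>2)"
    using integrable_distr_eq[OF m(1), of "\<lambda>x. x\<^sup>2"] integrable_distr_eq[OF m(2), of "\<lambda>x. x\<^sup>2"] d sq by simp
  show "expectation (X n) = expectation (X 1)"
    using integral_distr[OF m(1), of "\<lambda>x. x"] integral_distr[OF m(2), of "\<lambda>x. x"] d by simp
  show "expectation (\<lambda>\<omega>. (X n \<omega>)\<^sup>2) = expectation (\<lambda>\<omega>. (X 1 \<omega>)\<^sup>2)"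
    using integral_distr[OF m(1), of "\<lambda>x. x\<^sup>2"] integral_distr[OF m(2), of "\<lambda>x. x\<^sup>2"] d by simp
qed

lemma walk_diff_second_moment:
  assumes sq: "integrable M (\<lambda>\<omega>. (X 1 \<omega>)\<^sup>2)" and mean: "expectation (X 1) = 0"
    and v: "expectation (\<lambda>\<omega>. (X 1 \<omega>)\<^sup>2) = v" and I: "finite I"
  shows "integrable M (\<lambda>\<omega>. (\<Sum>i\<in>I. X (Suc (p + i)) \<omega>)\<^sup>2)"
    and "expectation (\<lambda>\<omega>. (\<Sum>i\<in>I. X (Suc (p + i)) \<omega>)\<^sup>2) = real (card I) * v"
    and "(\<lambda>\<omega>. \<Sum>i\<in>I. X (Suc (p + i)) \<omega>) \<in> borel_measurable M"
proof -
  have "integrable M (\<lambda>\<omega>. (X (Suc (p + i)) \<omega>)\<^sup>2)" "expectation (X (Suc (p + i))) = 0"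
    "expectation (\<lambda>\<omega>. (X (Suc (p + i)) \<omega>)\<^sup>2) = v" for i
    using step_second_moments[of "Suc (p + i)", OF _ sq] mean v by simp_all
  from second_moment_sum[OF I indep_vars_subset[OF indep_shifted_steps[of p] subset_UNIV] this]
  show "integrable M (\<lambda>\<omega>. (\<Sum>i\<in>I. X (Suc (p + i)) \<omega>)\<^sup>2)"
    "expectation (\<lambda>\<omega>. (\<Sum>i\<in>I. X (Suc (p + i)) \<omega>)\<^sup>2) = real (card I) * v"
    "(\<lambda>\<omega>. \<Sum>i\<in>I. X (Suc (p + i)) \<omega>) \<in> borel_measurable M"
    by blast+
qed

text \<open>Each block has oscillation above \<open>e * sqrt n\<close> with probability of order
  \<open>1/m\<^sup>2\<close>, by the fourth-power tail, and there are \<open>m\<close>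
  blocks.\<close>

lemma prob_rough_le:
  assumes sq: "integrable M (\<lambda>\<omega>. (X 1 \<omega>)\<^sup>2)" and mean: "expectation (X 1) = 0"
    and v: "expectation (\<lambda>\<omega>. (X 1 \<omega>)\<^sup>2) = v" "v > 0"
    and e: "e > 0" and m: "m > 0" "real m \<ge> 16 * v / e\<^sup>2"
  shows "\<forall>\<^sub>F n in sequentially. prob (rough m n e) \<le> 512 * v\<^sup>2 / (e ^ 4 * real m)"
proof -
  \<comment> \<open>Chosen so that \<open>x * sqrt (real l * v) \<le> e / 2 * sqrt (real n)\<close>
    as soon as \<open>l \<le> 2 * n / m\<close>. Ottaviani's inequality doubles the tail bound
    \<open>4 / x ^ 4\<close>, and \<open>m\<close> blocks at \<open>8 / x ^ 4\<close> give the
    constant 512.\<close>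
  define x where "x = e / 2 * sqrt (real m / (2 * v))"
  have x: "x > 0" using e m v by (simp add: x_def)
  have x4: "x ^ 4 = e ^ 4 * (real m)\<^sup>2 / (64 * v\<^sup>2)"
  proof -
    have "(sqrt (real m / (2 * v))) ^ 4 = ((sqrt (real m / (2 * v)))\<^sup>2)\<^sup>2" by (simp only: power_mult[symmetric]) simp
    also have "\<dots> = (real m / (2 * v))\<^sup>2" using m v by simp
    finally show ?thesis by (simp add: x_def power_mult_distrib power_divide)
  qed
  have "\<forall>\<^sub>F l in sequentially. prob {\<omega> \<in> space M. \<bar>\<Sum>i<l. X (Suc (0 + i)) \<omega>\<bar> > x * sqrt (real l * v)} \<le> 4 / x ^ 4"
  proof (rule eventually_tail_sum_le[OF indep_shifted_steps _ _ _ v(2) _ x])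
    fix i
    show "expectation (X (Suc (0 + i))) = 0" "integrable M (\<lambda>\<omega>. (X (Suc (0 + i)) \<omega>)\<^sup>2)"
      "expectation (\<lambda>\<omega>. (X (Suc (0 + i)) \<omega>)\<^sup>2) = v"
      using step_second_moments[of "Suc (0 + i)", OF _ sq] mean v(1) by simp_all
    show "distr M borel (X (Suc (0 + i))) = distr M borel (X 1)" by (rule distr_step_eq) simp
  qed
  then have "\<forall>\<^sub>F l in sequentially. prob {\<omega> \<in> space M. \<bar>walk X l \<omega>\<bar> > x * sqrt (real l * v)} \<le> 4 / x ^ 4"
    by (simp add: walk_eq_sum)
  moreover have "filterlim (\<lambda>n. n div m + 2) sequentially sequentially"
  proof (rule filterlim_at_top_mono)
    show "filterlim (\<lambda>n. n div m) sequentially sequentially"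
      using m(1) unfolding filterlim_at_top
      by (auto simp: eventually_sequentially less_eq_div_iff_mult_less_eq)
  qed simp
  ultimately have "\<forall>\<^sub>F n in sequentially. prob {\<omega> \<in> space M. \<bar>walk X (n div m + 2) \<omega>\<bar> > x * sqrt (real (n div m + 2) * v)} \<le> 4 / x ^ 4"
    by (rule eventually_compose_filterlim)
  \<comment> \<open>From \<open>2 * m \<le> n\<close> on, the window length
    \<open>n div m + 2\<close> is at most \<open>2 * n / m\<close>.\<close>
  with eventually_ge_at_top[of "2 * m"] show ?thesis
  proof eventually_elim
    fix n assume n: "2 * m \<le> n"
      and tail: "prob {\<omega> \<in> space M. \<bar>walk X (n div m + 2) \<omega>\<bar> > x * sqrt (real (n div m + 2) * v)} \<le> 4 / x ^ 4"
    define l where "l = n div m + 2"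
    define a where "a = e / 2 * sqrt (real n)"
    have n0: "real n > 0" using n m by simp
    have a: "a > 0" "a\<^sup>2 = e\<^sup>2 * real n / 4" using e n0 by (auto simp: a_def power_mult_distrib power_divide)
    have "2 \<le> real n / real m" using n m(1) by (simp add: pos_le_divide_eq)
    then have l: "real l \<le> 2 * (real n / real m)"
      using real_div_bounds(1)[of n m] unfolding l_def by simp
    have "x * sqrt (real l * v) \<le> x * sqrt (2 * (real n / real m) * v)"
      using l x v by (intro mult_left_mono real_sqrt_le_mono mult_right_mono) auto
    also have "\<dots> = e / 2 * sqrt ((real m / (2 * v)) * (2 * (real n / real m) * v))"
      unfolding x_def by (simp only: real_sqrt_mult mult_ac)
    also have "(real m / (2 * v)) * (2 * (real n / real m) * v) = real n" using m v by (simp add: field_simps)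
    finally have xa: "x * sqrt (real l * v) \<le> a" by (simp add: a_def)
    have tail_a: "prob {\<omega> \<in> space M. \<bar>walk X l \<omega>\<bar> > a} \<le> 4 / x ^ 4"
    proof -
      have "prob {\<omega> \<in> space M. \<bar>walk X l \<omega>\<bar> > a} \<le> prob {\<omega> \<in> space M. \<bar>walk X l \<omega>\<bar> > x * sqrt (real l * v)}"
        using xa by (intro finite_measure_mono) auto
      with tail show ?thesis by (simp add: l_def)
    qed
    \<comment> \<open>The Chebyshev bound that Ottaviani's inequality asks for; the condition
      \<open>real m \<ge> 16 * v / e\<^sup>2\<close> is exactly what it takes.\<close>
    have lv: "real l * v / a\<^sup>2 \<le> 1 / 2"
    proof -
      have "real l * v / a\<^sup>2 \<le> 2 * (real n / real m) * v / (e\<^sup>2 * real n / 4)"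
        unfolding a(2) using l v e n0 by (intro divide_right_mono mult_right_mono) auto
      also have "\<dots> = 8 * v / e\<^sup>2 / real m" using n0 m e by (simp add: field_simps)
      also have "\<dots> \<le> (real m / 2) / real m" using m by (intro divide_right_mono) auto
      also have "\<dots> = 1 / 2" using m by simp
      finally show ?thesis .
    qed
    \<comment> \<open>Increments are stationary, so the single eventual tail bound for
      \<open>walk X l\<close> serves every starting point \<open>p\<close>, and no uniformity over
      the blocks has to be arranged.\<close>
    have block: "prob {\<omega> \<in> space M. \<exists>i\<in>{..l}. \<bar>walk X (p + i) \<omega> - walk X p \<omega>\<bar> > e * sqrt (real n)} \<le> 8 / x ^ 4" for p
    proof -
      have "prob {\<omega> \<in> space M. \<exists>k\<le>l. \<bar>\<Sum>i<k. X (Suc (p + i)) \<omega>\<bar> > 2 * a}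
        \<le> 2 * prob {\<omega> \<in> space M. \<bar>\<Sum>i<l. X (Suc (p + i)) \<omega>\<bar> > a}"
      proof (rule ottaviani)
        show "indep_vars (\<lambda>_. borel) (\<lambda>i. X (Suc (p + i))) {..<l}"
          by (rule indep_vars_subset[OF indep_shifted_steps]) simp
        fix k assume "k \<le> l"
        have "prob {\<omega> \<in> space M. a < \<bar>\<Sum>i\<in>{k..<l}. X (Suc (p + i)) \<omega>\<bar>} \<le> real (card {k..<l}) * v / a\<^sup>2"
          using tail_second_moment[OF walk_diff_second_moment(3,1)[OF sq mean v(1) finite_atLeastLessThan, of p k l] a(1)]
            walk_diff_second_moment(2)[OF sq mean v(1) finite_atLeastLessThan, of p k l] by simp
        also have "\<dots> \<le> real l * v / a\<^sup>2" using v by (intro divide_right_mono mult_right_mono) auto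
        finally show "prob {\<omega> \<in> space M. a < \<bar>\<Sum>i\<in>{k..<l}. X (Suc (p + i)) \<omega>\<bar>} \<le> 1 / 2" using lv by linarith
      qed
      also have "prob {\<omega> \<in> space M. \<bar>\<Sum>i<l. X (Suc (p + i)) \<omega>\<bar> > a} = prob {\<omega> \<in> space M. \<bar>walk X l \<omega>\<bar> > a}"
        using prob_walk_diff[of a p l] by (simp add: walk_diff_eq_sum)
      also have "{\<omega> \<in> space M. \<exists>k\<le>l. \<bar>\<Sum>i<k. X (Suc (p + i)) \<omega>\<bar> > 2 * a}
        = {\<omega> \<in> space M. \<exists>i\<in>{..l}. \<bar>walk X (p + i) \<omega> - walk X p \<omega>\<bar> > e * sqrt (real n)}"
        by (auto simp: walk_diff_eq_sum a_def)
      finally show ?thesis using tail_a by simp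
    qed
    have meas: "{\<omega> \<in> space M. \<exists>i\<in>{..l}. \<bar>walk X (p + i) \<omega> - walk X p \<omega>\<bar> > e * sqrt (real n)} \<in> sets M" for p
      by (intro sets.sets_Collect_finite_Ex borel_measurable_less borel_measurable_const borel_measurable_abs
          borel_measurable_diff measurable_walk finite_atMost)
    have rough_eq: "rough m n e = (\<Union>j\<in>{..<m}. {\<omega> \<in> space M. \<exists>i\<in>{..l}.
        \<bar>walk X (n * j div m + i) \<omega> - walk X (n * j div m) \<omega>\<bar> > e * sqrt (real n)})"
      unfolding rough_def l_def by auto
    have "prob (rough m n e) \<le> (\<Sum>j<m. prob {\<omega> \<in> space M. \<exists>i\<in>{..l}.
        \<bar>walk X (n * j div m + i) \<omega> - walk X (n * j div m) \<omega>\<bar> > e * sqrt (real n)})"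
      unfolding rough_eq by (intro finite_measure_subadditive_finite finite_lessThan image_subsetI meas)
    also have "\<dots> \<le> (\<Sum>j<m. 8 / x ^ 4)" by (intro sum_mono block)
    also have "\<dots> = 512 * v\<^sup>2 / (e ^ 4 * real m)"
      unfolding x4 using m(1) by (simp add: power2_eq_square)
    finally show "prob (rough m n e) \<le> 512 * v\<^sup>2 / (e ^ 4 * real m)" .
  qed
qed

end

subsection \<open>Brownian increments\<close>

lemma (in prob_space) normal_char_and_moment:
  assumes s: "s > 0" and Z: "distributed M lborel Z (normal_density 0 s)"
  shows "expectation (\<lambda>\<omega>. iexp (c * Z \<omega>)) = complex_of_real (exp (- ((c * s)\<^sup>2) / 2))"
    and "integrable M (\<lambda>\<omega>. (Z \<omega>)\<^sup>2)" and "expectation (\<lambda>\<omega>. (Z \<omega>)\<^sup>2) = s\<^sup>2"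
proof -
  define Z' where "Z' \<omega> = Z \<omega> / s" for \<omega>
  have "distributed M lborel (\<lambda>\<omega>. (Z \<omega> - 0) / s) std_normal_density"
    using normal_standard_normal_convert[OF s, of Z 0] Z by simp
  then have Z': "distributed M lborel Z' std_normal_density" by (simp add: Z'_def[abs_def])
  have meas [measurable]: "Z' \<in> borel_measurable M" using distributed_measurable[OF Z'] by simp
  have "distr M lborel Z' = std_normal_distribution" by (rule distributed_distr_eq_density[OF Z'])
  then have d: "distr M borel Z' = std_normal_distribution"
    by (simp cong: distr_cong)
  have ZZ': "Z \<omega> = s * Z' \<omega>" for \<omega> using s by (simp add: Z'_def)
  have "char std_normal_distribution (c * s) = expectation (\<lambda>\<omega>. iexp (c * Z \<omega>))"
    unfolding d[symmetric] char_def by (subst integral_distr) (auto simp: ZZ' mult_ac)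
  then show "expectation (\<lambda>\<omega>. iexp (c * Z \<omega>)) = complex_of_real (exp (- ((c * s)\<^sup>2) / 2))"
    by (simp add: char_std_normal_distribution)
  have "integrable std_normal_distribution (\<lambda>x. x\<^sup>2)" by (rule integrable_std_normal_distribution_moment)
  then have i: "integrable M (\<lambda>\<omega>. (Z' \<omega>)\<^sup>2)" unfolding d[symmetric] by (simp add: integrable_distr_eq)
  then show "integrable M (\<lambda>\<omega>. (Z \<omega>)\<^sup>2)" unfolding ZZ' by (simp add: power_mult_distrib)
  have "integral\<^sup>L std_normal_distribution (\<lambda>x. x\<^sup>2) = 1"
    using std_normal_distribution_even_moments(1)[of 1] by (simp add: fact_numeral)
  then have "expectation (\<lambda>\<omega>. (Z' \<omega>)\<^sup>2) = 1" unfolding d[symmetric] by (simp add: integral_distr)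
  then show "expectation (\<lambda>\<omega>. (Z \<omega>)\<^sup>2) = s\<^sup>2" unfolding ZZ' using i by (simp add: power_mult_distrib)
qed

definition grid_increment :: "nat \<Rightarrow> (real \<Rightarrow> real) \<Rightarrow> nat \<Rightarrow> real"
  where "grid_increment m x j = (if j < m then x (real (Suc j) / real m) - x (real j / real m) else 0)"

lemma brownian_path:
  assumes "brownian_motion01 N B"
  shows "t \<in> {0..1} \<Longrightarrow> B t \<in> borel_measurable N" "\<omega> \<in> space N \<Longrightarrow> B 0 \<omega> = 0"
    "\<omega> \<in> space N \<Longrightarrow> continuous_on {0..1} (\<lambda>t. B t \<omega>)"
  using assms unfolding brownian_motion01_def by blast+

lemma (in prob_space) brownian_increments:
  assumes B: "brownian_motion01 M B"
  shows "j < m \<Longrightarrow> distributed M lborel (\<lambda>\<omega>. B (real (Suc j) / real m) \<omega> - B (real j / real m) \<omega>) (normal_density 0 (sqrt (1 / real m)))"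
    and "m > 0 \<Longrightarrow> indep_vars (\<lambda>_. borel) (\<lambda>j \<omega>. B (real (Suc j) / real m) \<omega> - B (real j / real m) \<omega>) {..<m}"
proof -
  assume j: "j < m"
  have *: "real (Suc j) / real m - real j / real m = 1 / real m" by (simp add: diff_divide_distrib[symmetric])
  have "0 \<le> real j / real m" "real j / real m < real (Suc j) / real m" "real (Suc j) / real m \<le> 1"
    using j by (auto simp: divide_strict_right_mono)
  then show "distributed M lborel (\<lambda>\<omega>. B (real (Suc j) / real m) \<omega> - B (real j / real m) \<omega>) (normal_density 0 (sqrt (1 / real m)))"
    using B unfolding brownian_motion01_def *[symmetric] by blast
next
  assume m: "m > 0"
  define \<tau> where "\<tau> i = real i / real m" for i
  have "\<forall>i\<le>m. \<tau> i \<in> {0..1}" "\<forall>i<m. \<tau> i < \<tau> (Suc i)"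
    using m by (auto simp: \<tau>_def divide_strict_right_mono)
  then have "indep_vars (\<lambda>_. borel) (\<lambda>i \<omega>. B (\<tau> (Suc i)) \<omega> - B (\<tau> i) \<omega>) {..<m}"
    using B unfolding brownian_motion01_def by blast
  then show "indep_vars (\<lambda>_. borel) (\<lambda>j \<omega>. B (real (Suc j) / real m) \<omega> - B (real j / real m) \<omega>) {..<m}"
    by (simp only: \<tau>_def)
qed

lemma (in prob_space) measurable_grid_increment:
  assumes B: "brownian_motion01 M B"
  shows "(\<lambda>\<omega>. grid_increment m (\<lambda>t. B t \<omega>) j) \<in> borel_measurable M"
proof (cases "j < m")
  case True
  then have "real (Suc j) / real m \<in> {0..1}" "real j / real m \<in> {0..1}" by auto
  then show ?thesis using True brownian_path(1)[OF B] by (simp add: grid_increment_def del: of_nat_Suc)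
qed (simp add: grid_increment_def)

lemma (in prob_space) grid_increment_second_moment:
  assumes B: "brownian_motion01 M B"
  shows "integrable M (\<lambda>\<omega>. (grid_increment m (\<lambda>t. B t \<omega>) j)\<^sup>2)"
    "expectation (\<lambda>\<omega>. (grid_increment m (\<lambda>t. B t \<omega>) j)\<^sup>2) \<le> 1"
proof -
  have "integrable M (\<lambda>\<omega>. (grid_increment m (\<lambda>t. B t \<omega>) j)\<^sup>2)
    \<and> expectation (\<lambda>\<omega>. (grid_increment m (\<lambda>t. B t \<omega>) j)\<^sup>2) \<le> 1"
  proof (cases "j < m")
    case True
    then have m: "m > 0" by simp
    then have s: "sqrt (1 / real m) > 0" by simp
    show ?thesis
      using normal_char_and_moment(2,3)[OF s brownian_increments(1)[OF B True]] True m
      by (simp add: grid_increment_def del: of_nat_Suc)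
  qed (simp add: grid_increment_def)
  then show "integrable M (\<lambda>\<omega>. (grid_increment m (\<lambda>t. B t \<omega>) j)\<^sup>2)"
    "expectation (\<lambda>\<omega>. (grid_increment m (\<lambda>t. B t \<omega>) j)\<^sup>2) \<le> 1" by blast+
qed

lemma (in prob_space) brownian_wave:
  assumes B: "brownian_motion01 M B" and m: "m > 0"
  shows "expectation (\<lambda>\<omega>. wave m c (grid_increment m (\<lambda>t. B t \<omega>))) = (\<Prod>j<m. complex_of_real (exp (- ((c j)\<^sup>2 / 2 * (1 / real m)))))"
proof -
  let ?d = "\<lambda>j \<omega>. B (real (Suc j) / real m) \<omega> - B (real j / real m) \<omega>"
  have ind: "indep_vars (\<lambda>_. borel) (\<lambda>j \<omega>. iexp (c j * ?d j \<omega>)) {..<m}"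
    by (rule indep_vars_compose2[OF brownian_increments(2)[OF B m]]) simp
  have "wave m c (grid_increment m (\<lambda>t. B t \<omega>)) = (\<Prod>j<m. iexp (c j * ?d j \<omega>))" for \<omega>
  proof -
    have "(\<Sum>j<m. c j * grid_increment m (\<lambda>t. B t \<omega>) j) = (\<Sum>j<m. c j * ?d j \<omega>)"
      by (intro sum.cong) (auto simp: grid_increment_def)
    then show ?thesis unfolding wave_def by (simp only: of_real_sum sum_distrib_left exp_sum[OF finite_lessThan])
  qed
  then have "expectation (\<lambda>\<omega>. wave m c (grid_increment m (\<lambda>t. B t \<omega>))) = expectation (\<lambda>\<omega>. \<Prod>j<m. iexp (c j * ?d j \<omega>))"
    by simp
  also have "\<dots> = (\<Prod>j<m. expectation (\<lambda>\<omega>. iexp (c j * ?d j \<omega>)))"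
  proof (rule indep_vars_lebesgue_integral[OF _ ind])
    fix j assume "j \<in> {..<m}"
    then have "random_variable borel (\<lambda>\<omega>. iexp (c j * ?d j \<omega>))"
      using ind by (auto simp: indep_vars_def)
    then show "integrable M (\<lambda>\<omega>. iexp (c j * ?d j \<omega>))"
      by (intro integrable_const_bound[where B=1]) auto
  qed simp
  also have "\<dots> = (\<Prod>j<m. complex_of_real (exp (- ((c j)\<^sup>2 / 2 * (1 / real m)))))"
  proof (intro prod.cong refl)
    fix j assume j: "j \<in> {..<m}"
    have s: "sqrt (1 / real m) > 0" using m by simp
    show "expectation (\<lambda>\<omega>. iexp (c j * ?d j \<omega>)) = complex_of_real (exp (- ((c j)\<^sup>2 / 2 * (1 / real m))))"
      using normal_char_and_moment(1)[OF s brownian_increments(1)[OF B], of j "c j"] j m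
      by (simp add: power_mult_distrib)
  qed
  finally show ?thesis .
qed

subsection \<open>The conditional law of the limit\<close>

text \<open>The conditional expectation, given \<open>W\<close>, of the character of the grid
  increments of \<open>B + \<sigma> W\<close>: \<open>B\<close> has been integrated out, leaving the
  Gaussian factor.\<close>

definition limit_wave :: "nat \<Rightarrow> real \<Rightarrow> (real \<Rightarrow> 'b \<Rightarrow> real) \<Rightarrow> (nat \<Rightarrow> real) \<Rightarrow> 'b \<Rightarrow> complex"
  where "limit_wave m \<sigma> W \<theta> \<omega> = (\<Prod>j<m. complex_of_real (exp (- ((\<theta> j)\<^sup>2 / 2 * (1 / real m)))))
    * wave m (\<lambda>j. \<sigma> * \<theta> j) (grid_increment m (\<lambda>t. W t \<omega>))"

text \<open>The Gaussian factors multiply by adding the squares of the frequencies, while the waves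
  of the common path \<open>W\<close> multiply by adding the frequencies themselves. Averaging the
  latter yields the square of the sum, in agreement with
  \<open>quenched_wave_moments_tendsto\<close>.\<close>

lemma prod_list_limit_wave:
  "(\<Prod>\<theta>\<leftarrow>\<theta>s. limit_wave m \<sigma> W \<theta> \<omega>)
    = (\<Prod>j<m. complex_of_real (exp (- ((\<Sum>\<theta>\<leftarrow>\<theta>s. (\<theta> j)\<^sup>2) / 2 * (1 / real m)))))
      * wave m (\<lambda>j. \<sigma> * (\<Sum>\<theta>\<leftarrow>\<theta>s. \<theta> j)) (grid_increment m (\<lambda>t. W t \<omega>))"
proof (induction \<theta>s)
  case (Cons \<theta> \<theta>s)
  have "exp (- ((\<Sum>\<theta>\<leftarrow>\<theta> # \<theta>s. (\<theta> j)\<^sup>2) / 2 * (1 / real m)))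
    = exp (- ((\<theta> j)\<^sup>2 / 2 * (1 / real m))) * exp (- ((\<Sum>\<theta>\<leftarrow>\<theta>s. (\<theta> j)\<^sup>2) / 2 * (1 / real m)))" for j
    by (simp add: exp_add[symmetric] add_divide_distrib)
  then have 1: "(\<Prod>j<m. complex_of_real (exp (- ((\<Sum>\<theta>\<leftarrow>\<theta> # \<theta>s. (\<theta> j)\<^sup>2) / 2 * (1 / real m)))))
    = (\<Prod>j<m. complex_of_real (exp (- ((\<theta> j)\<^sup>2 / 2 * (1 / real m)))))
      * (\<Prod>j<m. complex_of_real (exp (- ((\<Sum>\<theta>\<leftarrow>\<theta>s. (\<theta> j)\<^sup>2) / 2 * (1 / real m)))))"
    by (simp only: of_real_mult prod.distrib)
  have 2: "wave m (\<lambda>j. \<sigma> * (\<Sum>\<theta>\<leftarrow>\<theta> # \<theta>s. \<theta> j)) d = wave m (\<lambda>j. \<sigma> * \<theta> j) d * wave m (\<lambda>j. \<sigma> * (\<Sum>\<theta>\<leftarrow>\<theta>s. \<theta> j)) d" for d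
    by (simp add: wave_add distrib_left)
  show ?case unfolding 1 2 using Cons by (simp add: limit_wave_def mult_ac)
qed simp

lemma (in prob_space) limit_wave_moments:
  assumes W: "brownian_motion01 M W" and m: "m > 0"
  shows "expectation (\<lambda>\<omega>. \<Prod>\<theta>\<leftarrow>\<theta>s. limit_wave m \<sigma> W \<theta> \<omega>)
    = (\<Prod>j<m. complex_of_real (exp (- (((\<Sum>\<theta>\<leftarrow>\<theta>s. (\<theta> j)\<^sup>2) + \<sigma>\<^sup>2 * (\<Sum>\<theta>\<leftarrow>\<theta>s. \<theta> j)\<^sup>2) / 2) * (1 / real m))))"
proof -
  have "exp (- (((\<Sum>\<theta>\<leftarrow>\<theta>s. (\<theta> j)\<^sup>2) + \<sigma>\<^sup>2 * (\<Sum>\<theta>\<leftarrow>\<theta>s. \<theta> j)\<^sup>2) / 2) * (1 / real m))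
    = exp (- ((\<Sum>\<theta>\<leftarrow>\<theta>s. (\<theta> j)\<^sup>2) / 2 * (1 / real m))) * exp (- ((\<sigma> * (\<Sum>\<theta>\<leftarrow>\<theta>s. \<theta> j))\<^sup>2 / 2 * (1 / real m)))" for j
    by (simp add: exp_add[symmetric] add_divide_distrib power_mult_distrib algebra_simps)
  then show ?thesis
    unfolding prod_list_limit_wave using brownian_wave[OF W m] by (simp add: prod.distrib)
qed

lemma measurable_wave_path:
  assumes "m > 0"
  shows "(\<lambda>x. wave m c (grid_increment m x)) \<in> borel_measurable (\<Pi>\<^sub>M t\<in>{0..1}. borel)"
proof -
  have "(\<lambda>x. grid_increment m x j) \<in> borel_measurable (\<Pi>\<^sub>M t\<in>{0..1}. borel)" for j
  proof (cases "j < m")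
    case True
    then have "real (Suc j) / real m \<in> {0..1}" "real j / real m \<in> {0..1}" by auto
    then have "(\<lambda>x. x (real (Suc j) / real m) - x (real j / real m)) \<in> borel_measurable (\<Pi>\<^sub>M t\<in>{0..1::real}. borel :: real measure)"
      by (intro borel_measurable_diff measurable_component_singleton)
    then show ?thesis using True by (simp add: grid_increment_def)
  qed (simp add: grid_increment_def)
  then have "(\<lambda>x. \<Sum>j<m. c j * grid_increment m x j) \<in> borel_measurable (\<Pi>\<^sub>M t\<in>{0..1}. borel)"
    by (intro borel_measurable_sum borel_measurable_times) auto
  then show ?thesis unfolding wave_def by (rule measurable_compose) simp
qed

lemma grid_increment_restrict: "grid_increment m (\<lambda>t\<in>{0..1}. x t) = grid_increment m x"
  by (auto simp: grid_increment_def fun_eq_iff)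

text \<open>An event of the algebra generated by \<open>W\<close> is a condition on the whole path
  of \<open>W\<close>. The integrand thus splits into a function of the path of \<open>B\<close> and
  one of the path of \<open>W\<close>, and independence of the processes factorizes the
  integral.\<close>

lemma (in prob_space) limit_wave_cond:
  assumes B: "brownian_motion01 M B" and W: "brownian_motion01 M W"
    and BW: "independent_processes01 M B W" and m: "m > 0"
    and A: "A \<in> sets (generated_algebra M {0..1} borel W)"
  shows "(\<integral>\<omega>. indicator A \<omega> * wave m \<theta> (grid_increment m (\<lambda>t. B t \<omega> + \<sigma> * W t \<omega>)) \<partial>M)
    = (\<integral>\<omega>. indicator A \<omega> * limit_wave m \<sigma> W \<theta> \<omega> \<partial>M)"
proof -
  let ?P = "PiM {0..1::real} (\<lambda>_. borel :: real measure)"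
  let ?W = "\<lambda>\<omega>. \<lambda>t\<in>{0..1}. W t \<omega>" and ?B = "\<lambda>\<omega>. \<lambda>t\<in>{0..1}. B t \<omega>"
  have iv: "indep_var ?P ?B ?P ?W" using BW unfolding independent_processes01_def .
  have W_meas: "?W \<in> measurable M ?P" using iv by (rule indep_var_rv2)
  have "?W \<in> space M \<rightarrow> space ?P" using measurable_space[OF W_meas] by blast
  then obtain S where S: "S \<in> sets ?P" "A = ?W -` S \<inter> space M"
    using A unfolding generated_algebra_def by (auto simp: sets_vimage_algebra2)
  define h where "h w = indicator S w * wave m (\<lambda>j. \<sigma> * \<theta> j) (grid_increment m w)" for w
  define g where "g b = wave m \<theta> (grid_increment m b)" for b
  have gm: "g \<in> borel_measurable ?P" unfolding g_def[abs_def] by (rule measurable_wave_path[OF m])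
  have hm: "h \<in> borel_measurable ?P"
    unfolding h_def[abs_def] using S by (intro borel_measurable_times borel_measurable_indicator measurable_wave_path m)
  have iv': "indep_var borel (\<lambda>\<omega>. g (?B \<omega>)) borel (\<lambda>\<omega>. h (?W \<omega>))"
    using indep_var_compose[OF iv gm hm] by (simp add: o_def)
  have ig: "integrable M (\<lambda>\<omega>. g (?B \<omega>))" "integrable M (\<lambda>\<omega>. h (?W \<omega>))"
    using indep_var_rv1[OF iv'] indep_var_rv2[OF iv']
    by (auto intro!: integrable_const_bound[where B=1] simp: g_def h_def norm_mult indicator_def)
  have "grid_increment m (\<lambda>t. B t \<omega> + \<sigma> * W t \<omega>) j
    = grid_increment m (\<lambda>t. B t \<omega>) j + \<sigma> * grid_increment m (\<lambda>t. W t \<omega>) j" for j \<omega>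
    by (simp add: grid_increment_def algebra_simps)
  then have split: "wave m \<theta> (grid_increment m (\<lambda>t. B t \<omega> + \<sigma> * W t \<omega>))
    = wave m \<theta> (grid_increment m (\<lambda>t. B t \<omega>)) * wave m (\<lambda>j. \<sigma> * \<theta> j) (grid_increment m (\<lambda>t. W t \<omega>))" for \<omega>
    by (simp add: wave_def exp_add[symmetric] distrib_left[symmetric] sum.distrib[symmetric])
      (simp add: algebra_simps)
  have ind: "indicator A \<omega> = (indicator S (?W \<omega>) :: complex)" if "\<omega> \<in> space M" for \<omega>
    using that S(2) by (simp add: indicator_def)
  have "(\<integral>\<omega>. indicator A \<omega> * wave m \<theta> (grid_increment m (\<lambda>t. B t \<omega> + \<sigma> * W t \<omega>)) \<partial>M)
    = (\<integral>\<omega>. g (?B \<omega>) * h (?W \<omega>) \<partial>M)"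
    by (intro Bochner_Integration.integral_cong refl) (simp add: split ind g_def h_def grid_increment_restrict mult_ac)
  also have "\<dots> = expectation (\<lambda>\<omega>. g (?B \<omega>)) * expectation (\<lambda>\<omega>. h (?W \<omega>))"
    by (rule indep_var_lebesgue_integral[OF iv' ig])
  also have "expectation (\<lambda>\<omega>. g (?B \<omega>)) = (\<Prod>j<m. complex_of_real (exp (- ((\<theta> j)\<^sup>2 / 2 * (1 / real m)))))"
    unfolding g_def grid_increment_restrict by (rule brownian_wave[OF B m])
  also have "(\<Prod>j<m. complex_of_real (exp (- ((\<theta> j)\<^sup>2 / 2 * (1 / real m))))) * expectation (\<lambda>\<omega>. h (?W \<omega>))
    = (\<integral>\<omega>. indicator A \<omega> * limit_wave m \<sigma> W \<theta> \<omega> \<partial>M)"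
    unfolding integral_mult_right_zero[symmetric]
    by (intro Bochner_Integration.integral_cong refl) (simp add: ind h_def limit_wave_def grid_increment_restrict mult_ac)
  finally show ?thesis .
qed

lemma norm_limit_wave_le: "cmod (limit_wave m \<sigma> W \<theta> \<omega>) \<le> 1"
  unfolding limit_wave_def norm_mult norm_wave by (simp add: prod_norm[symmetric] prod_le_1)

lemma measurable_limit_wave:
  assumes W: "\<And>t. t \<in> {0..1} \<Longrightarrow> W t \<in> borel_measurable M" and m: "m > 0"
  shows "limit_wave m \<sigma> W \<theta> \<in> borel_measurable (generated_algebra M {0..1} borel W)"
proof -
  let ?F = "generated_algebra M {0..1} borel W"
  have "(\<lambda>\<omega>. \<lambda>t\<in>{0..1}. W t \<omega>) \<in> measurable ?F (\<Pi>\<^sub>M t\<in>{0..1}. borel)"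
    by (intro measurable_restrict measurable_generated_algebra[of "{0..1}" W M borel] W)
  from measurable_compose[OF this measurable_wave_path[OF m]]
  have "(\<lambda>\<omega>. wave m c (grid_increment m (\<lambda>t. W t \<omega>))) \<in> borel_measurable ?F" for c
    by (simp add: grid_increment_restrict)
  then show ?thesis unfolding limit_wave_def[abs_def] by simp
qed

subsection \<open>From joint moments to characteristic functions\<close>

lemma norm_expand_le:
  assumes "\<And>\<theta>. cmod (\<psi> \<theta>) \<le> 1"
  shows "cmod (expand \<psi> r) \<le> (\<Sum>(c, \<theta>)\<leftarrow>r. cmod c)"
proof (induction r)
  case (Cons a r)
  obtain c \<theta> where a: "a = (c, \<theta>)" by (cases a)
  have "cmod (c * \<psi> \<theta> + expand \<psi> r) \<le> cmod c * 1 + (\<Sum>(c, \<theta>)\<leftarrow>r. cmod c)"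
    using assms Cons by (intro norm_triangle_mono) (auto simp: norm_mult intro!: mult_left_le)
  then show ?case by (simp add: a)
qed simp

lemma measurable_expand:
  assumes "\<And>\<theta>. \<Psi> \<theta> \<in> borel_measurable M"
  shows "(\<lambda>\<omega>. expand (\<lambda>\<theta>. \<Psi> \<theta> \<omega>) r) \<in> borel_measurable M"
proof (induction r)
  case (Cons a r)
  obtain c \<theta> where "a = (c, \<theta>)" by (cases a)
  then show ?case using Cons assms by simp
qed simp

lemma measurable_prod_list:
  fixes g :: "'i \<Rightarrow> 'a \<Rightarrow> complex"
  assumes "\<And>x. g x \<in> borel_measurable M"
  shows "(\<lambda>\<omega>. \<Prod>x\<leftarrow>xs. g x \<omega>) \<in> borel_measurable M"
  using assms by (induction xs) auto

lemma norm_prod_list_le: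
  fixes g :: "'i \<Rightarrow> complex"
  assumes "\<And>x. cmod (g x) \<le> C x"
  shows "cmod (\<Prod>x\<leftarrow>xs. g x) \<le> (\<Prod>x\<leftarrow>xs. C x)"
proof -
  have C: "0 \<le> C x" for x using assms[of x] norm_ge_zero[of "g x"] by linarith
  then have "0 \<le> (\<Prod>x\<leftarrow>xs. C x)" for xs by (induction xs) auto
  then show ?thesis using assms C by (induction xs) (auto simp: norm_mult intro!: mult_mono)
qed

context prob_space
begin

lemma integrable_expand_prod:
  assumes "\<And>\<theta>. \<Psi> \<theta> \<in> borel_measurable M" "\<And>\<theta> \<omega>. \<omega> \<in> space M \<Longrightarrow> cmod (\<Psi> \<theta> \<omega>) \<le> 1"
  shows "integrable M (\<lambda>\<omega>. (\<Prod>r\<leftarrow>rs. expand (\<lambda>\<theta>. \<Psi> \<theta> \<omega>) r) * (\<Prod>\<theta>\<leftarrow>\<theta>s. \<Psi> \<theta> \<omega>))"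
proof (rule integrable_const_bound)
  show "AE \<omega> in M. cmod ((\<Prod>r\<leftarrow>rs. expand (\<lambda>\<theta>. \<Psi> \<theta> \<omega>) r) * (\<Prod>\<theta>\<leftarrow>\<theta>s. \<Psi> \<theta> \<omega>))
      \<le> (\<Prod>r\<leftarrow>rs. \<Sum>(c, \<theta>)\<leftarrow>r. cmod c) * (\<Prod>\<theta>\<leftarrow>\<theta>s. 1)"
  proof (rule AE_I2)
    fix \<omega> assume \<omega>: "\<omega> \<in> space M"
    have 1: "cmod (\<Prod>r\<leftarrow>rs. expand (\<lambda>\<theta>. \<Psi> \<theta> \<omega>) r) \<le> (\<Prod>r\<leftarrow>rs. \<Sum>(c, \<theta>)\<leftarrow>r. cmod c)"
      using assms(2)[OF \<omega>] by (intro norm_prod_list_le norm_expand_le)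
    have 2: "cmod (\<Prod>\<theta>\<leftarrow>\<theta>s. \<Psi> \<theta> \<omega>) \<le> (\<Prod>\<theta>\<leftarrow>\<theta>s. 1)"
      using assms(2)[OF \<omega>] by (intro norm_prod_list_le)
    show "cmod ((\<Prod>r\<leftarrow>rs. expand (\<lambda>\<theta>. \<Psi> \<theta> \<omega>) r) * (\<Prod>\<theta>\<leftarrow>\<theta>s. \<Psi> \<theta> \<omega>))
      \<le> (\<Prod>r\<leftarrow>rs. \<Sum>(c, \<theta>)\<leftarrow>r. cmod c) * (\<Prod>\<theta>\<leftarrow>\<theta>s. 1)"
      unfolding norm_mult using order_trans[OF norm_ge_zero 1] by (intro mult_mono 1 2) auto
  qed
  show "(\<lambda>\<omega>. (\<Prod>r\<leftarrow>rs. expand (\<lambda>\<theta>. \<Psi> \<theta> \<omega>) r) * (\<Prod>\<theta>\<leftarrow>\<theta>s. \<Psi> \<theta> \<omega>)) \<in> borel_measurable M"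
    by (intro borel_measurable_times measurable_prod_list measurable_expand assms)
qed

text \<open>One monomial leaves the first polynomial and its character joins the list \<theta>s.
  Repeating this reduces moments of polynomials to the joint moments of characters.\<close>

lemma expectation_expand_prod_Cons:
  assumes "\<And>\<theta>. \<Psi> \<theta> \<in> borel_measurable M" "\<And>\<theta> \<omega>. \<omega> \<in> space M \<Longrightarrow> cmod (\<Psi> \<theta> \<omega>) \<le> 1"
  shows "expectation (\<lambda>\<omega>. (\<Prod>r\<leftarrow>((c, \<theta>) # r) # rs. expand (\<lambda>\<theta>. \<Psi> \<theta> \<omega>) r) * (\<Prod>\<theta>\<leftarrow>\<theta>s. \<Psi> \<theta> \<omega>))
    = c * expectation (\<lambda>\<omega>. (\<Prod>r\<leftarrow>rs. expand (\<lambda>\<theta>. \<Psi> \<theta> \<omega>) r) * (\<Prod>\<theta>\<leftarrow>\<theta> # \<theta>s. \<Psi> \<theta> \<omega>))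
      + expectation (\<lambda>\<omega>. (\<Prod>r\<leftarrow>r # rs. expand (\<lambda>\<theta>. \<Psi> \<theta> \<omega>) r) * (\<Prod>\<theta>\<leftarrow>\<theta>s. \<Psi> \<theta> \<omega>))"
proof -
  have "(\<lambda>\<omega>. (\<Prod>r\<leftarrow>((c, \<theta>) # r) # rs. expand (\<lambda>\<theta>. \<Psi> \<theta> \<omega>) r) * (\<Prod>\<theta>\<leftarrow>\<theta>s. \<Psi> \<theta> \<omega>))
    = (\<lambda>\<omega>. c * ((\<Prod>r\<leftarrow>rs. expand (\<lambda>\<theta>. \<Psi> \<theta> \<omega>) r) * (\<Prod>\<theta>\<leftarrow>\<theta> # \<theta>s. \<Psi> \<theta> \<omega>))
        + (\<Prod>r\<leftarrow>r # rs. expand (\<lambda>\<theta>. \<Psi> \<theta> \<omega>) r) * (\<Prod>\<theta>\<leftarrow>\<theta>s. \<Psi> \<theta> \<omega>))"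
    by (simp add: fun_eq_iff algebra_simps)
  then show ?thesis
    using integrable_expand_prod[where \<Psi>=\<Psi> and rs=rs and \<theta>s="\<theta> # \<theta>s", OF assms]
      integrable_expand_prod[where \<Psi>=\<Psi> and rs="r # rs" and \<theta>s=\<theta>s, OF assms]
    by (simp only: Bochner_Integration.integral_add integrable_mult_right integral_mult_right_zero)
qed

lemma cmod_char_diff_le:
  assumes [measurable]: "Y \<in> borel_measurable M" "Z \<in> borel_measurable M" and int: "integrable M (\<lambda>\<omega>. \<bar>Y \<omega> - Z \<omega>\<bar>)"
  shows "cmod (char (distr M borel Y) t - char (distr M borel Z) t) \<le> \<bar>t\<bar> * expectation (\<lambda>\<omega>. \<bar>Y \<omega> - Z \<omega>\<bar>)"
proof -
  have i: "integrable M (\<lambda>\<omega>. iexp (t * Y \<omega>))" "integrable M (\<lambda>\<omega>. iexp (t * Z \<omega>))"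
    by (auto intro!: integrable_const_bound[where B=1])
  have "char (distr M borel Y) t - char (distr M borel Z) t = expectation (\<lambda>\<omega>. iexp (t * Y \<omega>) - iexp (t * Z \<omega>))"
    using i by (simp add: char_def integral_distr)
  also have "cmod \<dots> \<le> expectation (\<lambda>\<omega>. cmod (iexp (t * Y \<omega>) - iexp (t * Z \<omega>)))"
    by (rule integral_norm_bound)
  also have "\<dots> \<le> expectation (\<lambda>\<omega>. \<bar>t\<bar> * \<bar>Y \<omega> - Z \<omega>\<bar>)"
  proof (rule integral_mono)
    show "integrable M (\<lambda>\<omega>. cmod (iexp (t * Y \<omega>) - iexp (t * Z \<omega>)))" using i by simp
    show "integrable M (\<lambda>\<omega>. \<bar>t\<bar> * \<bar>Y \<omega> - Z \<omega>\<bar>)" using int by simp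
    show "cmod (iexp (t * Y \<omega>) - iexp (t * Z \<omega>)) \<le> \<bar>t\<bar> * \<bar>Y \<omega> - Z \<omega>\<bar>" for \<omega>
    proof -
      have "iexp (t * Y \<omega>) = iexp (t * Z \<omega>) * iexp (t * (Y \<omega> - Z \<omega>))"
        by (simp add: exp_add[symmetric] algebra_simps)
      then have "cmod (iexp (t * Y \<omega>) - iexp (t * Z \<omega>)) = cmod (iexp (t * Z \<omega>) * (iexp (t * (Y \<omega> - Z \<omega>)) - 1))"
        by (simp add: algebra_simps)
      also have "\<dots> = cmod (iexp (t * (Y \<omega> - Z \<omega>)) - 1)" by (simp only: norm_mult norm_exp_i_times mult_1)
      also have "\<dots> \<le> \<bar>t * (Y \<omega> - Z \<omega>)\<bar>" using iexp_approx1[of "t * (Y \<omega> - Z \<omega>)" 0] by simp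
      finally show ?thesis by (simp add: abs_mult)
    qed
  qed
  finally show ?thesis by simp
qed

text \<open>The error depends on the variable only through the bound \<open>C\<close>. The number of
  moments can therefore be fixed before \<open>n\<close>.\<close>

lemma cmod_char_moments_le:
  assumes [measurable]: "Z \<in> borel_measurable M" and bd: "AE \<omega> in M. \<bar>Z \<omega>\<bar> \<le> C"
  shows "cmod (char (distr M borel Z) t - (\<Sum>k\<le>n. (\<i> * t) ^ k / fact k * expectation (\<lambda>\<omega>. Z \<omega> ^ k)))
    \<le> 2 * ((\<bar>t\<bar> * C) ^ n / fact n)"
proof -
  have bdk: "AE \<omega> in M. \<bar>Z \<omega>\<bar> ^ k \<le> C ^ k" for k
    using bd by eventually_elim (intro power_mono, auto)
  have int: "integrable M (\<lambda>\<omega>. Z \<omega> ^ k)" for k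
    using bdk[of k] by (intro integrable_const_bound[where B="C ^ k"]) (auto simp: power_abs)
  have "cmod (char (distr M borel Z) t - (\<Sum>k\<le>n. (\<i> * t) ^ k / fact k * expectation (\<lambda>\<omega>. Z \<omega> ^ k)))
    \<le> (2 * \<bar>t\<bar> ^ n / fact n) * expectation (\<lambda>\<omega>. \<bar>Z \<omega>\<bar> ^ n)"
    by (rule char_approx1'[OF int _ refl]) simp
  also have "\<dots> \<le> (2 * \<bar>t\<bar> ^ n / fact n) * C ^ n"
    using bdk[of n] int[of n] by (intro mult_left_mono integral_le_const) (auto simp: power_abs[symmetric])
  finally show ?thesis by (simp add: power_mult_distrib)
qed

end

text \<open>The method of moments for variables with a common bound, here the sum of the moduli of
  the coefficients. A power of a polynomial in the characters is a finite combination of products of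
  characters, so joint moments of characters determine the limits of all moments.\<close>

lemma char_tendsto_of_expand:
  fixes \<Psi> :: "nat \<Rightarrow> 't \<Rightarrow> 'a \<Rightarrow> complex" and \<Phi> :: "'t \<Rightarrow> 'b \<Rightarrow> complex"
  assumes M: "prob_space M" and N: "prob_space N"
    and \<Psi>: "\<And>n \<theta>. \<Psi> n \<theta> \<in> borel_measurable M" "\<And>n \<theta> \<omega>. \<omega> \<in> space M \<Longrightarrow> cmod (\<Psi> n \<theta> \<omega>) \<le> 1"
    and \<Phi>: "\<And>\<theta>. \<Phi> \<theta> \<in> borel_measurable N" "\<And>\<theta> \<omega>. \<omega> \<in> space N \<Longrightarrow> cmod (\<Phi> \<theta> \<omega>) \<le> 1"
    and conv: "\<And>\<theta>s. (\<lambda>n. \<integral>\<omega>. (\<Prod>\<theta>\<leftarrow>\<theta>s. \<Psi> n \<theta> \<omega>) \<partial>M) \<longlonglongrightarrow> (\<integral>\<omega>. (\<Prod>\<theta>\<leftarrow>\<theta>s. \<Phi> \<theta> \<omega>) \<partial>N)"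
    and Z [measurable]: "\<And>n. Z n \<in> borel_measurable M" and Zr: "\<And>n. AE \<omega> in M. complex_of_real (Z n \<omega>) = expand (\<lambda>\<theta>. \<Psi> n \<theta> \<omega>) r"
    and Z' [measurable]: "Z' \<in> borel_measurable N" and Zr': "AE \<omega> in N. complex_of_real (Z' \<omega>) = expand (\<lambda>\<theta>. \<Phi> \<theta> \<omega>) r"
  shows "(\<lambda>n. char (distr M borel (Z n)) t) \<longlonglongrightarrow> char (distr N borel Z') t"
proof -
  interpret M: prob_space M by (rule M)
  interpret N: prob_space N by (rule N)
  have prods: "(\<lambda>n. \<integral>\<omega>. (\<Prod>r\<leftarrow>rs. expand (\<lambda>\<theta>. \<Psi> n \<theta> \<omega>) r) * (\<Prod>\<theta>\<leftarrow>\<theta>s. \<Psi> n \<theta> \<omega>) \<partial>M)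
    \<longlonglongrightarrow> (\<integral>\<omega>. (\<Prod>r\<leftarrow>rs. expand (\<lambda>\<theta>. \<Phi> \<theta> \<omega>) r) * (\<Prod>\<theta>\<leftarrow>\<theta>s. \<Phi> \<theta> \<omega>) \<partial>N)" for rs \<theta>s
  \<comment> \<open>Arbitrary \<theta>s are essential: the inner induction on the first polynomial
    feeds its characters into that list.\<close>
  proof (induction rs arbitrary: \<theta>s)
    case Nil
    then show ?case using conv by simp
  next
    case outer: (Cons r rs)
    show ?case
    proof (induction r)
      case (Cons a r)
      obtain c \<theta> where a: "a = (c, \<theta>)" by (cases a)
      have M: "(\<integral>\<omega>. (\<Prod>r\<leftarrow>((c, \<theta>) # r) # rs. expand (\<lambda>\<theta>. \<Psi> n \<theta> \<omega>) r) * (\<Prod>\<theta>\<leftarrow>\<theta>s. \<Psi> n \<theta> \<omega>) \<partial>M)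
        = c * (\<integral>\<omega>. (\<Prod>r\<leftarrow>rs. expand (\<lambda>\<theta>. \<Psi> n \<theta> \<omega>) r) * (\<Prod>\<theta>\<leftarrow>\<theta> # \<theta>s. \<Psi> n \<theta> \<omega>) \<partial>M)
          + (\<integral>\<omega>. (\<Prod>r\<leftarrow>r # rs. expand (\<lambda>\<theta>. \<Psi> n \<theta> \<omega>) r) * (\<Prod>\<theta>\<leftarrow>\<theta>s. \<Psi> n \<theta> \<omega>) \<partial>M)" for n
        by (rule M.expectation_expand_prod_Cons) (use \<Psi> in auto)
      have N: "(\<integral>\<omega>. (\<Prod>r\<leftarrow>((c, \<theta>) # r) # rs. expand (\<lambda>\<theta>. \<Phi> \<theta> \<omega>) r) * (\<Prod>\<theta>\<leftarrow>\<theta>s. \<Phi> \<theta> \<omega>) \<partial>N)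
        = c * (\<integral>\<omega>. (\<Prod>r\<leftarrow>rs. expand (\<lambda>\<theta>. \<Phi> \<theta> \<omega>) r) * (\<Prod>\<theta>\<leftarrow>\<theta> # \<theta>s. \<Phi> \<theta> \<omega>) \<partial>N)
          + (\<integral>\<omega>. (\<Prod>r\<leftarrow>r # rs. expand (\<lambda>\<theta>. \<Phi> \<theta> \<omega>) r) * (\<Prod>\<theta>\<leftarrow>\<theta>s. \<Phi> \<theta> \<omega>) \<partial>N)"
        by (rule N.expectation_expand_prod_Cons) (use \<Phi> in auto)
      show ?case unfolding a M N
        by (intro tendsto_add tendsto_mult tendsto_const outer Cons)
    qed simp
  qed
  define C where "C = (\<Sum>(c, \<theta>)\<leftarrow>r. cmod c)"
  have bd: "AE \<omega> in M. \<bar>Z n \<omega>\<bar> \<le> C" for n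
    using Zr[of n] AE_space
  proof eventually_elim
    case (elim \<omega>)
    then have "cmod (complex_of_real (Z n \<omega>)) \<le> C" unfolding C_def using \<Psi>(2) by (simp only: norm_expand_le)
    then show ?case by simp
  qed
  have bd': "AE \<omega> in N. \<bar>Z' \<omega>\<bar> \<le> C"
    using Zr' AE_space
  proof eventually_elim
    case (elim \<omega>)
    then have "cmod (complex_of_real (Z' \<omega>)) \<le> C" unfolding C_def using \<Phi>(2) by (simp only: norm_expand_le)
    then show ?case by simp
  qed
  \<comment> \<open>The \<open>k\<close>-th power is the product over \<open>k\<close> copies of the
    same polynomial.\<close>
  have pow: "(\<lambda>n. \<integral>\<omega>. (expand (\<lambda>\<theta>. \<Psi> n \<theta> \<omega>) r) ^ k \<partial>M) \<longlonglongrightarrow> (\<integral>\<omega>. (expand (\<lambda>\<theta>. \<Phi> \<theta> \<omega>) r) ^ k \<partial>N)" for k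
    using prods[of "replicate k r" "[]"] by (simp add: prod_list_replicate)
  have moments: "(\<lambda>n. complex_of_real (\<integral>\<omega>. Z n \<omega> ^ k \<partial>M)) \<longlonglongrightarrow> complex_of_real (\<integral>\<omega>. Z' \<omega> ^ k \<partial>N)" for k
  proof -
    have "(\<integral>\<omega>. (expand (\<lambda>\<theta>. \<Psi> n \<theta> \<omega>) r) ^ k \<partial>M) = (\<integral>\<omega>. complex_of_real (Z n \<omega> ^ k) \<partial>M)" for n
      using Zr[of n] measurable_expand[of "\<Psi> n" M r, OF \<Psi>(1)]
      by (intro integral_cong_AE) (auto elim!: eventually_mono)
    moreover have "(\<integral>\<omega>. (expand (\<lambda>\<theta>. \<Phi> \<theta> \<omega>) r) ^ k \<partial>N) = (\<integral>\<omega>. complex_of_real (Z' \<omega> ^ k) \<partial>N)"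
      using Zr' measurable_expand[of \<Phi> N r, OF \<Phi>(1)]
      by (intro integral_cong_AE) (auto elim!: eventually_mono)
    ultimately show ?thesis using pow[of k] by (simp only: integral_complex_of_real)
  qed
  show ?thesis
  proof (rule LIMSEQ_I)
    fix e :: real assume e: "e > 0"
    \<comment> \<open>With this quantity below \<open>e / 8\<close>, the two Taylor remainders
      together stay below \<open>e / 2\<close>; the rest is left to the convergence of finitely many
      moments.\<close>
    have "(\<lambda>k. (\<bar>t\<bar> * C) ^ k / fact k) \<longlonglongrightarrow> 0"
      using summable_LIMSEQ_zero[OF summable_exp[of "\<bar>t\<bar> * C"]] by (simp add: field_simps)
    then have "\<forall>\<^sub>F k in sequentially. (\<bar>t\<bar> * C) ^ k / fact k < e / 8"
      using e by (intro order_tendstoD) auto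
    then obtain k where k: "(\<bar>t\<bar> * C) ^ k / fact k < e / 8" by (auto simp: eventually_sequentially)
    define S where "S n = (\<Sum>i\<le>k. (\<i> * t) ^ i / fact i * complex_of_real (\<integral>\<omega>. Z n \<omega> ^ i \<partial>M))" for n
    define S' where "S' = (\<Sum>i\<le>k. (\<i> * t) ^ i / fact i * complex_of_real (\<integral>\<omega>. Z' \<omega> ^ i \<partial>N))"
    have "S \<longlonglongrightarrow> S'" unfolding S_def S'_def by (intro tendsto_intros moments)
    then obtain n0 where n0: "\<And>n. n \<ge> n0 \<Longrightarrow> cmod (S n - S') < e / 2"
      using e LIMSEQ_D[of S S' "e / 2"] by auto
    show "\<exists>no. \<forall>n\<ge>no. norm (char (distr M borel (Z n)) t - char (distr N borel Z') t) < e"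
    proof (intro exI allI impI)
      fix n assume n: "n \<ge> n0"
      have 1: "cmod (char (distr M borel (Z n)) t - S n) \<le> 2 * ((\<bar>t\<bar> * C) ^ k / fact k)"
        unfolding S_def by (rule M.cmod_char_moments_le[OF Z bd])
      have 2: "cmod (char (distr N borel Z') t - S') \<le> 2 * ((\<bar>t\<bar> * C) ^ k / fact k)"
        unfolding S'_def by (rule N.cmod_char_moments_le[OF Z' bd'])
      have "char (distr M borel (Z n)) t - char (distr N borel Z') t
        = (char (distr M borel (Z n)) t - S n) + (S n - S') - (char (distr N borel Z') t - S')" by simp
      also have "cmod \<dots> \<le> cmod (char (distr M borel (Z n)) t - S n) + cmod (S n - S') + cmod (char (distr N borel Z') t - S')"
        by (meson add_mono norm_triangle_ineq norm_triangle_ineq4 order_refl order_trans)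
      finally show "norm (char (distr M borel (Z n)) t - char (distr N borel Z') t) < e"
        using 1 2 k n0[OF n] by linarith
    qed
  qed
qed

section \<open>Conditional expectations of approximations and of trigonometric polynomials\<close>

context sigma_finite_subalgebra
begin

text \<open>The difference is tested against its own sign, which is measurable for the subalgebra,
  so the conditional expectations can be removed. This carries annealed L1 estimates over to the
  quenched expectations.\<close>

lemma real_cond_exp_L1_contraction:
  assumes f: "integrable M f" and g: "integrable M g"
  shows "integrable M (\<lambda>\<omega>. \<bar>real_cond_exp M F f \<omega> - real_cond_exp M F g \<omega>\<bar>)"
    "(\<integral>\<omega>. \<bar>real_cond_exp M F f \<omega> - real_cond_exp M F g \<omega>\<bar> \<partial>M) \<le> (\<integral>\<omega>. \<bar>f \<omega> - g \<omega>\<bar> \<partial>M)"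
proof -
  let ?f = "real_cond_exp M F f" and ?g = "real_cond_exp M F g"
  show "integrable M (\<lambda>\<omega>. \<bar>?f \<omega> - ?g \<omega>\<bar>)"
    using real_cond_exp_int(1)[OF f] real_cond_exp_int(1)[OF g] by simp
  define s where "s \<omega> = sgn (?f \<omega> - ?g \<omega>)" for \<omega>
  have sF: "s \<in> borel_measurable F" unfolding s_def[abs_def] by measurable
  then have sM: "s \<in> borel_measurable M" by (rule measurable_from_subalg[OF subalg])
  have s1: "\<bar>s \<omega>\<bar> \<le> 1" for \<omega> by (simp add: s_def sgn_real_def)
  have int: "integrable M (\<lambda>\<omega>. s \<omega> * h \<omega>)" if "integrable M h" for h
    using that sM s1 by (intro Bochner_Integration.integrable_bound[OF that]) (auto simp: abs_mult intro!: mult_left_le_one_le)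
  have "(\<integral>\<omega>. \<bar>?f \<omega> - ?g \<omega>\<bar> \<partial>M) = (\<integral>\<omega>. s \<omega> * ?f \<omega> - s \<omega> * ?g \<omega> \<partial>M)"
    by (intro Bochner_Integration.integral_cong) (auto simp: s_def abs_sgn algebra_simps)
  also have "\<dots> = (\<integral>\<omega>. s \<omega> * ?f \<omega> \<partial>M) - (\<integral>\<omega>. s \<omega> * ?g \<omega> \<partial>M)"
    using f g by (intro Bochner_Integration.integral_diff int real_cond_exp_int(1))
  also have "\<dots> = (\<integral>\<omega>. s \<omega> * f \<omega> \<partial>M) - (\<integral>\<omega>. s \<omega> * g \<omega> \<partial>M)"
    using f g sF by (simp add: real_cond_exp_intg(2) int)
  also have "\<dots> = (\<integral>\<omega>. s \<omega> * (f \<omega> - g \<omega>) \<partial>M)"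
    using f g int by (simp add: right_diff_distrib)
  also have "\<dots> \<le> (\<integral>\<omega>. \<bar>f \<omega> - g \<omega>\<bar> \<partial>M)"
  proof (rule integral_mono)
    show "integrable M (\<lambda>\<omega>. s \<omega> * (f \<omega> - g \<omega>))" using f g by (intro int) simp
    show "s \<omega> * (f \<omega> - g \<omega>) \<le> \<bar>f \<omega> - g \<omega>\<bar>" for \<omega>
    proof -
      have "s \<omega> * (f \<omega> - g \<omega>) \<le> \<bar>s \<omega>\<bar> * \<bar>f \<omega> - g \<omega>\<bar>" by (simp flip: abs_mult)
      also have "\<dots> \<le> \<bar>f \<omega> - g \<omega>\<bar>" using s1 by (intro mult_left_le_one_le) auto
      finally show ?thesis .
    qed
  qed (use f g in simp)
  finally show "(\<integral>\<omega>. \<bar>?f \<omega> - ?g \<omega>\<bar> \<partial>M) \<le> (\<integral>\<omega>. \<bar>f \<omega> - g \<omega>\<bar> \<partial>M)" .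
qed

text \<open>Stated for a general \<Psi> because it is used twice: for the environment with
  \<open>quenched_wave\<close>, and for the algebra of \<open>W\<close> with
  \<open>limit_wave\<close>. The list \<open>r\<close> is the same before and after
  conditioning.\<close>

lemma real_cond_exp_expand:
  fixes D :: "'a \<Rightarrow> nat \<Rightarrow> real"
  assumes M: "prob_space M"
    and D: "\<And>j. (\<lambda>\<omega>. D \<omega> j) \<in> borel_measurable M"
    and p: "\<And>d. complex_of_real (p d) = expand (\<lambda>\<theta>. wave m \<theta> d) r"
    and \<Psi>: "\<And>\<theta>. \<Psi> \<theta> \<in> borel_measurable F" "\<And>\<theta> \<omega>. \<omega> \<in> space M \<Longrightarrow> cmod (\<Psi> \<theta> \<omega>) \<le> 1"
    and cond: "\<And>A \<theta>. A \<in> sets F \<Longrightarrow> (\<integral>\<omega>. indicator A \<omega> * wave m \<theta> (D \<omega>) \<partial>M) = (\<integral>\<omega>. indicator A \<omega> * \<Psi> \<theta> \<omega> \<partial>M)"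
  shows "integrable M (\<lambda>\<omega>. p (D \<omega>))"
    and "AE \<omega> in M. complex_of_real (real_cond_exp M F (\<lambda>\<omega>. p (D \<omega>)) \<omega>) = expand (\<lambda>\<theta>. \<Psi> \<theta> \<omega>) r"
proof -
  interpret prob_space M by (rule M)
  have \<Psi>M: "\<Psi> \<theta> \<in> borel_measurable M" for \<theta> by (rule measurable_from_subalg[OF subalg \<Psi>(1)])
  have wave_meas: "(\<lambda>\<omega>. wave m \<theta> (D \<omega>)) \<in> borel_measurable M" for \<theta>
    unfolding wave_def using D by (intro measurable_compose[of _ M borel iexp] borel_measurable_sum borel_measurable_times) auto
  have iW: "integrable M (\<lambda>\<omega>. expand (\<lambda>\<theta>. wave m \<theta> (D \<omega>)) s)" for s
    using integrable_expand_prod[where \<Psi>="\<lambda>\<theta> \<omega>. wave m \<theta> (D \<omega>)" and rs="[s]" and \<theta>s="[]"] wave_meas by simp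
  have i\<Psi>: "integrable M (\<lambda>\<omega>. expand (\<lambda>\<theta>. \<Psi> \<theta> \<omega>) s)" for s
    using integrable_expand_prod[where \<Psi>=\<Psi> and rs="[s]" and \<theta>s="[]", OF \<Psi>M \<Psi>(2)] by simp
  have "integrable M (\<lambda>\<omega>. complex_of_real (p (D \<omega>)))" unfolding p by (rule iW)
  then show ip: "integrable M (\<lambda>\<omega>. p (D \<omega>))" using integrable_Re by fastforce
  show "AE \<omega> in M. complex_of_real (real_cond_exp M F (\<lambda>\<omega>. p (D \<omega>)) \<omega>) = expand (\<lambda>\<theta>. \<Psi> \<theta> \<omega>) r"
  proof (rule real_cond_exp_complex_charact[OF ip i\<Psi> measurable_expand[OF \<Psi>(1)]])
    fix A assume A: "A \<in> sets F"
    then have AM: "A \<in> sets M" using subalg by (auto simp: subalgebra_def)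
    have int: "integrable M (\<lambda>\<omega>. indicator A \<omega> * h \<omega>)" if "integrable M h" for h :: "'a \<Rightarrow> complex"
      using that AM borel_measurable_integrable[OF that]
      by (intro Bochner_Integration.integrable_bound[OF that]) (auto simp: norm_mult indicator_def intro!: borel_measurable_times)
    have "(\<integral>\<omega>. indicator A \<omega> * expand (\<lambda>\<theta>. wave m \<theta> (D \<omega>)) s \<partial>M) = (\<integral>\<omega>. indicator A \<omega> * expand (\<lambda>\<theta>. \<Psi> \<theta> \<omega>) s \<partial>M)" for s
    proof (induction s)
      case (Cons a s)
      obtain c \<theta> where a: "a = (c, \<theta>)" by (cases a)
      have w: "integrable M (\<lambda>\<omega>. indicator A \<omega> * wave m \<theta> (D \<omega>))" "integrable M (\<lambda>\<omega>. indicator A \<omega> * \<Psi> \<theta> \<omega>)"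
        using int[OF iW[of "[(1, \<theta>)]"]] int[OF i\<Psi>[of "[(1, \<theta>)]"]] by simp_all
      have "(\<integral>\<omega>. indicator A \<omega> * expand (\<lambda>\<theta>. wave m \<theta> (D \<omega>)) (a # s) \<partial>M)
        = (\<integral>\<omega>. c * (indicator A \<omega> * wave m \<theta> (D \<omega>)) + indicator A \<omega> * expand (\<lambda>\<theta>. wave m \<theta> (D \<omega>)) s \<partial>M)"
        by (simp add: a algebra_simps)
      also have "\<dots> = c * (\<integral>\<omega>. indicator A \<omega> * wave m \<theta> (D \<omega>) \<partial>M) + (\<integral>\<omega>. indicator A \<omega> * expand (\<lambda>\<theta>. wave m \<theta> (D \<omega>)) s \<partial>M)"
        using w(1) int[OF iW[of s]] by (simp only: Bochner_Integration.integral_add integrable_mult_right integral_mult_right_zero)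
      also have "\<dots> = c * (\<integral>\<omega>. indicator A \<omega> * \<Psi> \<theta> \<omega> \<partial>M) + (\<integral>\<omega>. indicator A \<omega> * expand (\<lambda>\<theta>. \<Psi> \<theta> \<omega>) s \<partial>M)"
        using cond[OF A] Cons by simp
      also have "\<dots> = (\<integral>\<omega>. c * (indicator A \<omega> * \<Psi> \<theta> \<omega>) + indicator A \<omega> * expand (\<lambda>\<theta>. \<Psi> \<theta> \<omega>) s \<partial>M)"
        using w(2) int[OF i\<Psi>[of s]] by (simp only: Bochner_Integration.integral_add integrable_mult_right integral_mult_right_zero)
      also have "\<dots> = (\<integral>\<omega>. indicator A \<omega> * expand (\<lambda>\<theta>. \<Psi> \<theta> \<omega>) (a # s) \<partial>M)"
        by (simp add: a algebra_simps)
      finally show ?case .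
    qed simp
    then show "(\<integral>\<omega>. indicator A \<omega> * complex_of_real (p (D \<omega>)) \<partial>M) = (\<integral>\<omega>. indicator A \<omega> * expand (\<lambda>\<theta>. \<Psi> \<theta> \<omega>) r \<partial>M)"
      by (simp only: p)
  qed
qed

end

subsection \<open>The invariance principle\<close>

text \<open>Outside the cube of radius \<open>R\<close> only the global bounds are available, and
  there the sum of the squared increments exceeds \<open>R\<^sup>2\<close>. Since only second
  moments enter, the estimate is uniform in \<open>n\<close>.\<close>

lemma (in prob_space) trig_approx_L1:
  fixes D :: "'a \<Rightarrow> nat \<Rightarrow> real"
  assumes zero: "\<And>\<omega> j. j \<ge> m \<Longrightarrow> D \<omega> j = 0"
    and D2: "\<And>j. integrable M (\<lambda>\<omega>. (D \<omega> j)\<^sup>2)" "\<And>j. expectation (\<lambda>\<omega>. (D \<omega> j)\<^sup>2) \<le> V"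
    and G: "integrable M (\<lambda>\<omega>. G (D \<omega>))" "\<And>d. \<bar>G d\<bar> \<le> K"
    and p: "integrable M (\<lambda>\<omega>. p (D \<omega>))" "\<And>d. \<bar>p d\<bar> \<le> K + e"
    and approx: "\<And>d. (\<And>j. j \<ge> m \<Longrightarrow> d j = 0) \<Longrightarrow> (\<And>j. j < m \<Longrightarrow> \<bar>d j\<bar> \<le> R) \<Longrightarrow> \<bar>p d - G d\<bar> \<le> e"
    and R: "R > 0" and e: "e \<ge> 0" and K: "K \<ge> 0"
  shows "expectation (\<lambda>\<omega>. \<bar>G (D \<omega>) - p (D \<omega>)\<bar>) \<le> e + (2 * K + e) * (real m * V / R\<^sup>2)"
proof -
  \<comment> \<open>A pointwise form of Chebyshev's inequality: the sum of squares over
    \<open>R\<^sup>2\<close> majorizes the indicator of leaving the cube.\<close>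
  have pw: "\<bar>G (D \<omega>) - p (D \<omega>)\<bar> \<le> e + (2 * K + e) / R\<^sup>2 * (\<Sum>j<m. (D \<omega> j)\<^sup>2)" for \<omega>
  proof (cases "\<forall>j<m. \<bar>D \<omega> j\<bar> \<le> R")
    case True
    then have "\<bar>p (D \<omega>) - G (D \<omega>)\<bar> \<le> e" using zero by (intro approx) auto
    moreover have "0 \<le> (2 * K + e) / R\<^sup>2 * (\<Sum>j<m. (D \<omega> j)\<^sup>2)"
      using e K by (intro mult_nonneg_nonneg divide_nonneg_nonneg sum_nonneg) auto
    ultimately show ?thesis by linarith
  next
    case False
    then obtain j where j: "j < m" "\<bar>D \<omega> j\<bar> > R" by (auto simp: not_le)
    have "R\<^sup>2 \<le> \<bar>D \<omega> j\<bar>\<^sup>2" using j R by (intro power_mono) auto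
    also have "\<dots> \<le> (\<Sum>j<m. (D \<omega> j)\<^sup>2)" using j by (simp add: member_le_sum[where f="\<lambda>j. (D \<omega> j)\<^sup>2"])
    finally have "(2 * K + e) / R\<^sup>2 * R\<^sup>2 \<le> (2 * K + e) / R\<^sup>2 * (\<Sum>j<m. (D \<omega> j)\<^sup>2)"
      using e K by (intro mult_left_mono) auto
    then have "2 * K + e \<le> (2 * K + e) / R\<^sup>2 * (\<Sum>j<m. (D \<omega> j)\<^sup>2)" using R by simp
    moreover have "\<bar>G (D \<omega>) - p (D \<omega>)\<bar> \<le> 2 * K + e"
      using G(2)[of "D \<omega>"] p(2)[of "D \<omega>"] by linarith
    ultimately show ?thesis using e by linarith
  qed
  have iS: "integrable M (\<lambda>\<omega>. \<Sum>j<m. (D \<omega> j)\<^sup>2)" using D2 by simp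
  have "expectation (\<lambda>\<omega>. \<bar>G (D \<omega>) - p (D \<omega>)\<bar>) \<le> expectation (\<lambda>\<omega>. e + (2 * K + e) / R\<^sup>2 * (\<Sum>j<m. (D \<omega> j)\<^sup>2))"
    using G p iS pw by (intro integral_mono) auto
  also have "\<dots> = e + (2 * K + e) / R\<^sup>2 * (\<Sum>j<m. expectation (\<lambda>\<omega>. (D \<omega> j)\<^sup>2))"
    using iS D2 by (simp add: prob_space)
  also have "\<dots> \<le> e + (2 * K + e) / R\<^sup>2 * (real m * V)"
    using D2(2) e K sum_bounded_above[of "{..<m}" "\<lambda>j. expectation (\<lambda>\<omega>. (D \<omega> j)\<^sup>2)" V]
    by (intro add_left_mono mult_left_mono) auto
  finally show ?thesis by (simp add: algebra_simps)
qed

context random_walk_in_random_environment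
begin

abbreviation "walk_increments m n \<omega> \<equiv> block_increment m n (\<lambda>k. walk X k \<omega>)"

lemma walk_increments_eq:
  assumes "j < m"
  shows "walk_increments m n \<omega> j = (\<Sum>i\<in>{n * j div m<..n * Suc j div m}. X i \<omega>) / sqrt (real n)"
proof -
  let ?a = "n * j div m" and ?b = "n * Suc j div m"
  have "?a \<le> ?b" by (rule block_endpoints_mono)
  then have "{1..?b} = {1..?a} \<union> {?a<..?b}" "{1..?a} \<inter> {?a<..?b} = {}" by auto
  then have "(\<Sum>i=1..?b. X i \<omega>) = (\<Sum>i=1..?a. X i \<omega>) + (\<Sum>i\<in>{?a<..?b}. X i \<omega>)"
    by (metis finite_atLeastAtMost finite_greaterThanAtMost sum.union_disjoint)
  then show ?thesis using assms by (simp add: block_increment_def walk_def)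
qed

lemma wave_walk_increments:
  assumes m: "m > 0"
  shows "wave m \<theta> (walk_increments m n \<omega>) = iexp (\<Sum>i=1..n. \<theta> (block_of m n i) / sqrt (real n) * X i \<omega>)"
proof -
  have "(\<Sum>i=1..n. \<theta> (block_of m n i) / sqrt (real n) * X i \<omega>)
    = (\<Sum>j<m. \<Sum>i\<in>{n * j div m<..n * Suc j div m}. \<theta> j / sqrt (real n) * X i \<omega>)"
    by (rule sum_block_of[OF m, of "\<lambda>j i. \<theta> j / sqrt (real n) * X i \<omega>"])
  also have "\<dots> = (\<Sum>j<m. \<theta> j * walk_increments m n \<omega> j)"
    by (intro sum.cong refl) (simp add: walk_increments_eq sum_distrib_left sum_divide_distrib del: mult_Suc_right)
  finally show ?thesis unfolding wave_def by simp
qed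

lemma quenched_wave_cond:
  assumes "m > 0" "A \<in> sets env"
  shows "(\<integral>\<omega>. indicator A \<omega> * wave m \<theta> (walk_increments m n \<omega>) \<partial>M) = (\<integral>\<omega>. indicator A \<omega> * quenched_wave m n \<theta> \<omega> \<partial>M)"
  unfolding wave_walk_increments[OF assms(1)] quenched_wave_def by (rule quenched_char[OF assms(2)])

lemma measurable_quenched_wave: "quenched_wave m n \<theta> \<in> borel_measurable env"
  unfolding quenched_wave_def[abs_def] by (rule measurable_quenched_char)

lemma cmod_quenched_wave_le: "\<omega> \<in> space M \<Longrightarrow> cmod (quenched_wave m n \<theta> \<omega>) \<le> 1"
  unfolding quenched_wave_def by (rule cmod_quenched_char_le)

lemma measurable_walk_increments: "(\<lambda>\<omega>. walk_increments m n \<omega> j) \<in> borel_measurable M"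
  unfolding block_increment_def by (cases "j < m") simp_all

lemma walk_increments_second_moment:
  assumes sq: "integrable M (\<lambda>\<omega>. (X 1 \<omega>)\<^sup>2)" and mean: "expectation (X 1) = 0"
    and v: "expectation (\<lambda>\<omega>. (X 1 \<omega>)\<^sup>2) = v"
  shows "integrable M (\<lambda>\<omega>. (walk_increments m n \<omega> j)\<^sup>2) \<and> expectation (\<lambda>\<omega>. (walk_increments m n \<omega> j)\<^sup>2) \<le> v"
proof -
  have v0: "v \<ge> 0" unfolding v[symmetric] by (rule integral_nonneg_AE) simp
  show ?thesis
  proof (cases "j < m \<and> n > 0")
    case True
    define a where "a = n * j div m"
    define k where "k = n * Suc j div m - a"
    have ak: "n * Suc j div m = a + k" using block_endpoints_mono[of n j m] by (simp add: a_def k_def)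
    have "n * Suc j div m \<le> n * m div m" using True by (intro div_le_mono mult_le_mono2) simp
    then have kn: "k \<le> n" using ak True by simp
    have eq: "walk_increments m n \<omega> j = (\<Sum>i<k. X (Suc (a + i)) \<omega>) / sqrt (real n)" for \<omega>
      using True walk_diff_eq_sum[of a k \<omega>] by (simp add: block_increment_def ak a_def[symmetric] del: mult_Suc_right)
    have i: "integrable M (\<lambda>\<omega>. (\<Sum>i<k. X (Suc (a + i)) \<omega>)\<^sup>2)"
      by (rule walk_diff_second_moment(1)[OF sq mean v]) simp
    have "expectation (\<lambda>\<omega>. (walk_increments m n \<omega> j)\<^sup>2) = real k * v / real n"
      using walk_diff_second_moment(2)[OF sq mean v, of "{..<k}" a] by (simp add: eq power_divide)
    also have "\<dots> \<le> real n * v / real n" using kn v0 by (intro divide_right_mono mult_right_mono) auto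
    also have "\<dots> = v" using True by simp
    finally show ?thesis using i by (simp add: eq power_divide)
  next
    case False
    then have "walk_increments m n \<omega> j = 0" for \<omega> by (auto simp: block_increment_def)
    then show ?thesis using v0 by simp
  qed
qed

text \<open>Off the rough event the two paths are within \<open>2 * e\<close>, so the Lipschitz
  constant governs; on it only the bound \<open>K\<close> for \<open>f\<close> is left.\<close>

lemma coarse_approx_L1:
  assumes f: "Lipschitz_continuous_map C01 euclidean_metric f" "\<And>x. x \<in> mspace C01 \<Longrightarrow> \<bar>f x\<bar> \<le> K"
    and L: "L > 0" "\<And>x y. x \<in> mspace C01 \<Longrightarrow> y \<in> mspace C01 \<Longrightarrow> \<bar>f x - f y\<bar> \<le> L * mdist C01 x y"
    and mn: "m > 0" "n > 0" and e: "e > 0"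
  shows "expectation (\<lambda>\<omega>. \<bar>f (broken_line n (\<lambda>k. walk X k \<omega>)) - increment_functional f m (walk_increments m n \<omega>)\<bar>)
    \<le> 2 * L * e + 2 * K * prob (rough m n e)"
proof -
  let ?F = "\<lambda>\<omega>. f (broken_line n (\<lambda>k. walk X k \<omega>))" and ?G = "\<lambda>\<omega>. increment_functional f m (walk_increments m n \<omega>)"
  have K: "K \<ge> 0" using f(2)[OF broken_line_in_C01[of 0 "\<lambda>_. 0"]] by linarith
  have F_le: "\<bar>?F \<omega>\<bar> \<le> K" "\<bar>?G \<omega>\<bar> \<le> K" for \<omega>
    unfolding increment_functional_def by (intro f(2) broken_line_in_C01)+
  have FM: "?F \<in> borel_measurable M"
    by (rule borel_measurable_continuous_sequence[OF Lipschitz_broken_line_continuous[OF f(1)]]) simp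
  have GM: "?G \<in> borel_measurable M"
    by (rule borel_measurable_continuous_sequence[OF continuous_on_increment_functional[OF f(1)] measurable_walk_increments])
  have int: "integrable M ?F" "integrable M ?G"
    using FM GM F_le by (auto intro!: integrable_const_bound[where B=K])
  have ind: "integrable M (indicator (rough m n e) :: 'a \<Rightarrow> real)"
    by (rule integrable_const_bound[where B=1], rule AE_I2, simp add: indicator_def,
      rule borel_measurable_indicator, rule rough_sets)
  have "\<bar>?F \<omega> - ?G \<omega>\<bar> \<le> 2 * L * e + 2 * K * indicator (rough m n e) \<omega>" if \<omega>: "\<omega> \<in> space M" for \<omega>
  proof (cases "\<omega> \<in> rough m n e")
    case True
    have "\<bar>?F \<omega> - ?G \<omega>\<bar> \<le> 2 * K" using F_le[of \<omega>] by linarith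
    moreover have "0 \<le> 2 * L * e" using L e by simp
    ultimately show ?thesis using True by simp
  next
    case False
    have small: "\<bar>walk X (n * j div m + i) \<omega> - walk X (n * j div m) \<omega>\<bar> \<le> e * sqrt (real n)"
      if "j < m" "i \<le> n div m + 2" for j i
    proof (rule ccontr)
      assume "\<not> ?thesis"
      then have "\<omega> \<in> rough m n e" unfolding rough_def using that \<omega> by force
      with False show False by simp
    qed
    have "mdist C01 (broken_line n (\<lambda>k. walk X k \<omega>))
        (broken_line m (\<lambda>j. sqrt (real m) * (\<Sum>i<j. walk_increments m n \<omega> i))) \<le> 2 * e"
      using e by (intro mdist_C01_le dist_coarse_broken_line mn small) (auto simp: walk_def)
    then have "L * mdist C01 (broken_line n (\<lambda>k. walk X k \<omega>))
        (broken_line m (\<lambda>j. sqrt (real m) * (\<Sum>i<j. walk_increments m n \<omega> i))) \<le> L * (2 * e)"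
      using L(1) by (intro mult_left_mono) auto
    then have "\<bar>?F \<omega> - ?G \<omega>\<bar> \<le> L * (2 * e)"
      using L(2)[OF broken_line_in_C01 broken_line_in_C01] unfolding increment_functional_def by (meson order_trans)
    then show ?thesis using False by simp
  qed
  then have "expectation (\<lambda>\<omega>. \<bar>?F \<omega> - ?G \<omega>\<bar>) \<le> expectation (\<lambda>\<omega>. 2 * L * e + 2 * K * indicator (rough m n e) \<omega>)"
  proof (rule integral_mono_AE[rotated 2, OF AE_I2])
    show "integrable M (\<lambda>\<omega>. 2 * L * e + 2 * K * indicator (rough m n e) \<omega>)" using ind by simp
  qed (use int in auto)
  also have "\<dots> = 2 * L * e + 2 * K * prob (rough m n e)"
    using ind by (simp add: prob_space rough_sets)
  finally show ?thesis .
qed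

end

lemma (in prob_space) mixture_increment_second_moment:
  assumes B: "brownian_motion01 M B" and W: "brownian_motion01 M W"
  shows "integrable M (\<lambda>\<omega>. (grid_increment m (\<lambda>t. B t \<omega> + \<sigma> * W t \<omega>) j)\<^sup>2)"
    "expectation (\<lambda>\<omega>. (grid_increment m (\<lambda>t. B t \<omega> + \<sigma> * W t \<omega>) j)\<^sup>2) \<le> 2 * (1 + \<sigma>\<^sup>2)"
    "(\<lambda>\<omega>. grid_increment m (\<lambda>t. B t \<omega> + \<sigma> * W t \<omega>) j) \<in> borel_measurable M"
proof -
  let ?b = "\<lambda>\<omega>. grid_increment m (\<lambda>t. B t \<omega>) j" and ?w = "\<lambda>\<omega>. grid_increment m (\<lambda>t. W t \<omega>) j"
  have eq: "grid_increment m (\<lambda>t. B t \<omega> + \<sigma> * W t \<omega>) j = ?b \<omega> + \<sigma> * ?w \<omega>" for \<omega>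
    by (simp add: grid_increment_def algebra_simps)
  have meas [measurable]: "?b \<in> borel_measurable M" "?w \<in> borel_measurable M"
    by (rule measurable_grid_increment[OF B] measurable_grid_increment[OF W])+
  have le: "(?b \<omega> + \<sigma> * ?w \<omega>)\<^sup>2 \<le> 2 * (?b \<omega>)\<^sup>2 + 2 * \<sigma>\<^sup>2 * (?w \<omega>)\<^sup>2" for \<omega>
  proof -
    have "0 \<le> (?b \<omega> - \<sigma> * ?w \<omega>)\<^sup>2" by simp
    then show ?thesis by (simp add: power2_sum power2_diff power_mult_distrib)
  qed
  have i: "integrable M (\<lambda>\<omega>. 2 * (?b \<omega>)\<^sup>2 + 2 * \<sigma>\<^sup>2 * (?w \<omega>)\<^sup>2)"
    using grid_increment_second_moment(1)[OF B] grid_increment_second_moment(1)[OF W] by simp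
  show m: "(\<lambda>\<omega>. grid_increment m (\<lambda>t. B t \<omega> + \<sigma> * W t \<omega>) j) \<in> borel_measurable M"
    unfolding eq by measurable
  show int: "integrable M (\<lambda>\<omega>. (grid_increment m (\<lambda>t. B t \<omega> + \<sigma> * W t \<omega>) j)\<^sup>2)"
    unfolding eq by (rule Bochner_Integration.integrable_bound[OF i]) (use le in auto)
  have "expectation (\<lambda>\<omega>. (grid_increment m (\<lambda>t. B t \<omega> + \<sigma> * W t \<omega>) j)\<^sup>2)
    \<le> expectation (\<lambda>\<omega>. 2 * (?b \<omega>)\<^sup>2 + 2 * \<sigma>\<^sup>2 * (?w \<omega>)\<^sup>2)"
    using int i le unfolding eq by (intro integral_mono) auto
  also have "\<dots> = 2 * expectation (\<lambda>\<omega>. (?b \<omega>)\<^sup>2) + 2 * \<sigma>\<^sup>2 * expectation (\<lambda>\<omega>. (?w \<omega>)\<^sup>2)"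
    using grid_increment_second_moment(1)[OF B] grid_increment_second_moment(1)[OF W] by simp
  also have "\<dots> \<le> 2 * 1 + 2 * \<sigma>\<^sup>2 * 1"
    by (intro add_mono mult_left_mono grid_increment_second_moment(2) B W) auto
  finally show "expectation (\<lambda>\<omega>. (grid_increment m (\<lambda>t. B t \<omega> + \<sigma> * W t \<omega>) j)\<^sup>2) \<le> 2 * (1 + \<sigma>\<^sup>2)"
    by simp
qed

theorem corollary2p2:
  fixes M :: "'a measure" and \<mu> :: "nat \<Rightarrow> 'a \<Rightarrow> real measure" and X :: "nat \<Rightarrow> 'a \<Rightarrow> real"
    and N :: "'b measure" and B W :: "real \<Rightarrow> 'b \<Rightarrow> real"
    and \<alpha> \<sigma> :: real and f :: "(real \<Rightarrow> real) \<Rightarrow> real"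
  assumes "random_walk_in_random_environment M \<mu> X"
    and "(\<integral>\<omega>. quenched_mean M \<mu> X 1 \<omega> \<partial>M) = 0"
    and "(\<integral>\<omega>. quenched_var M \<mu> X 1 \<omega> \<partial>M) = 1"
    and "\<sigma>\<^sup>2 = (\<integral>\<omega>. (quenched_mean M \<mu> X 1 \<omega>)\<^sup>2 \<partial>M)"
    and "\<alpha> > 2"
    and "(\<integral>\<^sup>+\<omega>. (quenched_nn_exp M \<mu> (\<lambda>\<omega>. ennreal (\<bar>walk X 1 \<omega>\<bar> powr \<alpha>)) \<omega>)\<^sup>2 \<partial>M) < \<infinity>"
    and "prob_space N"
    and "brownian_motion01 N B" and "brownian_motion01 N W"
    and "independent_processes01 N B W"
    and "Lipschitz_continuous_map C01 euclidean_metric f"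
    and "bounded (f ` mspace C01)"
  shows "weak_conv_m
    (\<lambda>n. distr M borel (quenched_exp M \<mu> (\<lambda>\<omega>. f (broken_line n (\<lambda>k. walk X k \<omega>)))))
    (distr N borel (real_cond_exp N (generated_algebra N {0..1} borel W)
      (\<lambda>\<omega>. f (\<lambda>t\<in>{0..1}. B t \<omega> + \<sigma> * W t \<omega>))))"
proof -
  interpret random_walk_in_random_environment M \<mu> X by (rule assms(1))
  interpret N: prob_space N by (rule assms(7))
  note BB = assms(8) and WW = assms(9) and BW = assms(10) and f = assms(11)
  obtain L where L: "L > 0" "\<And>x y. x \<in> mspace C01 \<Longrightarrow> y \<in> mspace C01 \<Longrightarrow> \<bar>f x - f y\<bar> \<le> L * mdist C01 x y"
    using f unfolding Lipschitz_continuous_map_pos by (auto simp: dist_real_def)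
  obtain K where K: "\<And>x. x \<in> mspace C01 \<Longrightarrow> \<bar>f x\<bar> \<le> K"
    using assms(12) unfolding bounded_iff by auto
  have K0: "K \<ge> 0" using K[OF broken_line_in_C01[of 0 "\<lambda>_. 0"]] by linarith

  have sq: "integrable M (\<lambda>\<omega>. (X 1 \<omega>)\<^sup>2)" by (rule square_integrable_step[OF assms(5,6)])
  note mom = step_moments[OF sq assms(2,3,4)]
  have v: "1 + \<sigma>\<^sup>2 > 0" by (simp add: add_pos_nonneg)

  define FW where "FW = generated_algebra N {0..1} borel W"
  have W_meas: "t \<in> {0..1} \<Longrightarrow> W t \<in> borel_measurable N" for t by (rule brownian_path(1)[OF WW])
  have subW: "subalgebra N FW" unfolding FW_def by (rule subalgebra_generated_algebra) (rule W_meas)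
  interpret FW: sigma_finite_subalgebra N FW
    by (intro finite_measure_subalgebra_is_sigma_finite finite_measure_subalgebra.intro
        finite_measure_subalgebra_axioms.intro subW N.finite_measure_axioms)

  \<comment> \<open>Functionals of the walk and of the limit process\<close>
  define F where "F n \<omega> = f (broken_line n (\<lambda>k. walk X k \<omega>))" for n \<omega>
  define Y where "Y n = real_cond_exp M env (F n)" for n
  define H where "H \<omega> = f (\<lambda>t\<in>{0..1}. B t \<omega> + \<sigma> * W t \<omega>)" for \<omega>
  define Y' where "Y' = real_cond_exp N FW H"
  define DN where "DN m \<omega> = grid_increment m (\<lambda>t. B t \<omega> + \<sigma> * W t \<omega>)" for m \<omega>
  define G where "G m = increment_functional f m" for m
  have G_le: "\<bar>G m d\<bar> \<le> K" for m d unfolding G_def increment_functional_def by (intro K broken_line_in_C01)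
  have G_cont: "continuous_on UNIV (G m)" for m unfolding G_def by (rule continuous_on_increment_functional[OF f])
  have iF: "integrable M (F n)" for n
  proof (rule integrable_const_bound[where B=K])
    show "F n \<in> borel_measurable M" unfolding F_def[abs_def]
      by (rule borel_measurable_continuous_sequence[OF Lipschitz_broken_line_continuous[OF f]]) simp
    show "AE \<omega> in M. norm (F n \<omega>) \<le> K" unfolding F_def using K[OF broken_line_in_C01] by simp
  qed
  have GD: "(\<lambda>\<omega>. G m (DN m \<omega>)) \<in> borel_measurable N" for m
    unfolding DN_def
    by (rule borel_measurable_continuous_sequence[OF G_cont N.mixture_increment_second_moment(3)[OF BB WW]])
  have iGD: "integrable N (\<lambda>\<omega>. G m (DN m \<omega>))" for m
    using GD G_le by (intro N.integrable_const_bound[where B=K]) auto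
  have path: "continuous_on {0..1} (\<lambda>t. B t \<omega> + \<sigma> * W t \<omega>)" "B 0 \<omega> + \<sigma> * W 0 \<omega> = 0" if "\<omega> \<in> space N" for \<omega>
    using brownian_path(2,3)[OF BB that] brownian_path(2,3)[OF WW that] by (auto intro!: continuous_intros)
  have lim: "(\<lambda>m. G m (DN m \<omega>)) \<longlonglongrightarrow> H \<omega>" if "\<omega> \<in> space N" for \<omega>
    using increment_functional_tendsto[OF f path[OF that]]
    by (simp add: G_def DN_def H_def grid_increment_def[abs_def])
  \<comment> \<open>Path space carries no sigma-algebra here; \<open>H\<close> is measurable as a
    pointwise limit of functions of finitely many increments.\<close>
  have HM: "H \<in> borel_measurable N" by (rule borel_measurable_LIMSEQ_real[OF lim GD])
  have H_le: "\<bar>H \<omega>\<bar> \<le> K" if "\<omega> \<in> space N" for \<omega>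
    using lim[OF that] G_le by (intro LIMSEQ_le_const2[OF tendsto_rabs]) auto
  have iH: "integrable N H" using HM H_le by (intro N.integrable_const_bound[where B=K]) auto
  have limL1: "(\<lambda>m. N.expectation (\<lambda>\<omega>. \<bar>H \<omega> - G m (DN m \<omega>)\<bar>)) \<longlonglongrightarrow> 0"
  proof -
    have "(\<lambda>m. N.expectation (\<lambda>\<omega>. \<bar>H \<omega> - G m (DN m \<omega>)\<bar>)) \<longlonglongrightarrow> N.expectation (\<lambda>\<omega>. 0)"
    proof (rule integral_dominated_convergence[where w="\<lambda>_. 2 * K"])
      show "AE \<omega> in N. (\<lambda>m. \<bar>H \<omega> - G m (DN m \<omega>)\<bar>) \<longlonglongrightarrow> 0"
      proof (rule AE_I2)
        fix \<omega> assume "\<omega> \<in> space N"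
        then have "(\<lambda>m. \<bar>H \<omega> - G m (DN m \<omega>)\<bar>) \<longlonglongrightarrow> \<bar>H \<omega> - H \<omega>\<bar>" by (intro tendsto_intros lim)
        then show "(\<lambda>m. \<bar>H \<omega> - G m (DN m \<omega>)\<bar>) \<longlonglongrightarrow> 0" by simp
      qed
      show "AE \<omega> in N. norm \<bar>H \<omega> - G m (DN m \<omega>)\<bar> \<le> 2 * K" for m
      proof (rule AE_I2)
        fix \<omega> assume "\<omega> \<in> space N"
        then show "norm \<bar>H \<omega> - G m (DN m \<omega>)\<bar> \<le> 2 * K" using H_le[of \<omega>] G_le[of m "DN m \<omega>"] by simp
      qed
    qed (use HM GD in auto)
    then show ?thesis by simp
  qed

  have "weak_conv_m (\<lambda>n. distr M borel (Y n)) (distr N borel Y')"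
  proof (rule levy_continuity)
    show "real_distribution (distr M borel (Y n))" for n
      unfolding Y_def by (rule real_distribution_distr) simp
    show "real_distribution (distr N borel Y')"
      unfolding Y'_def by (rule N.real_distribution_distr) simp
    fix t
    show "(\<lambda>n. char (distr M borel (Y n)) t) \<longlonglongrightarrow> char (distr N borel Y') t"
    proof (rule LIMSEQ_I)
      fix r :: real assume r: "r > 0"
      \<comment> \<open>Three errors share \<open>r\<close>: walk against polynomial, polynomial
        against its limit, and limit process against polynomial. The summand 1 keeps the divisor
        positive for \<open>t = 0\<close>.\<close>
      define \<delta> where "\<delta> = r / (3 * (\<bar>t\<bar> + 1))"
      have \<delta>: "\<delta> > 0" "\<bar>t\<bar> * \<delta> < r / 3" using r by (simp_all add: \<delta>_def field_simps)
      \<comment> \<open>Makes the Lipschitz part \<open>2 * L * e\<close> of the coarse error equal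
        to \<open>\<delta> / 4\<close>.\<close>
      define e where "e = \<delta> / (8 * L)"
      have e: "e > 0" using \<delta> L by (simp add: e_def)
      \<comment> \<open>The mesh is fixed first and must serve both sides: the third condition makes
        the rough event cost at most \<open>\<delta> / 4\<close>, the last one controls the
        interpolation of the limit process.\<close>
      have "\<forall>\<^sub>F m in sequentially. 0 < m \<and> real m \<ge> 16 * (1 + \<sigma>\<^sup>2) / e\<^sup>2
          \<and> real m \<ge> 4 * (2 * K * (512 * (1 + \<sigma>\<^sup>2)\<^sup>2 / e ^ 4)) / \<delta>
          \<and> N.expectation (\<lambda>\<omega>. \<bar>H \<omega> - G m (DN m \<omega>)\<bar>) < \<delta> / 4"
        using \<delta>(1) by (intro eventually_conj eventually_gt_at_top order_tendstoD(2)[OF limL1]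
            filterlim_real_sequentially[unfolded filterlim_at_top, rule_format]) auto
      then obtain m where m: "0 < m" "real m \<ge> 16 * (1 + \<sigma>\<^sup>2) / e\<^sup>2"
          "real m \<ge> 4 * (2 * K * (512 * (1 + \<sigma>\<^sup>2)\<^sup>2 / e ^ 4)) / \<delta>"
          "N.expectation (\<lambda>\<omega>. \<bar>H \<omega> - G m (DN m \<omega>)\<bar>) < \<delta> / 4"
        by (auto simp: eventually_sequentially)
      define e' where "e' = min 1 (\<delta> / 4)"
      have e': "0 < e'" "e' \<le> \<delta> / 4" "e' \<le> 1" using \<delta> by (auto simp: e'_def)
      \<comment> \<open>A common bound for the second moments of the increments of the walk and of
        \<open>B + \<sigma> W\<close>, so that one cut-off \<open>R\<close> and one polynomial work
        for both.\<close>
      define V where "V = 2 * (1 + \<sigma>\<^sup>2)"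
      \<comment> \<open>Solves \<open>(2 * K + 1) * (real m * V / R\<^sup>2) = \<delta> / 4\<close>,
        the cost of leaving the cube; \<open>e' \<le> 1\<close> allows replacing
        \<open>2 * K + e'\<close> by \<open>2 * K + 1\<close>.\<close>
      define R where "R = sqrt ((2 * K + 1) * (real m * V) * 4 / \<delta>)"
      have pos: "(2 * K + 1) * (real m * V) * 4 / \<delta> > 0"
        using K0 m v \<delta> by (intro divide_pos_pos mult_pos_pos) (auto simp: V_def)
      have R: "R > 0" using pos by (simp add: R_def)
      have RV: "(2 * K + e') * (real m * V / R\<^sup>2) \<le> \<delta> / 4"
      proof -
        have "(2 * K + e') * (real m * V / R\<^sup>2) \<le> (2 * K + 1) * (real m * V / R\<^sup>2)"
          using e' v by (intro mult_right_mono divide_nonneg_nonneg mult_nonneg_nonneg) (auto simp: V_def)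
        also have "(2 * K + 1) * (real m * V / R\<^sup>2) = \<delta> / 4"
        proof -
          have R2: "R\<^sup>2 = (2 * K + 1) * (real m * V) * 4 / \<delta>" using pos by (simp add: R_def)
          have "(2 * K + 1) * (real m * V) > 0" using K0 m v by (intro mult_pos_pos) (auto simp: V_def)
          then show ?thesis using \<delta>(1) unfolding R2 by (simp add: field_simps)
        qed
        finally show ?thesis .
      qed
      obtain p where p: "trig_poly m p" "\<And>d. \<bar>p d\<bar> \<le> K + e'"
        "\<And>d. (\<And>j. j \<ge> m \<Longrightarrow> d j = 0) \<Longrightarrow> (\<And>j. j < m \<Longrightarrow> \<bar>d j\<bar> \<le> R) \<Longrightarrow> \<bar>p d - G m d\<bar> \<le> e'"
        using trig_poly_approx[where m=m and G="G m" and K=K and R=R and e=e', OF G_cont G_le R e'(1)] by metis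
      obtain rep where rep: "\<And>d. complex_of_real (p d) = expand (\<lambda>\<theta>. wave m \<theta> d) rep"
        using p(1) unfolding trig_poly_def by blast

      \<comment> \<open>Convergence for the trigonometric polynomial\<close>
      define P where "P n \<omega> = p (walk_increments m n \<omega>)" for n \<omega>
      define P' where "P' \<omega> = p (DN m \<omega>)" for \<omega>
      define Z where "Z n = real_cond_exp M env (P n)" for n
      define Z' where "Z' = real_cond_exp N FW P'"
      have ZP: "integrable M (P n)" "AE \<omega> in M. complex_of_real (Z n \<omega>) = expand (\<lambda>\<theta>. quenched_wave m n \<theta> \<omega>) rep" for n
        unfolding P_def[abs_def] Z_def
        using E.real_cond_exp_expand[OF prob_space_axioms measurable_walk_increments rep measurable_quenched_wave
            cmod_quenched_wave_le quenched_wave_cond[OF m(1)]] by blast+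
      have LW: "limit_wave m \<sigma> W \<theta> \<in> borel_measurable FW" for \<theta>
        unfolding FW_def by (rule measurable_limit_wave[OF W_meas m(1)])
      have ZP': "integrable N P'" "AE \<omega> in N. complex_of_real (Z' \<omega>) = expand (\<lambda>\<theta>. limit_wave m \<sigma> W \<theta> \<omega>) rep"
        unfolding P'_def[abs_def] Z'_def DN_def
        using FW.real_cond_exp_expand[OF N.prob_space_axioms N.mixture_increment_second_moment(3)[OF BB WW] rep LW
            norm_limit_wave_le N.limit_wave_cond[OF BB WW BW m(1), folded FW_def]] by blast+

      have conv: "(\<lambda>n. char (distr M borel (Z n)) t) \<longlonglongrightarrow> char (distr N borel Z') t"
      proof (rule char_tendsto_of_expand[OF prob_space_axioms N.prob_space_axioms _ cmod_quenched_wave_le _ norm_limit_wave_le _ _ ZP(2) _ ZP'(2)])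
        show "quenched_wave m n \<theta> \<in> borel_measurable M" for n \<theta>
          by (rule measurable_from_subalg[OF subalgebra_env measurable_quenched_wave])
        show "limit_wave m \<sigma> W \<theta> \<in> borel_measurable N" for \<theta>
          by (rule measurable_from_subalg[OF subW LW])
        show "(\<lambda>n. expectation (\<lambda>\<omega>. \<Prod>\<theta>\<leftarrow>\<theta>s. quenched_wave m n \<theta> \<omega>))
          \<longlonglongrightarrow> N.expectation (\<lambda>\<omega>. \<Prod>\<theta>\<leftarrow>\<theta>s. limit_wave m \<sigma> W \<theta> \<omega>)" for \<theta>s
          unfolding N.limit_wave_moments[OF WW m(1)] by (rule quenched_wave_moments_tendsto[OF m(1) sq mom(3,4,5)])
      qed (simp_all add: Z_def Z'_def)

      \<comment> \<open>Approximation error for the limit process\<close>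
      have Z'_close: "cmod (char (distr N borel Y') t - char (distr N borel Z') t) \<le> \<bar>t\<bar> * \<delta>"
      proof -
        have "N.expectation (\<lambda>\<omega>. \<bar>G m (DN m \<omega>) - P' \<omega>\<bar>) \<le> e' + (2 * K + e') * (real m * V / R\<^sup>2)"
          unfolding P'_def V_def
        proof (rule N.trig_approx_L1[where G="G m" and D="DN m" and p=p, OF _ _ _ iGD[of m] G_le _ p(2) p(3) R _ K0])
          show "DN m \<omega> j = 0" if "m \<le> j" for \<omega> j using that by (simp add: DN_def grid_increment_def)
          show "integrable N (\<lambda>\<omega>. (DN m \<omega> j)\<^sup>2)" "N.expectation (\<lambda>\<omega>. (DN m \<omega> j)\<^sup>2) \<le> 2 * (1 + \<sigma>\<^sup>2)" for j
            unfolding DN_def by (rule N.mixture_increment_second_moment[OF BB WW])+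
          show "integrable N (\<lambda>\<omega>. p (DN m \<omega>))" using ZP'(1) by (simp add: P'_def[abs_def])
        qed (use e' in auto)
        then have "N.expectation (\<lambda>\<omega>. \<bar>G m (DN m \<omega>) - P' \<omega>\<bar>) \<le> \<delta> / 2" using RV e' by linarith
        moreover have "N.expectation (\<lambda>\<omega>. \<bar>H \<omega> - P' \<omega>\<bar>)
          \<le> N.expectation (\<lambda>\<omega>. \<bar>H \<omega> - G m (DN m \<omega>)\<bar> + \<bar>G m (DN m \<omega>) - P' \<omega>\<bar>)"
          using iH iGD[of m] ZP'(1) by (intro integral_mono) auto
        moreover have "\<dots> = N.expectation (\<lambda>\<omega>. \<bar>H \<omega> - G m (DN m \<omega>)\<bar>) + N.expectation (\<lambda>\<omega>. \<bar>G m (DN m \<omega>) - P' \<omega>\<bar>)"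
          using iH iGD[of m] ZP'(1) by (intro Bochner_Integration.integral_add) auto
        ultimately have "N.expectation (\<lambda>\<omega>. \<bar>H \<omega> - P' \<omega>\<bar>) \<le> \<delta>" using m(4) \<delta>(1) by linarith
        then have "N.expectation (\<lambda>\<omega>. \<bar>Y' \<omega> - Z' \<omega>\<bar>) \<le> \<delta>"
          unfolding Y'_def Z'_def using FW.real_cond_exp_L1_contraction(2)[OF iH ZP'(1)] by linarith
        then have "\<bar>t\<bar> * N.expectation (\<lambda>\<omega>. \<bar>Y' \<omega> - Z' \<omega>\<bar>) \<le> \<bar>t\<bar> * \<delta>" by (intro mult_left_mono) auto
        moreover have "cmod (char (distr N borel Y') t - char (distr N borel Z') t) \<le> \<bar>t\<bar> * N.expectation (\<lambda>\<omega>. \<bar>Y' \<omega> - Z' \<omega>\<bar>)"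
          unfolding Y'_def Z'_def using FW.real_cond_exp_L1_contraction(1)[OF iH ZP'(1)]
          by (intro N.cmod_char_diff_le) auto
        ultimately show ?thesis by linarith
      qed

      \<comment> \<open>Approximation error for the walk\<close>
      have rough_small: "2 * K * (512 * (1 + \<sigma>\<^sup>2)\<^sup>2 / (e ^ 4 * real m)) \<le> \<delta> / 4"
      proof -
        define q where "q = 2 * K * (512 * (1 + \<sigma>\<^sup>2)\<^sup>2 / e ^ 4)"
        have "4 * q \<le> real m * \<delta>"
          using m(3) unfolding q_def[symmetric] by (simp only: pos_divide_le_eq[OF \<delta>(1)])
        then have "q / real m \<le> \<delta> / 4"
          using m(1) by (simp add: pos_divide_le_eq mult.commute)
        then show ?thesis by (simp add: q_def)
      qed
      \<comment> \<open>Four quarters of \<delta>: the Lipschitz part, the rough event, the accuracy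
        \<open>e'\<close> of the polynomial inside the cube, and the cost of leaving the
        cube.\<close>
      have Z_close: "\<forall>\<^sub>F n in sequentially. cmod (char (distr M borel (Y n)) t - char (distr M borel (Z n)) t) \<le> \<bar>t\<bar> * \<delta>"
        using prob_rough_le[OF sq mom(1,2) v e m(1,2)] eventually_gt_at_top[of 0]
      proof eventually_elim
        fix n :: nat assume rough: "prob (rough m n e) \<le> 512 * (1 + \<sigma>\<^sup>2)\<^sup>2 / (e ^ 4 * real m)" and n: "0 < n"
        let ?G = "\<lambda>\<omega>. G m (walk_increments m n \<omega>)"
        have GM: "?G \<in> borel_measurable M"
          by (rule borel_measurable_continuous_sequence[OF G_cont measurable_walk_increments])
        have iG: "integrable M ?G" using GM G_le by (intro integrable_const_bound[where B=K]) auto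
        have "expectation (\<lambda>\<omega>. \<bar>F n \<omega> - ?G \<omega>\<bar>) \<le> 2 * L * e + 2 * K * prob (rough m n e)"
          unfolding F_def G_def by (rule coarse_approx_L1[OF f K L m(1) n e])
        moreover have "2 * K * prob (rough m n e) \<le> 2 * K * (512 * (1 + \<sigma>\<^sup>2)\<^sup>2 / (e ^ 4 * real m))"
          using K0 rough by (intro mult_left_mono) auto
        moreover have "2 * L * e = \<delta> / 4" using L by (simp add: e_def)
        ultimately have 1: "expectation (\<lambda>\<omega>. \<bar>F n \<omega> - ?G \<omega>\<bar>) \<le> \<delta> / 2"
          using rough_small by linarith
        have "expectation (\<lambda>\<omega>. \<bar>?G \<omega> - P n \<omega>\<bar>) \<le> e' + (2 * K + e') * (real m * V / R\<^sup>2)"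
          unfolding P_def
        proof (rule trig_approx_L1[where G="G m" and D="walk_increments m n" and p=p, OF _ _ _ iG G_le _ p(2) p(3) R _ K0])
          show "walk_increments m n \<omega> j = 0" if "m \<le> j" for \<omega> j using that by (simp add: block_increment_def)
          show "integrable M (\<lambda>\<omega>. (walk_increments m n \<omega> j)\<^sup>2)" for j
            using walk_increments_second_moment[OF sq mom(1,2)] by blast
          show "expectation (\<lambda>\<omega>. (walk_increments m n \<omega> j)\<^sup>2) \<le> V" for j
            using walk_increments_second_moment[OF sq mom(1,2), of m n j] v by (simp add: V_def)
          show "integrable M (\<lambda>\<omega>. p (walk_increments m n \<omega>))" using ZP(1)[of n] by (simp add: P_def[abs_def])
        qed (use e' in auto)
        then have 2: "expectation (\<lambda>\<omega>. \<bar>?G \<omega> - P n \<omega>\<bar>) \<le> \<delta> / 2" using RV e' by linarith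
        have "expectation (\<lambda>\<omega>. \<bar>F n \<omega> - P n \<omega>\<bar>) \<le> expectation (\<lambda>\<omega>. \<bar>F n \<omega> - ?G \<omega>\<bar> + \<bar>?G \<omega> - P n \<omega>\<bar>)"
          using iF[of n] iG ZP(1)[of n] by (intro integral_mono) auto
        also have "\<dots> = expectation (\<lambda>\<omega>. \<bar>F n \<omega> - ?G \<omega>\<bar>) + expectation (\<lambda>\<omega>. \<bar>?G \<omega> - P n \<omega>\<bar>)"
          using iF[of n] iG ZP(1)[of n] by (intro Bochner_Integration.integral_add) auto
        finally have "expectation (\<lambda>\<omega>. \<bar>F n \<omega> - P n \<omega>\<bar>) \<le> \<delta>" using 1 2 by linarith
        then have "expectation (\<lambda>\<omega>. \<bar>Y n \<omega> - Z n \<omega>\<bar>) \<le> \<delta>"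
          unfolding Y_def Z_def using E.real_cond_exp_L1_contraction(2)[OF iF ZP(1), of n n] by linarith
        then have "\<bar>t\<bar> * expectation (\<lambda>\<omega>. \<bar>Y n \<omega> - Z n \<omega>\<bar>) \<le> \<bar>t\<bar> * \<delta>" by (intro mult_left_mono) auto
        moreover have "cmod (char (distr M borel (Y n)) t - char (distr M borel (Z n)) t) \<le> \<bar>t\<bar> * expectation (\<lambda>\<omega>. \<bar>Y n \<omega> - Z n \<omega>\<bar>)"
          unfolding Y_def Z_def using E.real_cond_exp_L1_contraction(1)[OF iF ZP(1), of n n]
          by (intro cmod_char_diff_le) auto
        ultimately show "cmod (char (distr M borel (Y n)) t - char (distr M borel (Z n)) t) \<le> \<bar>t\<bar> * \<delta>" by linarith
      qed
      have "\<forall>\<^sub>F n in sequentially. cmod (char (distr M borel (Z n)) t - char (distr N borel Z') t) < r / 3"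
        using conv[unfolded tendsto_iff dist_norm, rule_format, of "r / 3"] r by (simp only: zero_less_divide_iff, simp)
      with Z_close have "\<forall>\<^sub>F n in sequentially. cmod (char (distr M borel (Y n)) t - char (distr N borel Y') t) < r"
      proof eventually_elim
        case (elim n)
        have "char (distr M borel (Y n)) t - char (distr N borel Y') t
          = (char (distr M borel (Y n)) t - char (distr M borel (Z n)) t) + (char (distr M borel (Z n)) t - char (distr N borel Z') t)
            - (char (distr N borel Y') t - char (distr N borel Z') t)" by simp
        also have "cmod \<dots> \<le> cmod (char (distr M borel (Y n)) t - char (distr M borel (Z n)) t)
            + cmod (char (distr M borel (Z n)) t - char (distr N borel Z') t)
            + cmod (char (distr N borel Y') t - char (distr N borel Z') t)"
          by (meson add_mono norm_triangle_ineq norm_triangle_ineq4 order_refl order_trans)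
        finally show ?case using elim Z'_close \<delta>(2) by linarith
      qed
      then show "\<exists>no. \<forall>n\<ge>no. norm (char (distr M borel (Y n)) t - char (distr N borel Y') t) < r"
        by (simp add: eventually_sequentially)
    qed
  qed
  then show ?thesis
    unfolding Y_def Y'_def F_def H_def FW_def quenched_exp_def .
qed

end
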